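(* Let $d\ge 2$, let $W\subset\mathbb R^d$ be a convex body of unit volume, let $L\subset\mathbb R^d$ be a plane (two-dimensional linear subspace), let $\mathcal G_t$ be any random geometric graph on $W$ with vertex and edge markings as defined in the context, let $g(x)$ be the probability that two points at distance $x$ are connected by an edge, and let $X_t(L)$ be the number of edge crossings of $\mathcal G_t$ when projected onto $L$. Then there exist positive constants $c_1,c_1'$ and $c_2,c_2'$ depending only on $W$ such that \[c_1' t^4 \left[ \int_0^{c_1} g(x) x^{d} \,\mathrm dx \right]^2 \leq \mathbb E X_t(L)\leq c_2' t^4 \left[ \int_0^{c_2} g(x) x^{d} \,\mathrm dx\right]^2.\] Further, if there exists $(R_t)_{t>0}$ with $R_t\to 0$ as $t\to\infty$ such that \[\int_{R_t}^{c_2} g(x) x^{d} \,\mathrm dx = o_t\left(\int_0^{R_t} g(x) x^{d} \,\mathrm dx\right),\] then \[\mathbb E X_t(L) = t^4 \left[\int_0^{R_t} g(x) x^{d}\,\mathrm dx\right]^2 \frac 18\, c_d (d+1)^2 I_W(L)\,\bigl(1 +\mathcal O_t(R_t)\bigr) \left(1+\mathcal O_t\left(\frac{\int_{R_t}^{c_2}g(x) x^{d}\,\mathrm dx}{\int_0^{R_t}g(x) x^{d}\,\mathrm dx}\right)\right),\] where \[c_d= 2\pi\kappa_{d-2}^2\, \mathbf B\left(\tfrac 32, \tfrac d2\right)^2,\qquad I_W(L)= \int_{L}\lambda_{d-2}\bigl(W\cap (v+L^\perp)\bigr)^2\,\mathrm dv.\]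
   Context: Model: $\eta_t$ is a homogeneous Poisson point process in $W$ with intensity $t>0$. Each $y\in\eta_t$ carries a mark $R_y\in[0,\infty)$, i.i.d. with law $\kappa_v$, and each unordered pair of distinct points $y,z\in\eta_t$ carries a mark $W_{y,z}\in[0,\infty)$, i.i.d. with law $\kappa_e$; the vertex marks, edge marks and point process are independent. Given a measurable $\varphi:[0,\infty)^3\to[0,\infty)$, $\mathcal G_t$ has vertex set $\eta_t$, and distinct $y,z$ are joined by an edge (written $y\leftrightarrow z$) if and only if $\|y-z\|\le\varphi(R_y,R_z,W_{y,z})$. The mark laws and $\varphi$ (hence $g$) may depend on $t$. The connection function is $g(x)=\mathbb P(\varphi(R_y,R_z,W_{y,z})\ge x)$. Crossings: for a set $A$ let $A|_L$ be its orthogonal projection onto $L$, and let $[u,v]$ be the line segment between $u,v$. Put $h_L(v_1,v_2,v_3,v_4)=\mathbf 1(v_1\leftrightarrow v_2, v_3\leftrightarrow v_4, [v_1,v_2]|_L\cap[v_3,v_4]|_L\ne\emptyset)+\mathbf 1(v_1\leftrightarrow v_3, v_2\leftrightarrow v_4, [v_1,v_3]|_L\cap[v_2,v_4]|_L\ne\emptyset)+\mathbf 1(v_1\leftrightarrow v_4, v_2\leftrightarrow v_3, [v_1,v_4]|_L\cap[v_2,v_3]|_L\ne\emptyset)$, and $X_t(L)=\frac1{24}\sum h_L(v_1,v_2,v_3,v_4)$, the sum running over all ordered 4-tuples of pairwise distinct points of $\eta_t$. Notation: a convex body is a compact convex set with non-empty interior; $\lambda_k$ is $k$-dimensional Lebesgue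 measure ($\lambda_0$ is counting measure); $\kappa_k$ is the volume of the $k$-dimensional unit ball ($\kappa_0=1$); $L^\perp$ is the orthogonal complement of $L$; $\mathbf B(a,b)=\int_0^1 s^{a-1}(1-s)^{b-1}\,\mathrm ds$. Subscript $t$ in $o_t,\mathcal O_t$ means asymptotics as $t\to\infty$. *)

theory Defs
  imports "HOL-Probability.Probability" "HOL-Library.Landau_Symbols"
begin

section \<open>Orthogonal projection and Lebesgue measure on a linear subspace\<close>

definition orth_proj :: "'a::euclidean_space set \<Rightarrow> 'a \<Rightarrow> 'a" where
  "orth_proj L x = (THE p. p \<in> L \<and> x - p \<in> L\<^sup>\<bottom>)"

definition orthonormal_basis :: "'a::euclidean_space set \<Rightarrow> 'a set \<Rightarrow> bool" where
  "orthonormal_basis S B \<longleftrightarrow>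
     B \<subseteq> S \<and> pairwise orthogonal B \<and> (\<forall>b\<in>B. norm b = 1) \<and> span B = S"

text \<open>The (dim S)-dimensional Lebesgue measure on a linear subspace \<open>S\<close>, as a Borel measure
  on the ambient space concentrated on \<open>S\<close>. The construction is that of \<^const>\<open>lborel\<close>, with
  an orthonormal basis of \<open>S\<close> in place of \<^const>\<open>Basis\<close>; by rotation invariance it does not
  depend on the basis. For \<open>S = {0}\<close> the basis is empty and the result is
  the unit mass at 0, that is, the counting measure on \<open>S\<close>.\<close>

definition subspace_lborel :: "'a::euclidean_space set \<Rightarrow> 'a measure" where
  "subspace_lborel S =
     (let B = (SOME B. orthonormal_basis S B)
      in distr (\<Pi>\<^sub>M b\<in>B. (lborel :: real measure)) borel (\<lambda>f. \<Sum>b\<in>B. f b *\<^sub>R b))"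

text \<open>The volume of \<open>W \<inter> (v + L\<^sup>\<bottom>)\<close> in the flat \<open>v + L\<^sup>\<bottom>\<close>, computed after translation by
  \<open>-v\<close>.\<close>

definition fibre_volume :: "'a::euclidean_space set \<Rightarrow> 'a set \<Rightarrow> 'a \<Rightarrow> real" where
  "fibre_volume W L v = measure (subspace_lborel (L\<^sup>\<bottom>)) {x \<in> L\<^sup>\<bottom>. v + x \<in> W}"

definition I_W :: "'a::euclidean_space set \<Rightarrow> 'a set \<Rightarrow> real" where
  "I_W W L = (\<integral>v. (fibre_volume W L v)\<^sup>2 \<partial>subspace_lborel L)"

definition c_const :: "nat \<Rightarrow> real" where
  "c_const d = 2 * pi * (unit_ball_vol (real (d - 2)))\<^sup>2 * (Beta (3 / 2) (real d / 2))\<^sup>2"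


section \<open>Random geometric graphs with vertex and edge marks\<close>

text \<open>The points of the process are labelled: a configuration \<open>(n, y)\<close> stands for the finite set
  \<open>{y 0, \<dots>, y (n - 1)}\<close>. Labels are needed in order to attach i.i.d. marks measurably to the
  points of a random set. The entries \<open>y i\<close> with \<open>i \<ge> n\<close> play no role.\<close>

type_synonym 'a config = "nat \<times> (nat \<Rightarrow> 'a)"

definition points :: "'a config \<Rightarrow> 'a set" where
  "points \<omega> = snd \<omega> ` {..<fst \<omega>}"

text \<open>\<open>P\<close> is the law of some enumeration without repetitions of a Poisson point process in
  \<open>W\<close> with intensity \<open>t\<close>: counts in Borel sets are Poisson distributed, and counts in finitely many
  disjoint Borel sets are independent. That almost surely all points lie in \<open>W\<close> is the
  case \<open>A = -W\<close>. Nothing is assumed about the order of the enumeration.\<close>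

definition poisson_process :: "'a::euclidean_space set \<Rightarrow> real \<Rightarrow> 'a config measure \<Rightarrow> bool" where
  "poisson_process W t P \<longleftrightarrow>
     prob_space P \<and>
     sets P = sets (count_space UNIV \<Otimes>\<^sub>M (\<Pi>\<^sub>M i\<in>UNIV. borel)) \<and>
     (AE \<omega> in P. inj_on (snd \<omega>) {..<fst \<omega>}) \<and>
     (\<forall>A\<in>sets borel. \<forall>k. measure P {\<omega> \<in> space P. card (points \<omega> \<inter> A) = k} =
        (t * measure lborel (W \<inter> A)) ^ k / fact k * exp (- (t * measure lborel (W \<inter> A)))) \<and>
     (\<forall>m. \<forall>A :: nat \<Rightarrow> 'a set.
        (\<forall>i<m. A i \<in> sets borel) \<and> disjoint_family_on A {..<m} \<longrightarrow>
        prob_space.indep_vars P (\<lambda>_. count_space UNIV) (\<lambda>i \<omega>. card (points \<omega> \<inter> A i)) {..<m})"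

abbreviation nonneg_borel :: "real measure" where
  "nonneg_borel \<equiv> restrict_space borel {0..}"

text \<open>\<open>\<phi>\<close> is not required to be symmetric in its first two arguments.\<close>

definition marked_model ::
  "'a::euclidean_space set \<Rightarrow> real \<Rightarrow> 'a config measure \<Rightarrow> real measure \<Rightarrow> real measure \<Rightarrow>
   (real \<Rightarrow> real \<Rightarrow> real \<Rightarrow> real) \<Rightarrow> bool" where
  "marked_model W t P \<kappa>v \<kappa>e \<phi> \<longleftrightarrow>
     poisson_process W t P \<and>
     prob_space \<kappa>v \<and> sets \<kappa>v = sets nonneg_borel \<and>
     prob_space \<kappa>e \<and> sets \<kappa>e = sets nonneg_borel \<and>
     (\<lambda>(a, b, w). \<phi> a b w) \<in>
       nonneg_borel \<Otimes>\<^sub>M nonneg_borel \<Otimes>\<^sub>M nonneg_borel \<rightarrow>\<^sub>M nonneg_borel"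

text \<open>An outcome consists of the labelled points, the vertex marks indexed by labels, and the
  edge marks indexed by unordered pairs of distinct labels. The marks are i.i.d. and
  independent of each other and of the points, which is to say that their joint law is
  the product measure. Any realization of the model on another probability space has a law of
  this form, and expectations depend on that law only.\<close>

type_synonym 'a outcome = "'a config \<times> (nat \<Rightarrow> real) \<times> (nat set \<Rightarrow> real)"

definition rgg_space ::
  "'a config measure \<Rightarrow> real measure \<Rightarrow> real measure \<Rightarrow> 'a outcome measure" where
  "rgg_space P \<kappa>v \<kappa>e =
     P \<Otimes>\<^sub>M (\<Pi>\<^sub>M i\<in>UNIV. \<kappa>v) \<Otimes>\<^sub>M (\<Pi>\<^sub>M e\<in>{e. card e = 2}. \<kappa>e)"

definition connection_fun ::
  "real measure \<Rightarrow> real measure \<Rightarrow> (real \<Rightarrow> real \<Rightarrow> real \<Rightarrow> real) \<Rightarrow> real \<Rightarrow> real" where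
  "connection_fun \<kappa>v \<kappa>e \<phi> x =
     measure (\<kappa>v \<Otimes>\<^sub>M \<kappa>v \<Otimes>\<^sub>M \<kappa>e)
       {z \<in> space (\<kappa>v \<Otimes>\<^sub>M \<kappa>v \<Otimes>\<^sub>M \<kappa>e). case z of (a, b, w) \<Rightarrow> \<phi> a b w \<ge> x}"

definition edge ::
  "(real \<Rightarrow> real \<Rightarrow> real \<Rightarrow> real) \<Rightarrow> 'a::euclidean_space outcome \<Rightarrow> nat \<Rightarrow> nat \<Rightarrow> bool" where
  "edge \<phi> \<omega> i j \<longleftrightarrow> (case \<omega> of ((n, y), r, w) \<Rightarrow> norm (y i - y j) \<le> \<phi> (r i) (r j) (w {i, j}))"

definition segments_meet ::
  "'a::euclidean_space set \<Rightarrow> 'a outcome \<Rightarrow> nat \<Rightarrow> nat \<Rightarrow> nat \<Rightarrow> nat \<Rightarrow> bool" where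
  "segments_meet L \<omega> i j k l \<longleftrightarrow> (case \<omega> of ((n, y), r, w) \<Rightarrow>
     orth_proj L ` closed_segment (y i) (y j) \<inter> orth_proj L ` closed_segment (y k) (y l) \<noteq> {})"

definition h_cross ::
  "(real \<Rightarrow> real \<Rightarrow> real \<Rightarrow> real) \<Rightarrow> 'a::euclidean_space set \<Rightarrow> 'a outcome \<Rightarrow>
   nat \<Rightarrow> nat \<Rightarrow> nat \<Rightarrow> nat \<Rightarrow> real" where
  "h_cross \<phi> L \<omega> i j k l =
     of_bool (edge \<phi> \<omega> i j \<and> edge \<phi> \<omega> k l \<and> segments_meet L \<omega> i j k l) +
     of_bool (edge \<phi> \<omega> i k \<and> edge \<phi> \<omega> j l \<and> segments_meet L \<omega> i k j l) +
     of_bool (edge \<phi> \<omega> i l \<and> edge \<phi> \<omega> j k \<and> segments_meet L \<omega> i l j k)"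

text \<open>Almost surely distinct labels below \<open>n\<close> carry distinct points, so the sum over
  4-tuples of distinct labels is the sum over 4-tuples of distinct points.\<close>

definition crossings ::
  "(real \<Rightarrow> real \<Rightarrow> real \<Rightarrow> real) \<Rightarrow> 'a::euclidean_space set \<Rightarrow> 'a outcome \<Rightarrow> real" where
  "crossings \<phi> L \<omega> = 1 / 24 *
     (\<Sum>(i, j, k, l) \<in> {(i, j, k, l). {i, j, k, l} \<subseteq> {..<fst (fst \<omega>)} \<and> distinct [i, j, k, l]}.
        h_cross \<phi> L \<omega> i j k l)"

definition expected_crossings ::
  "'a::euclidean_space config measure \<Rightarrow> real measure \<Rightarrow> real measure \<Rightarrow>
   (real \<Rightarrow> real \<Rightarrow> real \<Rightarrow> real) \<Rightarrow> 'a set \<Rightarrow> real" where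
  "expected_crossings P \<kappa>v \<kappa>e \<phi> L = prob_space.expectation (rgg_space P \<kappa>v \<kappa>e) (crossings \<phi> L)"

end

theory Submission
  imports Defs
begin

text \<open>By the factorial moment formula for Poisson processes, the expected number of crossings is
  \<open>t\<^sup>4/8\<close> times an integral over pairs of edge vectors \<open>u\<close>, \<open>z\<close> of \<open>g(norm u) g(norm z)\<close> times the volume of the set of
  positions \<open>v\<close>, \<open>w\<close> for which the edges \<open>[v, v + u]\<close> and \<open>[w, w + z]\<close> lie in \<open>W\<close> and cross after projection.
  The change of variables \<open>w - v = s u - r z\<close> modulo \<open>L\<^sup>\<bottom>\<close> turns that volume into
  \<open>\<bar>det(u, z)\<bar>\<close> times an average over \<open>s, r \<in> [0, 1]\<close> of \<open>\<integral>\<^sub>L h\<^sub>1 h\<^sub>2\<close>, where \<open>h\<^sub>1\<close>, \<open>h\<^sub>2\<close> are the fibre volumes of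
  \<open>(W + s u) \<inter> (W - (1 - s) u)\<close> and \<open>(W + r z) \<inter> (W - (1 - r) z)\<close>. By convexity these sets are contained in \<open>W\<close>
  and fill \<open>W\<close> up to a volume of order \<open>norm u\<close> and \<open>norm z\<close>, so the average is \<open>I_W W L\<close> up to a relative
  error of that order. The remaining integral of \<open>\<bar>det(u, z)\<bar> g(norm u) g(norm z)\<close> is computed exactly from the homogeneity of the
  determinant. All constants involve only an inscribed ball and the diameter of \<open>W\<close>.\<close>

text \<open>Two demands shape the proof. The constants may depend on \<open>W\<close> only, while
  the main term contains \<open>I_W W L\<close>; so \<open>I_W W L\<close> is bounded above and
  below by quantities free of \<open>L\<close>, and the error of the crossing volume is linear in
  the edge lengths with a slope free of \<open>L\<close>. Moreover the mark laws and the connection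
  function vary with t, so each estimate is proved at one intensity for arbitrary marks, and
  asymptotics enter only in \<open>expansion_errors\<close>. The Poisson process is given by its
  counts in disjoint sets. They determine the factorial moment measure off the diagonals, which is
  enough because neither side of the moment formula charges the diagonals. The prefactor 1/8 is
  3/24, as the three pairings of four points have the same mean. The factor g(norm u) g(norm z) is a
  product because two edges with four distinct ends share no mark. The constant
  \<open>c_const\<close> arises from two averages: that of the determinant over u leaves the norm of
  the projection of z, which is then averaged over z.\<close>

lemma nn_integral_lborel_translate:
  fixes f :: "'a::euclidean_space \<Rightarrow> ennreal"
  assumes [measurable]: "f \<in> borel_measurable borel"
  shows "(\<integral>\<^sup>+x. f (a + x) \<partial>lborel) = (\<integral>\<^sup>+x. f x \<partial>lborel)"
  by (subst (2) lborel_distr_plus[of a, symmetric]) (simp add: nn_integral_distr)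

lemma nn_integral_lborel_reflect:
  fixes f :: "'a::euclidean_space \<Rightarrow> ennreal"
  assumes [measurable]: "f \<in> borel_measurable borel"
  shows "(\<integral>\<^sup>+x. f (a - x) \<partial>lborel) = (\<integral>\<^sup>+x. f x \<partial>lborel)"
proof -
  have "(\<integral>\<^sup>+x. f x \<partial>lborel) = (\<integral>\<^sup>+x. f x \<partial>density (distr lborel borel (\<lambda>x. a + (-1) *\<^sub>R x)) (\<lambda>_. ennreal (\<bar>-1\<bar> ^ DIM('a))))"
    using lborel_affine[of "-1" a] by simp
  also have "\<dots> = (\<integral>\<^sup>+x. f (a - x) \<partial>lborel)"
    by (simp add: nn_integral_distr nn_integral_density)
  finally show ?thesis by simp
qed

text \<open>Evaluating \<open>\<integral>\<integral> 1\<^sub>A(x) 1\<^sub>B(y) \<partial>\<lambda>(y) \<partial>M(x)\<close> with the substitutions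
  \<open>y \<mapsto> x + y\<close> and then \<open>x \<mapsto> x - y\<close> exchanges the roles of \<open>M\<close> and \<open>\<lambda>\<close>.\<close>

lemma lborel_eqI_translation:
  fixes M :: "'a::euclidean_space measure"
  assumes sM[measurable_cong]: "sets M = sets borel" and sf: "sigma_finite_measure M"
    and tr: "\<And>a. distr M borel ((+) a) = M"
    and ball: "emeasure M (cball 0 1) = emeasure lborel (cball 0 1 :: 'a set)"
  shows "M = lborel"
proof (rule measure_eqI)
  show "sets M = sets lborel" by (simp add: sM)
  fix A assume "A \<in> sets M"
  then have A[measurable]: "A \<in> sets borel" by (simp add: sM)
  let ?B = "cball 0 1 :: 'a set"
  have [measurable]: "?B \<in> sets borel" by simp
  interpret M: sigma_finite_measure M by fact
  interpret pair_sigma_finite M "lborel :: 'a measure" ..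
  have trM: "(\<integral>\<^sup>+x. f (a + x) \<partial>M) = (\<integral>\<^sup>+x. f x \<partial>M)" if [measurable]: "f \<in> borel_measurable borel" for f :: "'a \<Rightarrow> ennreal" and a
    by (subst (2) tr[of a, symmetric]) (simp add: nn_integral_distr)
  have "emeasure M A * emeasure lborel ?B = (\<integral>\<^sup>+x. indicator A x * (\<integral>\<^sup>+y. indicator ?B y \<partial>lborel) \<partial>M)"
    by (simp add: nn_integral_multc)
  also have "\<dots> = (\<integral>\<^sup>+x. indicator A x * (\<integral>\<^sup>+y. indicator ?B (x + y) \<partial>lborel) \<partial>M)"
    by (subst nn_integral_lborel_translate[of "indicator ?B"]) (auto intro!: borel_measurable_indicator)
  also have "\<dots> = (\<integral>\<^sup>+x. (\<integral>\<^sup>+y. indicator A x * indicator ?B (x + y) \<partial>lborel) \<partial>M)"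
    by (simp add: nn_integral_cmult)
  also have "\<dots> = (\<integral>\<^sup>+y. (\<integral>\<^sup>+x. indicator A x * indicator ?B (x + y) \<partial>M) \<partial>lborel)"
    by (rule Fubini'[symmetric]) measurable
  also have "\<dots> = (\<integral>\<^sup>+y. (\<integral>\<^sup>+x. indicator A (- y + x) * indicator ?B x \<partial>M) \<partial>lborel)"
    proof (rule nn_integral_cong)
    fix y :: 'a
    show "(\<integral>\<^sup>+x. indicator A x * indicator ?B (x + y) \<partial>M) = (\<integral>\<^sup>+x. indicator A (- y + x) * indicator ?B x \<partial>M)"
      using trM[of "\<lambda>x. indicator A (- y + x) * indicator ?B x" y] by (simp add: add.commute)
  qed
  also have "\<dots> = (\<integral>\<^sup>+x. (\<integral>\<^sup>+y. indicator A (- y + x) * indicator ?B x \<partial>lborel) \<partial>M)"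
    by (rule Fubini') measurable
  also have "\<dots> = (\<integral>\<^sup>+x. (\<integral>\<^sup>+y. indicator A (x - y) \<partial>lborel) * indicator ?B x \<partial>M)"
    by (simp add: nn_integral_multc)
  also have "\<dots> = emeasure lborel A * emeasure M ?B"
    by (subst nn_integral_lborel_reflect) (auto simp: nn_integral_cmult sM)
  finally have "emeasure M A * emeasure lborel ?B = emeasure lborel A * emeasure lborel ?B"
    by (simp add: ball)
  \<comment> \<open>The mass of the unit ball is finite and positive, so it can be
    cancelled.\<close>
  moreover have "emeasure lborel ?B = ennreal (unit_ball_vol (DIM('a)))"
    by (subst emeasure_cball) auto
  moreover have "unit_ball_vol (DIM('a)) > 0" by simp
  ultimately show "emeasure M A = emeasure lborel A"
    by (metis ennreal_eq_zero_iff ennreal_mult_cancel_left ennreal_neq_top less_le_not_le mult.commute)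
qed

section \<open>Lebesgue measure on a subspace\<close>

text \<open>The construction of \<open>subspace_lborel\<close> with the basis as a parameter:
  properties are proved for every orthonormal basis, so the choice made by \<open>SOME\<close> never
  matters.\<close>

definition onb_lborel :: "'a::euclidean_space set \<Rightarrow> 'a measure" where
  "onb_lborel B = distr (\<Pi>\<^sub>M b\<in>B. (lborel :: real measure)) borel (\<lambda>f. \<Sum>b\<in>B. f b *\<^sub>R b)"

definition subspace_basis :: "'a::euclidean_space set \<Rightarrow> 'a set" where
  "subspace_basis S = (SOME B. orthonormal_basis S B)"

lemma subspace_lborel_onb: "subspace_lborel S = onb_lborel (subspace_basis S)"
  by (simp add: subspace_lborel_def onb_lborel_def subspace_basis_def Let_def)

lemma orthonormal_basis_subspace_basis:
  assumes "subspace S" shows "orthonormal_basis S (subspace_basis S)"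
  unfolding subspace_basis_def
  by (rule someI_ex) (metis orthonormal_basis_subspace[OF assms] orthonormal_basis_def)

lemma orthonormal_basis_inner:
  assumes "orthonormal_basis S B" "b \<in> B" "c \<in> B"
  shows "b \<bullet> c = of_bool (b = c)"
  using assms by (auto simp: orthonormal_basis_def pairwise_def orthogonal_def norm_eq_1)

lemma orthonormal_basis_finite:
  assumes "orthonormal_basis S B" shows "finite B"
  using assms unfolding orthonormal_basis_def
  by (metis pairwise_orthogonal_imp_finite)

lemma orthonormal_basis_card:
  assumes "orthonormal_basis S B" shows "card B = dim S"
proof -
  have "0 \<notin> B" using assms unfolding orthonormal_basis_def by (metis norm_zero zero_neq_one)
  then have "independent B" using assms unfolding orthonormal_basis_def
    by (metis pairwise_orthogonal_independent)
  then show ?thesis using assms unfolding orthonormal_basis_def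
    by (metis dim_span_eq_card_independent)
qed

lemma norm_onb_sum:
  assumes "orthonormal_basis S B"
  shows "norm (\<Sum>b\<in>B. f b *\<^sub>R b) = sqrt (\<Sum>b\<in>B. (f b)\<^sup>2)"
proof -
  have fin: "finite B" by (rule orthonormal_basis_finite[OF assms])
  have "c \<bullet> (\<Sum>b\<in>B. f b *\<^sub>R b) = f c" if "c \<in> B" for c
  proof -
    have "c \<bullet> (\<Sum>b\<in>B. f b *\<^sub>R b) = (\<Sum>b\<in>B. f b * of_bool (c = b))"
      unfolding inner_sum_right by (intro sum.cong refl) (simp add: orthonormal_basis_inner[OF assms that])
    then show ?thesis using fin that by (simp add: of_bool_def if_distrib sum.delta' cong: if_cong)
  qed
  then have "(norm (\<Sum>b\<in>B. f b *\<^sub>R b))\<^sup>2 = (\<Sum>b\<in>B. (f b)\<^sup>2)"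
    by (simp add: power2_norm_eq_inner inner_sum_left) (simp add: power2_eq_square)
  then show ?thesis by (metis norm_ge_zero real_sqrt_unique)
qed

lemma onb_repr:
  assumes B: "orthonormal_basis S B" and x: "x \<in> S"
  shows "x = (\<Sum>b\<in>B. (x \<bullet> b) *\<^sub>R b)"
proof -
  have fin: "finite B" by (rule orthonormal_basis_finite[OF B])
  have "x \<in> span B" using B x by (simp add: orthonormal_basis_def)
  then obtain u where u: "x = (\<Sum>b\<in>B. u b *\<^sub>R b)"
    using span_finite[OF fin] by auto
  have "x \<bullet> c = u c" if "c \<in> B" for c
  proof -
    have "x \<bullet> c = (\<Sum>b\<in>B. u b * of_bool (b = c))"
      unfolding u inner_sum_left by (intro sum.cong refl) (simp add: orthonormal_basis_inner[OF B _ that])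
    then show ?thesis using fin that by (simp add: of_bool_def if_distrib sum.delta cong: if_cong)
  qed
  then show ?thesis using u by (metis (no_types, lifting) sum.cong)
qed

lemma sets_onb_lborel[simp, measurable_cong]: "sets (onb_lborel B) = sets borel"
  by (simp add: onb_lborel_def)

lemma space_onb_lborel[simp]: "space (onb_lborel B) = UNIV"
  by (simp add: onb_lborel_def)

lemma nn_integral_onb_lborel:
  assumes [measurable]: "f \<in> borel_measurable borel"
  shows "(\<integral>\<^sup>+x. f x \<partial>onb_lborel B) = (\<integral>\<^sup>+\<omega>. f (\<Sum>b\<in>B. \<omega> b *\<^sub>R b) \<partial>(\<Pi>\<^sub>M b\<in>B. (lborel :: real measure)))"
  unfolding onb_lborel_def by (subst nn_integral_distr) auto

text \<open>It is enough to compare boxes, whose preimages are boxes with translated sides.\<close>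

lemma distr_PiM_lborel_translate:
  assumes "finite B"
  shows "distr (\<Pi>\<^sub>M b\<in>B. (lborel :: real measure)) (\<Pi>\<^sub>M b\<in>B. lborel) (\<lambda>\<omega>. \<lambda>b\<in>B. a b + \<omega> b) = (\<Pi>\<^sub>M b\<in>B. lborel)"
proof -
  interpret product_sigma_finite "\<lambda>_. lborel :: real measure" ..
  interpret finite_product_sigma_finite "\<lambda>_. lborel :: real measure" B by standard fact
  show ?thesis
  proof (rule PiM_eqI[OF assms])
    fix A assume A: "\<And>i. i \<in> B \<Longrightarrow> A i \<in> sets (lborel :: real measure)"
    have [measurable]: "A i \<in> sets borel" if "i \<in> B" for i using A[OF that] by simp
    have "emeasure (distr (\<Pi>\<^sub>M b\<in>B. (lborel :: real measure)) (\<Pi>\<^sub>M b\<in>B. lborel) (\<lambda>\<omega>. \<lambda>b\<in>B. a b + \<omega> b)) (Pi\<^sub>E B A)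
      = emeasure (\<Pi>\<^sub>M b\<in>B. (lborel :: real measure)) (Pi\<^sub>E B (\<lambda>i. (+) (a i) -` A i))"
      proof (subst emeasure_distr)
        show "Pi\<^sub>E B A \<in> sets (\<Pi>\<^sub>M b\<in>B. lborel)" by (rule sets_PiM_I_finite[OF assms A])
      qed (auto intro!: arg_cong2[where f=emeasure] simp: space_PiM PiE_def Pi_def extensional_def)
    also have "\<dots> = (\<Prod>i\<in>B. emeasure lborel ((+) (a i) -` A i))"
    proof (subst emeasure_PiM[OF assms])
      fix i assume "i \<in> B"
      then have "A i \<in> sets borel" by measurable
      then have "(+) (a i) -` A i \<inter> space borel \<in> sets borel"
        by (intro measurable_sets[of "(+) (a i)" borel borel]) auto
      then show "(+) (a i) -` A i \<in> sets lborel" by simp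
    qed simp
    also have "\<dots> = (\<Prod>i\<in>B. emeasure lborel (A i))"
    proof (rule prod.cong[OF refl])
      fix i assume "i \<in> B"
      then show "emeasure lborel ((+) (a i) -` A i) = emeasure lborel (A i)"
        by (subst (2) lborel_distr_plus[of "a i", symmetric]) (simp add: emeasure_distr)
    qed
    finally show "emeasure (distr (\<Pi>\<^sub>M b\<in>B. (lborel :: real measure)) (\<Pi>\<^sub>M b\<in>B. lborel) (\<lambda>\<omega>. \<lambda>b\<in>B. a b + \<omega> b)) (Pi\<^sub>E B A)
      = (\<Prod>i\<in>B. emeasure lborel (A i))" .
  qed auto
qed

lemma distr_onb_lborel_translate:
  assumes B: "orthonormal_basis S B" and x: "x \<in> S"
  shows "distr (onb_lborel B) borel ((+) x) = onb_lborel B"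
proof -
  have fin: "finite B" by (rule orthonormal_basis_finite[OF B])
  have "onb_lborel B = distr (distr (\<Pi>\<^sub>M b\<in>B. (lborel :: real measure)) (\<Pi>\<^sub>M b\<in>B. lborel) (\<lambda>\<omega>. \<lambda>b\<in>B. x \<bullet> b + \<omega> b)) borel (\<lambda>f. \<Sum>b\<in>B. f b *\<^sub>R b)"
    by (simp add: onb_lborel_def distr_PiM_lborel_translate[OF fin])
  also have "\<dots> = distr (\<Pi>\<^sub>M b\<in>B. (lborel :: real measure)) borel (\<lambda>f. x + (\<Sum>b\<in>B. f b *\<^sub>R b))"
    by (subst distr_distr)
       (auto simp: comp_def scaleR_add_left sum.distrib intro!: distr_cong onb_repr[OF B x, symmetric])
  also have "\<dots> = distr (onb_lborel B) borel ((+) x)"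
    unfolding onb_lborel_def by (subst distr_distr) (auto simp: comp_def)
  finally show ?thesis by simp
qed

text \<open>In coordinates the ball is a Euclidean ball of functions on \<open>B\<close>, because
  the basis is orthonormal. The bound includes radius 0, so that every ball of natural radius is
  available for sigma-finiteness.\<close>

lemma emeasure_onb_lborel_cball:
  assumes B: "orthonormal_basis S B" and r: "r \<ge> 0"
  shows "emeasure (onb_lborel B) (cball 0 r) \<le> ennreal (unit_ball_vol (dim S) * r ^ dim S)"
    "r > 0 \<Longrightarrow> emeasure (onb_lborel B) (cball 0 r) = ennreal (unit_ball_vol (dim S) * r ^ dim S)"
proof -
  have fin: "finite B" by (rule orthonormal_basis_finite[OF B])
  show *: "emeasure (onb_lborel B) (cball 0 r) = ennreal (unit_ball_vol (dim S) * r ^ dim S)" if "r > 0" for r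
  proof -
    have "(\<lambda>f. \<Sum>b\<in>B. f b *\<^sub>R b) -` cball 0 r = {f. sqrt (\<Sum>i\<in>B. (f i)\<^sup>2) \<le> r}"
      by (auto simp: norm_onb_sum[OF B])
    then show ?thesis unfolding onb_lborel_def
      using emeasure_cball_aux[OF fin that]
      by (subst emeasure_distr) (auto simp: orthonormal_basis_card[OF B])
  qed
  show "emeasure (onb_lborel B) (cball 0 r) \<le> ennreal (unit_ball_vol (dim S) * r ^ dim S)"
  proof (cases "r = 0")
    case True
    have "emeasure (onb_lborel B) (cball 0 0) \<le> ennreal (unit_ball_vol (dim S) * e ^ dim S)" if "e > 0" for e
      using *[OF that] emeasure_mono[of "cball 0 0" "cball 0 e" "onb_lborel B"] that by auto
    note b = this
    \<comment> \<open>The exact formula holds for positive radii, so radius 0 is reached as a limit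
      from the right. For \<open>dim S = 0\<close> the limit value is \<open>0 ^ 0 = 1\<close>, the
      unit mass at 0.\<close>
    have "((\<lambda>e. ennreal (unit_ball_vol (dim S) * e ^ dim S)) \<longlongrightarrow> ennreal (unit_ball_vol (dim S) * 0 ^ dim S)) (at_right 0)"
      by (intro tendsto_intros tendsto_ennrealI)
    from tendsto_lowerbound[OF this, of "emeasure (onb_lborel B) (cball 0 0)"] b True show ?thesis
      by (auto simp: eventually_at_filter)
  qed (use r * in auto)
qed

lemma sigma_finite_onb_lborel:
  assumes B: "orthonormal_basis S B" shows "sigma_finite_measure (onb_lborel B)"
proof
  have "emeasure (onb_lborel B) (cball 0 (real n)) \<noteq> \<top>" for n
    using emeasure_onb_lborel_cball(1)[OF B, of "real n"] by (metis ennreal_neq_top of_nat_0_le_iff neq_top_trans)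
  then show "\<exists>A. countable A \<and> A \<subseteq> sets (onb_lborel B) \<and> \<Union>A = space (onb_lborel B) \<and>
      (\<forall>a\<in>A. emeasure (onb_lborel B) a \<noteq> \<infinity>)"
    apply (intro exI[of _ "range (\<lambda>n::nat. cball 0 (real n))"])
    apply auto
    apply (meson real_arch_simple)
    done
qed

text \<open>This takes the place of rotation invariance: the product measure of any orthonormal
  basis is invariant under translations and gives the unit ball its standard mass, and these two
  properties characterise Lebesgue measure.\<close>

lemma onb_lborel_UNIV:
  assumes B: "orthonormal_basis UNIV (B :: 'a::euclidean_space set)" shows "onb_lborel B = lborel"
  using sigma_finite_onb_lborel[OF B] distr_onb_lborel_translate[OF B] emeasure_onb_lborel_cball(2)[OF B, of 1]
  by (intro lborel_eqI_translation) (auto simp: emeasure_cball)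

text \<open>Orthonormal bases of \<open>L\<close> and of its complement unite to one of the whole
  space, so this is Tonelli for a product split into two blocks of coordinates. It serves both to
  slice balls by hyperplanes and to integrate along the fibres of the projection.\<close>

lemma nn_integral_lborel_subspace_split:
  fixes f :: "'a::euclidean_space \<Rightarrow> ennreal"
  assumes L: "subspace L" and f[measurable]: "f \<in> borel_measurable borel"
  shows "(\<integral>\<^sup>+x. f x \<partial>lborel) = (\<integral>\<^sup>+x. (\<integral>\<^sup>+y. f (x + y) \<partial>subspace_lborel (L\<^sup>\<bottom>)) \<partial>subspace_lborel L)"
proof -
  let ?B = "subspace_basis L" and ?C = "subspace_basis (L\<^sup>\<bottom>)"
  note B = orthonormal_basis_subspace_basis[OF L]
  note C = orthonormal_basis_subspace_basis[OF subspace_orthogonal_comp, of L]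
  have fin: "finite ?B" "finite ?C" using B C orthonormal_basis_finite by auto
  have BC: "b \<bullet> c = 0" if "b \<in> ?B" "c \<in> ?C" for b c
    using that B C unfolding orthonormal_basis_def orthogonal_comp_def orthogonal_def by blast
  have disj: "?B \<inter> ?C = {}"
  proof (rule ccontr)
    assume "?B \<inter> ?C \<noteq> {}"
    then obtain b where "b \<in> ?B" "b \<in> ?C" by auto
    with BC[of b b] orthonormal_basis_inner[OF B, of b b] show False by simp
  qed
  have "orthonormal_basis UNIV (?B \<union> ?C)"
    unfolding orthonormal_basis_def
  proof (intro conjI)
    show "pairwise orthogonal (?B \<union> ?C)"
      using B C BC unfolding orthonormal_basis_def pairwise_def orthogonal_def by (metis UnE inner_commute)
    show "\<forall>b\<in>?B \<union> ?C. norm b = 1" using B C unfolding orthonormal_basis_def by auto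
    have "span (?B \<union> ?C) = {x + y | x y. x \<in> L \<and> y \<in> L\<^sup>\<bottom>}"
      using B C unfolding span_Un orthonormal_basis_def by auto
    also have "\<dots> = UNIV"
      using subspace_sum_orthogonal_comp[OF L] unfolding set_plus_def by blast
    finally show "span (?B \<union> ?C) = UNIV" .
  qed auto
  from onb_lborel_UNIV[OF this]
  have "(\<integral>\<^sup>+x. f x \<partial>lborel) = (\<integral>\<^sup>+x. f x \<partial>onb_lborel (?B \<union> ?C))" by simp
  also have "\<dots> = (\<integral>\<^sup>+\<omega>. f (\<Sum>b\<in>?B \<union> ?C. \<omega> b *\<^sub>R b) \<partial>(\<Pi>\<^sub>M b\<in>?B \<union> ?C. (lborel :: real measure)))"
    by (rule nn_integral_onb_lborel) simp
  also have "\<dots> = (\<integral>\<^sup>+x. (\<integral>\<^sup>+y. f (\<Sum>b\<in>?B \<union> ?C. merge ?B ?C (x, y) b *\<^sub>R b) \<partial>(\<Pi>\<^sub>M b\<in>?C. (lborel :: real measure))) \<partial>(\<Pi>\<^sub>M b\<in>?B. (lborel :: real measure)))"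
  proof -
    interpret product_sigma_finite "\<lambda>_. lborel :: real measure" ..
    show ?thesis by (rule product_nn_integral_fold[OF disj fin]) measurable
  qed
  also have "\<dots> = (\<integral>\<^sup>+x. (\<integral>\<^sup>+y. f ((\<Sum>b\<in>?B. x b *\<^sub>R b) + (\<Sum>b\<in>?C. y b *\<^sub>R b)) \<partial>(\<Pi>\<^sub>M b\<in>?C. (lborel :: real measure))) \<partial>(\<Pi>\<^sub>M b\<in>?B. (lborel :: real measure)))"
  proof (intro nn_integral_cong arg_cong[where f=f])
    fix x y :: "'a \<Rightarrow> real"
    have "b \<notin> ?B" if "b \<in> ?C" for b using disj that by auto
    then have "(\<Sum>b\<in>?B. merge ?B ?C (x, y) b *\<^sub>R b) = (\<Sum>b\<in>?B. x b *\<^sub>R b)"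
      "(\<Sum>b\<in>?C. merge ?B ?C (x, y) b *\<^sub>R b) = (\<Sum>b\<in>?C. y b *\<^sub>R b)"
      by (auto intro!: sum.cong simp: merge_def)
    then show "(\<Sum>b\<in>?B \<union> ?C. merge ?B ?C (x, y) b *\<^sub>R b) = (\<Sum>b\<in>?B. x b *\<^sub>R b) + (\<Sum>b\<in>?C. y b *\<^sub>R b)"
      by (simp add: sum.union_disjoint[OF fin disj])
  qed
  also have "\<dots> = (\<integral>\<^sup>+x. (\<integral>\<^sup>+y. f (x + y) \<partial>onb_lborel ?C) \<partial>onb_lborel ?B)"
  proof -
    interpret sigma_finite_measure "onb_lborel ?C" by (rule sigma_finite_onb_lborel[OF C])
    show ?thesis
      by (subst nn_integral_onb_lborel) (auto intro!: nn_integral_cong nn_integral_onb_lborel[symmetric])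
  qed
  finally show ?thesis by (simp add: subspace_lborel_onb)
qed

section \<open>Homogeneous functions in polar coordinates\<close>

lemma nn_integral_lborel_scaleR:
  fixes f :: "'a::euclidean_space \<Rightarrow> ennreal"
  assumes [measurable]: "f \<in> borel_measurable borel" and c: "c > 0"
  shows "(\<integral>\<^sup>+x. f x \<partial>lborel) = ennreal (c ^ DIM('a)) * (\<integral>\<^sup>+x. f (c *\<^sub>R x) \<partial>lborel)"
proof -
  have "(\<integral>\<^sup>+x. f x \<partial>lborel) = (\<integral>\<^sup>+x. f x \<partial>density (distr lborel borel (\<lambda>x. 0 + c *\<^sub>R x)) (\<lambda>_. ennreal (\<bar>c\<bar> ^ DIM('a))))"
    using lborel_affine[of c "0::'a"] c by simp
  also have "\<dots> = ennreal (c ^ DIM('a)) * (\<integral>\<^sup>+x. f (c *\<^sub>R x) \<partial>lborel)"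
    using c by (simp add: nn_integral_distr nn_integral_density nn_integral_cmult)
  finally show ?thesis .
qed

lemma cball_borel [measurable]: "cball a r \<in> sets borel"
  by simp

lemma nn_integral_homogeneous_cball:
  fixes f :: "'a::euclidean_space \<Rightarrow> ennreal"
  assumes [measurable]: "f \<in> borel_measurable borel"
    and hom: "\<And>c x. c > 0 \<Longrightarrow> f (c *\<^sub>R x) = ennreal (c ^ k) * f x" and r: "r > 0"
  shows "(\<integral>\<^sup>+x. f x * indicator (cball 0 r) x \<partial>lborel)
    = ennreal (r ^ (DIM('a) + k)) * (\<integral>\<^sup>+x. f x * indicator (cball 0 1) x \<partial>lborel)"
proof -
  have "(\<integral>\<^sup>+x. f x * indicator (cball 0 r) x \<partial>lborel)
    = ennreal (r ^ DIM('a)) * (\<integral>\<^sup>+x. f (r *\<^sub>R x) * indicator (cball 0 r) (r *\<^sub>R x) \<partial>lborel)"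
    by (rule nn_integral_lborel_scaleR) (use r in auto)
  also have "(\<integral>\<^sup>+x. f (r *\<^sub>R x) * indicator (cball 0 r) (r *\<^sub>R x) \<partial>lborel)
    = (\<integral>\<^sup>+x. ennreal (r ^ k) * (f x * indicator (cball 0 1) x) \<partial>lborel)"
    using r by (intro nn_integral_cong) (auto simp: hom indicator_def mult.assoc)
  also have "\<dots> = ennreal (r ^ k) * (\<integral>\<^sup>+x. f x * indicator (cball 0 1) x \<partial>lborel)"
    by (rule nn_integral_cmult) measurable
  finally show ?thesis using r
    by (simp add: power_add ennreal_mult mult.assoc)
qed

lemma nn_integral_power_Icc:
  assumes "a \<ge> 0" "n > 0"
  shows "(\<integral>\<^sup>+r. ennreal (real n * r ^ (n - 1)) * indicator {0..a} r \<partial>lborel) = ennreal (a ^ n)"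
  using assms
  by (subst nn_integral_FTC_Icc[where F="\<lambda>x. x ^ n"]) (auto intro!: derivative_eq_intros)

text \<open>Polar coordinates without a surface measure: push the measure with density
  \<open>f\<close> forward under the norm. Homogeneity gives its mass on every ball, hence its
  distribution function, and identifies it as the measure on the half-line with density
  \<open>K * n * r ^ (n - 1)\<close>, where n is the dimension plus the degree
  \<open>k\<close>.\<close>

lemma nn_integral_homogeneous:
  fixes f :: "'a::euclidean_space \<Rightarrow> ennreal"
  assumes f[measurable]: "f \<in> borel_measurable borel"
    and hom: "\<And>c x. c > 0 \<Longrightarrow> f (c *\<^sub>R x) = ennreal (c ^ k) * f x"
    and K: "(\<integral>\<^sup>+x. f x * indicator (cball 0 1) x \<partial>lborel) = ennreal K" "K \<ge> 0"
    and g[measurable]: "g \<in> borel_measurable borel"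
  shows "(\<integral>\<^sup>+x. f x * g (norm x) \<partial>lborel)
    = ennreal (real (DIM('a) + k) * K) * (\<integral>\<^sup>+r. ennreal (r ^ (DIM('a) + k - 1)) * indicator {0..} r * g r \<partial>lborel)"
proof -
  let ?n = "DIM('a) + k"
  have n: "?n > 0" by simp
  define M where "M = distr (density lborel f) borel norm"
  define N where "N = density lborel (\<lambda>r::real. ennreal K * (ennreal (real ?n * r ^ (?n - 1)) * indicator {0..} r))"
  have M: "emeasure M {..a} = (if a < 0 then 0 else ennreal (K * a ^ ?n))" for a
  proof -
    have "emeasure M {..a} = (\<integral>\<^sup>+x. f x * indicator (cball 0 a) x \<partial>lborel)"
    proof -
      have "norm -` {..a} = (cball 0 a :: 'a set)" by auto
      then have "emeasure M {..a} = emeasure (density lborel f) (cball 0 a)"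
        unfolding M_def by (subst emeasure_distr) auto
      then show ?thesis by (simp add: emeasure_density)
    qed
    also have "\<dots> = (if a < 0 then 0 else ennreal (K * a ^ ?n))"
    proof (cases "a > 0")
      case True
      then show ?thesis
        using nn_integral_homogeneous_cball[OF f hom True] K
        by (simp add: ennreal_mult mult.commute)
    next
      case False
      \<comment> \<open>For \<open>a <= 0\<close> the ball is empty or the single point 0.\<close>
      have "AE x in lborel. f x * indicator (cball 0 a) x = 0"
        using AE_lborel_singleton[of 0] 
      proof eventually_elim
        case (elim x)
        then have "norm x > 0" by simp
        with False have "\<not> norm x \<le> a" by linarith
        then show ?case by (simp add: indicator_def)
      qed
      then have "(\<integral>\<^sup>+x. f x * indicator (cball 0 a) x \<partial>lborel) = 0"
        by (subst nn_integral_0_iff_AE) auto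
      then show ?thesis using False n by (auto simp: power_0_left)
    qed
    finally show ?thesis .
  qed
  have N: "emeasure N {..a} = (if a < 0 then 0 else ennreal (K * a ^ ?n))" for a
  proof -
    have "emeasure N {..a} = (\<integral>\<^sup>+r. ennreal K * (ennreal (real ?n * r ^ (?n - 1)) * indicator {0..a} r) \<partial>lborel)"
      unfolding N_def
      by (subst emeasure_density) (auto intro!: nn_integral_cong simp: indicator_def)
    also have "\<dots> = ennreal K * (\<integral>\<^sup>+r. ennreal (real ?n * r ^ (?n - 1)) * indicator {0..a} r \<partial>lborel)"
      by (rule nn_integral_cmult) measurable
    also have "\<dots> = (if a < 0 then 0 else ennreal (K * a ^ ?n))"
      using nn_integral_power_Icc[of a ?n] K(2) n by (auto simp: ennreal_mult)
    finally show ?thesis .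
  qed
  have "M = N"
  proof (rule measure_eqI_generator_eq[where E="range (\<lambda>a. {..a::real})" and \<Omega>=UNIV and A="\<lambda>n. {..real n}"])
    show "Int_stable (range (\<lambda>a::real. {..a}))" by (auto simp: Int_stable_def)
    show "sets M = sigma_sets UNIV (range (\<lambda>a. {..a::real}))"
      by (simp add: M_def) (subst borel_eq_atMost, simp)
    show "sets N = sigma_sets UNIV (range (\<lambda>a. {..a::real}))"
      by (simp add: N_def) (subst borel_eq_atMost, simp)
    show "(\<Union>i::nat. {..real i}) = UNIV" using real_arch_simple by auto
  qed (auto simp: M N)
  have "(\<integral>\<^sup>+x. f x * g (norm x) \<partial>lborel) = (\<integral>\<^sup>+r. g r \<partial>M)"
    unfolding M_def by (simp add: nn_integral_distr nn_integral_density)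
  also have "\<dots> = (\<integral>\<^sup>+r. ennreal (real ?n * K) * (ennreal (r ^ (?n - 1)) * indicator {0..} r * g r) \<partial>lborel)"
    unfolding \<open>M = N\<close> N_def
    by (subst nn_integral_density) (auto intro!: nn_integral_cong simp: indicator_def ennreal_mult K mult_ac)
  also have "\<dots> = ennreal (real ?n * K) * (\<integral>\<^sup>+r. ennreal (r ^ (?n - 1)) * indicator {0..} r * g r \<partial>lborel)"
    by (rule nn_integral_cmult) measurable
  finally show ?thesis .
qed

section \<open>The constant\<close>

text \<open>Between the zeros pi/2 and 3 pi/2 the cosine keeps its sign; the three arcs contribute
  1, 2 and 1. The closed arcs overlap in single points, which almost-everywhere equality
  absorbs.\<close>

lemma nn_integral_abs_cos_2pi: "(\<integral>\<^sup>+\<theta>. ennreal \<bar>cos \<theta>\<bar> * indicator {0..<2*pi} \<theta> \<partial>lborel) = 4"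
proof -
  have 1: "(\<integral>\<^sup>+\<theta>. ennreal (cos \<theta>) * indicator {0..pi/2} \<theta> \<partial>lborel) = ennreal 1"
    by (subst nn_integral_FTC_Icc[where F=sin]) (auto intro!: derivative_eq_intros cos_ge_zero)
  have 2: "(\<integral>\<^sup>+\<theta>. ennreal (- cos \<theta>) * indicator {pi/2..3*pi/2} \<theta> \<partial>lborel) = ennreal 2"
  proof (subst nn_integral_FTC_Icc[where F="\<lambda>x. - sin x"])
    show "0 \<le> - cos x" if "x \<in> {pi / 2..3 * pi / 2}" for x
      using cos_ge_zero[of "x - pi"] that by (simp add: cos_diff)
    show "ennreal (- sin (3 * pi / 2) - - sin (pi / 2)) = ennreal 2"
      using sin_3over2_pi by simp
  qed (auto intro!: derivative_eq_intros)
  have 3: "(\<integral>\<^sup>+\<theta>. ennreal (cos \<theta>) * indicator {3*pi/2..2*pi} \<theta> \<partial>lborel) = ennreal 1"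
  proof (subst nn_integral_FTC_Icc[where F=sin])
    show "0 \<le> cos x" if "x \<in> {3 * pi / 2..2 * pi}" for x
      using cos_ge_zero[of "x - 2 * pi"] that by (simp add: cos_diff)
    show "ennreal (sin (2 * pi) - sin (3 * pi / 2)) = ennreal 1"
      using sin_3over2_pi by simp
  qed (auto intro!: derivative_eq_intros)
  have "(\<integral>\<^sup>+\<theta>. ennreal \<bar>cos \<theta>\<bar> * indicator {0..<2*pi} \<theta> \<partial>lborel)
    = (\<integral>\<^sup>+\<theta>. ennreal (cos \<theta>) * indicator {0..pi/2} \<theta> + (ennreal (- cos \<theta>) * indicator {pi/2..3*pi/2} \<theta>
        + ennreal (cos \<theta>) * indicator {3*pi/2..2*pi} \<theta>) \<partial>lborel)"
  proof (rule nn_integral_cong_AE)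
    have "AE \<theta> in lborel. \<theta> \<noteq> pi/2 \<and> \<theta> \<noteq> 3*pi/2 \<and> \<theta> \<noteq> 2*pi"
      using AE_lborel_singleton[of "pi/2"] AE_lborel_singleton[of "3*pi/2"] AE_lborel_singleton[of "2*pi"] by auto
    then show "AE \<theta> in lborel. ennreal \<bar>cos \<theta>\<bar> * indicator {0..<2*pi} \<theta> = ennreal (cos \<theta>) * indicator {0..pi/2} \<theta> + (ennreal (- cos \<theta>) * indicator {pi/2..3*pi/2} \<theta>
        + ennreal (cos \<theta>) * indicator {3*pi/2..2*pi} \<theta>)"
    proof eventually_elim
      case (elim x)
      consider "x < 0 \<or> x \<ge> 2 * pi" | "0 \<le> x" "x < pi/2" | "pi/2 < x" "x < 3*pi/2" | "3*pi/2 < x" "x < 2 * pi"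
        using elim by linarith
      then show ?case
      proof cases
        case 1 then show ?thesis using elim pi_gt_zero by (auto simp: indicator_def)
      next
        case 2 then show ?thesis using cos_ge_zero[of x] by (auto simp: indicator_def)
      next
        case 3 then show ?thesis using cos_ge_zero[of "x - pi"] by (auto simp: indicator_def cos_diff)
      next
        case 4 then show ?thesis using cos_ge_zero[of "x - 2 * pi"] by (auto simp: indicator_def cos_diff)
      qed
    qed
  qed
  also have "\<dots> = ennreal 1 + (ennreal 2 + ennreal 1)"
    by (subst nn_integral_add, measurable, subst nn_integral_add, measurable) (simp only: 1 2 3)
  also have "\<dots> = ennreal 4" by (simp flip: ennreal_plus)
  finally show ?thesis by simp
qed

text \<open>The stretch from -\<alpha> to 0, pushed out of the period by the shift, is brought back
  by periodicity.\<close>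

lemma nn_integral_abs_cos_shift:
  assumes "0 \<le> \<alpha>" "\<alpha> \<le> 2 * pi"
  shows "(\<integral>\<^sup>+\<theta>. ennreal \<bar>cos (\<theta> - \<alpha>)\<bar> * indicator {0..<2*pi} \<theta> \<partial>lborel) = 4"
proof -
  let ?c = "\<lambda>x. ennreal \<bar>cos x\<bar>"
  have "(\<integral>\<^sup>+\<theta>. ?c (\<theta> - \<alpha>) * indicator {0..<2*pi} \<theta> \<partial>lborel)
    = (\<integral>\<^sup>+\<theta>. ?c \<theta> * indicator {0..<2*pi} (\<alpha> + \<theta>) \<partial>lborel)"
    by (subst nn_integral_lborel_translate[where a=\<alpha>, symmetric]) auto
  also have "\<dots> = (\<integral>\<^sup>+\<theta>. ?c \<theta> * indicator {-\<alpha>..<0} \<theta> + ?c \<theta> * indicator {0..<2*pi-\<alpha>} \<theta> \<partial>lborel)"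
    using assms by (intro nn_integral_cong) (auto simp: indicator_def)
  also have "\<dots> = (\<integral>\<^sup>+\<theta>. ?c \<theta> * indicator {-\<alpha>..<0} \<theta> \<partial>lborel) + (\<integral>\<^sup>+\<theta>. ?c \<theta> * indicator {0..<2*pi-\<alpha>} \<theta> \<partial>lborel)"
    by (rule nn_integral_add) measurable
  also have "(\<integral>\<^sup>+\<theta>. ?c \<theta> * indicator {-\<alpha>..<0} \<theta> \<partial>lborel) = (\<integral>\<^sup>+\<theta>. ?c (- (2*pi) + \<theta>) * indicator {-\<alpha>..<0} (- (2*pi) + \<theta>) \<partial>lborel)"
    by (rule nn_integral_lborel_translate[symmetric]) measurable
  also have "\<dots> = (\<integral>\<^sup>+\<theta>. ?c \<theta> * indicator {2*pi-\<alpha>..<2*pi} \<theta> \<partial>lborel)"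
    by (intro nn_integral_cong) (auto simp: indicator_def cos_diff)
  also have "\<dots> + (\<integral>\<^sup>+\<theta>. ?c \<theta> * indicator {0..<2*pi-\<alpha>} \<theta> \<partial>lborel)
     = (\<integral>\<^sup>+\<theta>. ?c \<theta> * indicator {2*pi-\<alpha>..<2*pi} \<theta> + ?c \<theta> * indicator {0..<2*pi-\<alpha>} \<theta> \<partial>lborel)"
    by (rule nn_integral_add[symmetric]) measurable
  also have "\<dots> = (\<integral>\<^sup>+\<theta>. ?c \<theta> * indicator {0..<2*pi} \<theta> \<partial>lborel)"
    using assms by (intro nn_integral_cong) (auto simp: indicator_def)
  finally show ?thesis by (simp add: nn_integral_abs_cos_2pi)
qed

text \<open>With amplitude and phase the integrand is \<rho> times a shifted cosine, and a full
  period does not see the shift.\<close>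

lemma nn_integral_abs_sincos:
  "(\<integral>\<^sup>+\<theta>. ennreal \<bar>a * cos \<theta> + b * sin \<theta>\<bar> * indicator {0..<2*pi} \<theta> \<partial>lborel) = ennreal (4 * sqrt (a\<^sup>2 + b\<^sup>2))"
proof (cases "a\<^sup>2 + b\<^sup>2 = 0")
  case True
  then have "a = 0" "b = 0" by (auto simp: sum_power2_eq_zero_iff)
  then show ?thesis by simp
next
  case False
  define \<rho> where "\<rho> = sqrt (a\<^sup>2 + b\<^sup>2)"
  have \<rho>: "\<rho> > 0" "\<rho>\<^sup>2 = a\<^sup>2 + b\<^sup>2" using False by (auto simp: \<rho>_def sum_power2_gt_zero_iff sum_power2_eq_zero_iff)
  then have "(a / \<rho>)\<^sup>2 + (b / \<rho>)\<^sup>2 = 1" by (metis add_divide_distrib divide_self less_irrefl power_divide zero_less_power)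
  then obtain \<alpha> where \<alpha>: "0 \<le> \<alpha>" "\<alpha> \<le> 2 * pi" "a / \<rho> = cos \<alpha>" "b / \<rho> = sin \<alpha>"
    using sincos_total_2pi_le by blast
  have "a = \<rho> * cos \<alpha>" "b = \<rho> * sin \<alpha>" using \<alpha> \<rho> by (auto simp: field_simps)
  then have "a * cos \<theta> + b * sin \<theta> = \<rho> * cos (\<theta> - \<alpha>)" for \<theta> by (simp add: cos_diff algebra_simps)
  then have "(\<integral>\<^sup>+\<theta>. ennreal \<bar>a * cos \<theta> + b * sin \<theta>\<bar> * indicator {0..<2*pi} \<theta> \<partial>lborel)
    = (\<integral>\<^sup>+\<theta>. ennreal \<rho> * (ennreal \<bar>cos (\<theta> - \<alpha>)\<bar> * indicator {0..<2*pi} \<theta>) \<partial>lborel)"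
    using \<rho> by (simp add: abs_mult ennreal_mult mult.assoc)
  also have "\<dots> = ennreal \<rho> * 4"
    by (subst nn_integral_cmult) (auto simp: nn_integral_abs_cos_shift[OF \<alpha>(1,2)])
  also have "\<dots> = ennreal (4 * \<rho>)" using \<rho> by (simp add: ennreal_mult mult.commute)
  finally show ?thesis by (simp add: \<rho>_def)
qed

lemma nn_integral_abs_sqrt_power:
  "(\<integral>\<^sup>+t. ennreal (\<bar>t\<bar> * sqrt (1 - t\<^sup>2) ^ n) * indicator {-1..1} t \<partial>lborel) = ennreal (2 / (real n + 2))"
proof -
  \<comment> \<open>A primitive of the integrand up to sign on each half of the interval. It need
    not be differentiable at -1 and 1, so the fundamental theorem is used in its interior
    form.\<close>
  let ?F = "\<lambda>t::real. sqrt (1 - t\<^sup>2) ^ (n + 2) / (real n + 2)"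
  have D: "(?F has_vector_derivative - (t * sqrt (1 - t\<^sup>2) ^ n)) (at t)" if "t \<in> {-1<..<1}" for t
  proof -
    have *: "1 - t\<^sup>2 > 0" using that by (simp add: abs_square_less_1 abs_less_iff)
    have "((\<lambda>t. sqrt (1 - t\<^sup>2)) has_real_derivative - (t / sqrt (1 - t\<^sup>2))) (at t)"
      using * by (auto intro!: derivative_eq_intros simp: field_simps)
    from DERIV_power[OF this, of "n + 2"]
    have "((\<lambda>t. sqrt (1 - t\<^sup>2) ^ (n + 2)) has_real_derivative
        real (n + 2) * (- (t / sqrt (1 - t\<^sup>2)) * sqrt (1 - t\<^sup>2) ^ (n + 1))) (at t)" by simp
    also have "real (n + 2) * (- (t / sqrt (1 - t\<^sup>2)) * sqrt (1 - t\<^sup>2) ^ (n + 1))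
      = - (t * sqrt (1 - t\<^sup>2) ^ n) * (real n + 2)"
      using * by simp
    finally have "(?F has_real_derivative - (t * sqrt (1 - t\<^sup>2) ^ n) * (real n + 2) / (real n + 2)) (at t)"
      by (rule DERIV_cdivide)
    moreover have "- (t * sqrt (1 - t\<^sup>2) ^ n) * (real n + 2) / (real n + 2) = - (t * sqrt (1 - t\<^sup>2) ^ n)"
      by (rule nonzero_mult_div_cancel_right) auto
    ultimately show ?thesis
      by (simp add: has_real_derivative_iff_has_vector_derivative)
  qed
  have C: "continuous_on S ?F" for S by (intro continuous_intros) auto
  have 1: "((\<lambda>t. - (t * sqrt (1 - t\<^sup>2) ^ n)) has_integral (?F 0 - ?F (-1))) {-1..0}"
    by (rule fundamental_theorem_of_calculus_interior) (use D C in auto)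
  have "((\<lambda>t. - (t * sqrt (1 - t\<^sup>2) ^ n)) has_integral (?F 1 - ?F 0)) {0..1}"
    by (rule fundamental_theorem_of_calculus_interior) (use D C in auto)
  then have 2: "((\<lambda>t. t * sqrt (1 - t\<^sup>2) ^ n) has_integral - (?F 1 - ?F 0)) {0..1}"
    by (drule_tac has_integral_neg) simp
  have "((\<lambda>t. \<bar>t\<bar> * sqrt (1 - t\<^sup>2) ^ n) has_integral ((?F 0 - ?F (-1)) + (- (?F 1 - ?F 0)))) {-1..1}"
  proof (rule has_integral_combine[where c=0])
    show "((\<lambda>t. \<bar>t\<bar> * sqrt (1 - t\<^sup>2) ^ n) has_integral (?F 0 - ?F (-1))) {-1..0}"
      by (rule has_integral_eq[OF _ 1]) auto
    show "((\<lambda>t. \<bar>t\<bar> * sqrt (1 - t\<^sup>2) ^ n) has_integral (- (?F 1 - ?F 0))) {0..1}"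
      by (rule has_integral_eq[OF _ 2]) auto
  qed auto
  moreover have "(?F 0 - ?F (-1)) + (- (?F 1 - ?F 0)) = 2 / (real n + 2)" by simp
  ultimately have "((\<lambda>t. \<bar>t\<bar> * sqrt (1 - t\<^sup>2) ^ n) has_integral (2 / (real n + 2))) {-1..1}" by simp
  from nn_integral_has_integral_lebesgue'[OF _ this] show ?thesis
    by (simp add: abs_square_le_1 abs_le_iff)
qed

section \<open>Slices of the unit ball and the constant they produce\<close>

lemma AE_onb_lborel:
  assumes B: "orthonormal_basis S B" shows "AE x in onb_lborel B. x \<in> S"
proof -
  have sub: "subspace S" and BS: "B \<subseteq> S" using B unfolding orthonormal_basis_def by auto
  then have S: "S \<in> sets borel" by (simp add: borel_closed closed_subspace)
  have "(\<Sum>b\<in>B. f b *\<^sub>R b) \<in> S" for f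
    using BS by (intro subspace_sum[OF sub] subspace_scale[OF sub]) auto
  then show ?thesis unfolding onb_lborel_def using S
    by (subst AE_distr_iff) auto
qed

lemma AE_subspace_lborel:
  "subspace S \<Longrightarrow> AE x in subspace_lborel S. x \<in> S"
  unfolding subspace_lborel_onb by (rule AE_onb_lborel[OF orthonormal_basis_subspace_basis])

lemma sets_subspace_lborel[simp, measurable_cong]: "sets (subspace_lborel S) = sets borel"
  by (simp add: subspace_lborel_onb)

lemma space_subspace_lborel[simp]: "space (subspace_lborel S) = UNIV"
  by (simp add: subspace_lborel_onb)

lemma sigma_finite_subspace_lborel: "subspace S \<Longrightarrow> sigma_finite_measure (subspace_lborel S)"
  unfolding subspace_lborel_onb by (rule sigma_finite_onb_lborel[OF orthonormal_basis_subspace_basis])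

lemma emeasure_subspace_lborel_cball:
  "subspace S \<Longrightarrow> r > 0 \<Longrightarrow>
    emeasure (subspace_lborel S) (cball 0 r) = ennreal (unit_ball_vol (dim S) * r ^ dim S)"
  unfolding subspace_lborel_onb
  by (rule emeasure_onb_lborel_cball(2)) (auto intro: orthonormal_basis_subspace_basis)

lemma dim_orthogonal_comp:
  fixes L :: "'a::euclidean_space set"
  assumes "subspace L" shows "dim (L\<^sup>\<bottom>) = DIM('a) - dim L"
  using dim_subspace_orthogonal_to_vectors[OF assms subspace_UNIV subset_UNIV]
  by (simp add: orthogonal_comp_def orthogonal_commute)

text \<open>Slice the ball orthogonally to \<open>n\<close>: at height t there is a ball of
  dimension d - 1 and radius sqrt (1 - t^2), on which the integrand is the constant
  \<bar>t\<bar>.\<close>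

lemma nn_integral_abs_inner_cball:
  fixes n :: "'a::euclidean_space"
  assumes n: "norm n = 1"
  shows "(\<integral>\<^sup>+u. ennreal \<bar>u \<bullet> n\<bar> * indicator (cball 0 1) u \<partial>lborel)
    = ennreal (2 * unit_ball_vol (DIM('a) - 1) / (DIM('a) + 1))"
proof -
  let ?d = "DIM('a)"
  define L where "L = span {n}"
  have L: "subspace L" unfolding L_def by simp
  have n0: "n \<noteq> 0" using n by auto
  have dL: "dim L = 1" unfolding L_def using n0 by (simp add: dim_singleton)
  define B where "B = subspace_basis L"
  have B: "orthonormal_basis L B" unfolding B_def by (rule orthonormal_basis_subspace_basis[OF L])
  \<comment> \<open>The basis vector of the line is \<open>n\<close> or \<open>- n\<close>; the
    absolute value does not see the sign.\<close>
  obtain b where b: "B = {b}" using orthonormal_basis_card[OF B] dL by (metis card_1_singletonE)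
  have "b \<in> L" and nb: "norm b = 1" using B unfolding b orthonormal_basis_def by auto
  then obtain c where c: "b = c *\<^sub>R n" unfolding L_def by (auto simp: span_singleton)
  have "\<bar>c\<bar> = 1" using nb n unfolding c by simp
  then have bn: "\<bar>u \<bullet> b\<bar> = \<bar>u \<bullet> n\<bar>" for u unfolding c by (simp add: abs_mult)
  note L' = subspace_orthogonal_comp[of L]
  have dL': "dim (L\<^sup>\<bottom>) = ?d - 1" using dim_orthogonal_comp[OF L] dL by simp
  interpret L': sigma_finite_measure "subspace_lborel (L\<^sup>\<bottom>)" by (rule sigma_finite_subspace_lborel[OF L'])
  interpret product_sigma_finite "\<lambda>_. lborel :: real measure" ..
  let ?slice = "\<lambda>t. (\<integral>\<^sup>+y. ennreal \<bar>(t *\<^sub>R b + y) \<bullet> b\<bar> * indicator (cball 0 1) (t *\<^sub>R b + y) \<partial>subspace_lborel (L\<^sup>\<bottom>))"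
  \<comment> \<open>At heights 1 and -1 the slice degenerates to a point, where the volume formula
    for positive radii does not apply; the two heights are a null set.\<close>
  have inner: "?slice t
    = ennreal (unit_ball_vol (real (?d - 1))) * (ennreal (\<bar>t\<bar> * sqrt (1 - t\<^sup>2) ^ (?d - 1)) * indicator {-1..1} t)" if t: "t \<noteq> 1" "t \<noteq> -1" for t
  proof -
    have "?slice t
      = (\<integral>\<^sup>+y. ennreal \<bar>t\<bar> * (indicator {-1..1} t * indicator (cball 0 (sqrt (1 - t\<^sup>2))) y) \<partial>subspace_lborel (L\<^sup>\<bottom>))"
    proof (rule nn_integral_cong_AE)
      show "AE y in subspace_lborel (L\<^sup>\<bottom>). ennreal \<bar>(t *\<^sub>R b + y) \<bullet> b\<bar> * indicator (cball 0 1) (t *\<^sub>R b + y)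
        = ennreal \<bar>t\<bar> * (indicator {-1..1} t * indicator (cball 0 (sqrt (1 - t\<^sup>2))) y)"
        using AE_subspace_lborel[OF L']
      proof eventually_elim
        case (elim y)
        then have yb: "y \<bullet> b = 0" "b \<bullet> y = 0" using \<open>b \<in> L\<close> by (auto simp: orthogonal_comp_def orthogonal_def inner_commute)
        have bb: "b \<bullet> b = 1" using nb by (simp add: norm_eq_1)
        have "(t *\<^sub>R b + y) \<bullet> b = t" by (simp add: inner_add_left yb bb)
        moreover have "(norm (t *\<^sub>R b + y))\<^sup>2 = t\<^sup>2 + (norm y)\<^sup>2"
          unfolding power2_norm_eq_inner by (simp add: inner_add_left inner_add_right yb bb power2_eq_square)
        then have "norm (t *\<^sub>R b + y) \<le> 1 \<longleftrightarrow> t\<^sup>2 + (norm y)\<^sup>2 \<le> 1"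
          by (metis abs_norm_cancel abs_square_le_1)
        moreover have "t\<^sup>2 + (norm y)\<^sup>2 \<le> 1 \<longleftrightarrow> \<bar>t\<bar> \<le> 1 \<and> norm y \<le> sqrt (1 - t\<^sup>2)"
        proof
          assume *: "t\<^sup>2 + (norm y)\<^sup>2 \<le> 1"
          then have "t\<^sup>2 \<le> 1" using zero_le_power2[of "norm y"] by linarith
          then show "\<bar>t\<bar> \<le> 1 \<and> norm y \<le> sqrt (1 - t\<^sup>2)" using * by (auto simp: abs_square_le_1 intro!: real_le_rsqrt)
        next
          assume *: "\<bar>t\<bar> \<le> 1 \<and> norm y \<le> sqrt (1 - t\<^sup>2)"
          then have "1 - t\<^sup>2 \<ge> 0" by (simp add: abs_square_le_1)
          have "(norm y)\<^sup>2 \<le> (sqrt (1 - t\<^sup>2))\<^sup>2" using * by (intro power_mono) auto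
          then show "t\<^sup>2 + (norm y)\<^sup>2 \<le> 1" using \<open>1 - t\<^sup>2 \<ge> 0\<close> by simp
        qed
        ultimately show ?case by (auto simp: indicator_def)
      qed
    qed
    also have "\<dots> = ennreal \<bar>t\<bar> * (indicator {-1..1} t * emeasure (subspace_lborel (L\<^sup>\<bottom>)) (cball 0 (sqrt (1 - t\<^sup>2))))"
      by (simp add: nn_integral_cmult)
    also have "\<dots> = ennreal (unit_ball_vol (real (?d - 1))) * (ennreal (\<bar>t\<bar> * sqrt (1 - t\<^sup>2) ^ (?d - 1)) * indicator {-1..1} t)"
    proof (cases "t \<in> {-1..1}")
      case True
      then have "\<bar>t\<bar> < 1" using t by auto
      then have "sqrt (1 - t\<^sup>2) > 0" by (simp add: abs_square_less_1)
      then show ?thesis using True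
        by (subst emeasure_subspace_lborel_cball[OF L'])
           (auto simp: dL' ennreal_mult mult_ac)
    qed auto
    finally show ?thesis .
  qed
  have "(\<integral>\<^sup>+u. ennreal \<bar>u \<bullet> n\<bar> * indicator (cball 0 1) u \<partial>lborel) = (\<integral>\<^sup>+u. ennreal \<bar>u \<bullet> b\<bar> * indicator (cball 0 1) u \<partial>lborel)"
    by (simp add: bn)
  also have "\<dots> = (\<integral>\<^sup>+x. (\<integral>\<^sup>+y. ennreal \<bar>(x + y) \<bullet> b\<bar> * indicator (cball 0 1) (x + y) \<partial>subspace_lborel (L\<^sup>\<bottom>)) \<partial>subspace_lborel L)"
    by (rule nn_integral_lborel_subspace_split[OF L]) measurable
  also have "\<dots> = (\<integral>\<^sup>+t. ?slice t \<partial>lborel)"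
    unfolding subspace_lborel_onb[of L] B_def[symmetric] b
    by (subst nn_integral_onb_lborel)
       (auto intro!: product_nn_integral_singleton[of "\<lambda>t. ?slice t" b])
  also have "\<dots> = (\<integral>\<^sup>+t. ennreal (unit_ball_vol (real (?d - 1))) * (ennreal (\<bar>t\<bar> * sqrt (1 - t\<^sup>2) ^ (?d - 1)) * indicator {-1..1} t) \<partial>lborel)"
    using AE_lborel_singleton[of "1::real"] AE_lborel_singleton[of "-1::real"]
    by (intro nn_integral_cong_AE, eventually_elim) (rule inner, auto)
  also have "\<dots> = ennreal (unit_ball_vol (real (?d - 1))) * ennreal (2 / (real (?d - 1) + 2))"
    by (subst nn_integral_cmult) (auto simp: nn_integral_abs_sqrt_power)
  also have "\<dots> = ennreal (2 * unit_ball_vol (?d - 1) / (?d + 1))"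
    by (simp add: ennreal_mult[symmetric] of_nat_diff add.commute mult_ac)
  finally show ?thesis by simp
qed

lemma nn_integral_abs_inner_cball':
  fixes n :: "'a::euclidean_space"
  shows "(\<integral>\<^sup>+u. ennreal \<bar>u \<bullet> n\<bar> * indicator (cball 0 1) u \<partial>lborel)
    = ennreal (2 * unit_ball_vol (DIM('a) - 1) / (DIM('a) + 1) * norm n)"
proof (cases "n = 0")
  case False
  define m where "m = n /\<^sub>R norm n"
  have m: "norm m = 1" "n = norm n *\<^sub>R m" using False unfolding m_def by (simp, simp)
  have "(\<integral>\<^sup>+u. ennreal \<bar>u \<bullet> n\<bar> * indicator (cball 0 1) u \<partial>lborel)
    = (\<integral>\<^sup>+u. ennreal (norm n) * (ennreal \<bar>u \<bullet> m\<bar> * indicator (cball 0 1) u) \<partial>lborel)"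
  proof (rule nn_integral_cong)
    fix u
    have "u \<bullet> n = norm n * (u \<bullet> m)" using m(2) by (metis inner_scaleR_right)
    then show "ennreal \<bar>u \<bullet> n\<bar> * indicator (cball 0 1) u = ennreal (norm n) * (ennreal \<bar>u \<bullet> m\<bar> * indicator (cball 0 1) u)"
      by (simp add: abs_mult ennreal_mult mult.assoc)
  qed
  also have "\<dots> = ennreal (norm n) * ennreal (2 * unit_ball_vol (DIM('a) - 1) / (DIM('a) + 1))"
    by (subst nn_integral_cmult) (auto simp: nn_integral_abs_inner_cball[OF m(1)])
  finally show ?thesis by (subst (asm) ennreal_mult[symmetric]) (auto simp: mult.commute)
qed simp

text \<open>Slicing produces the unit ball volume of dimension d - 1, while \<open>c_const\<close>
  contains that of dimension d - 2. The functional equation of Gamma turns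
  \<open>2 * unit_ball_vol (d - 1) / (d + 1)\<close> into
  \<open>2 * unit_ball_vol (d - 2) * Beta (3/2) (d/2)\<close>; the square of this times pi/2 is
  \<open>c_const d\<close>.\<close>

lemma c_const_eq:
  assumes "d \<ge> 2"
  shows "pi / 2 * (2 * unit_ball_vol (real (d - 1)) / (real d + 1))\<^sup>2 = c_const d"
proof -
  let ?G = "Gamma (real d / 2 + 3 / 2)"
  have G: "?G > 0" "Gamma (real d / 2) > 0" using assms by (auto intro: Gamma_real_pos)
  have d: "real (d - 1) = real d - 1" "real (d - 2) = real d - 2" using assms by auto
  have "?G = (real d / 2 + 1 / 2) * Gamma (real d / 2 + 1 / 2)"
  proof -
    have "real d / 2 + 1 / 2 \<notin> \<int>\<^sub>\<le>\<^sub>0" using nonpos_Ints_nonpos[of "real d / 2 + 1 / 2"] by linarith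
    from Gamma_plus1[OF this] show ?thesis by (simp add: add.assoc)
  qed
  then have g1: "Gamma (real d / 2 + 1 / 2) = 2 * ?G / (real d + 1)" using assms by (simp add: field_simps)
  have "unit_ball_vol (real (d - 1)) = pi powr ((real d - 1) / 2) / Gamma (real d / 2 + 1 / 2)"
    unfolding unit_ball_vol_def d by (simp add: field_simps)
  also have "\<dots> = pi powr ((real d - 1) / 2) * (real d + 1) / (2 * ?G)"
    unfolding g1 by simp
  finally have kv: "unit_ball_vol (real (d - 1)) = pi powr ((real d - 1) / 2) * (real d + 1) / (2 * ?G)" .
  have 1: "2 * unit_ball_vol (real (d - 1)) / (real d + 1) = pi powr ((real d - 1) / 2) / ?G"
  proof -
    have "2 * (P * x / (2 * y)) / x = P / y" if "x > 0" "y > 0" for P x y :: real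
      using that by (simp add: field_simps)
    then show ?thesis unfolding kv using G by auto
  qed
  have "unit_ball_vol (real (d - 2)) = pi powr ((real d - 2) / 2) / Gamma (real d / 2)"
    unfolding unit_ball_vol_def d by (simp add: field_simps)
  moreover have "Beta (3 / 2) (real d / 2) = (sqrt pi / 2) * Gamma (real d / 2) / ?G"
  proof -
    have "(1 / 2 :: real) \<notin> \<int>\<^sub>\<le>\<^sub>0" using nonpos_Ints_nonpos[of "1 / 2 :: real"] by linarith
    from Gamma_plus1[OF this] have "Gamma (3 / 2 :: real) = sqrt pi / 2" by (simp add: Gamma_one_half_real)
    then have "Beta (3 / 2) (real d / 2) = (sqrt pi / 2) * Gamma (real d / 2) / Gamma (3 / 2 + real d / 2)"
      unfolding Beta_def by (simp only:)
    then show ?thesis by (simp only: add.commute[of "3 / 2"])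
  qed
  ultimately have 2: "unit_ball_vol (real (d - 2)) * Beta (3 / 2) (real d / 2) = pi powr ((real d - 2) / 2) * (sqrt pi / 2) / ?G"
    using G by simp
  have "pi powr ((real d - 1) / 2) = pi powr ((real d - 2) / 2) * pi powr (1/2)"
    unfolding powr_add[symmetric] by (simp add: field_simps)
  then have 3: "2 * unit_ball_vol (real (d - 1)) / (real d + 1) = 2 * (unit_ball_vol (real (d - 2)) * Beta (3 / 2) (real d / 2))"
    unfolding 1 2 by (simp add: powr_half_sqrt)
  show ?thesis unfolding 3 c_const_def by (simp add: power_mult_distrib)
qed

lemma c_const_pos:
  assumes "d \<ge> 2" shows "c_const d > 0"
proof -
  have "unit_ball_vol (real (d - 1)) > 0" by (rule unit_ball_vol_pos) simp
  then have "pi / 2 * (2 * unit_ball_vol (real (d - 1)) / (real d + 1))\<^sup>2 > 0"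
    by (intro mult_pos_pos zero_less_power divide_pos_pos) auto
  then show ?thesis by (simp only: c_const_eq[OF assms])
qed

text \<open>The vectors \<open>p\<close>, \<open>q\<close> are the very basis on which
  \<open>subspace_lborel L\<close> is built, so integrals over \<open>L\<close> turn into double
  integrals in these coordinates without a change of basis.\<close>

locale plane =
  fixes L :: "'a::euclidean_space set" and p q :: 'a
  assumes subspace_L: "subspace L"
    and basis_L: "subspace_basis L = {p, q}" and pq_neq: "p \<noteq> q"
begin

lemma onb_pq: "orthonormal_basis L {p, q}"
  using orthonormal_basis_subspace_basis[OF subspace_L] by (simp add: basis_L)

lemma inner_pq[simp]: "p \<bullet> p = 1" "q \<bullet> q = 1" "p \<bullet> q = 0" "q \<bullet> p = 0"
  using orthonormal_basis_inner[OF onb_pq] pq_neq by auto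

lemma dim_L: "dim L = 2"
  using orthonormal_basis_card[OF onb_pq] pq_neq by simp

text \<open>The signed area of the parallelogram spanned by the projections of \<open>u\<close> and
  \<open>z\<close> onto \<open>L\<close>.\<close>

definition det2 :: "'a \<Rightarrow> 'a \<Rightarrow> real" where
  "det2 u z = (u \<bullet> p) * (z \<bullet> q) - (u \<bullet> q) * (z \<bullet> p)"

lemma det2_borel[measurable]:
  assumes [measurable]: "f \<in> borel_measurable M" "h \<in> borel_measurable M"
  shows "(\<lambda>x. det2 (f x) (h x)) \<in> borel_measurable M"
  unfolding det2_def by measurable

lemma norm_pq: "norm (a *\<^sub>R p + b *\<^sub>R q) = sqrt (a\<^sup>2 + b\<^sup>2)"
  by (simp add: norm_eq_sqrt_inner inner_add_left inner_add_right power2_eq_square)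

lemma nn_integral_det2_cball:
  "(\<integral>\<^sup>+u. ennreal \<bar>det2 u z\<bar> * indicator (cball 0 1) u \<partial>lborel)
    = ennreal (2 * unit_ball_vol (DIM('a) - 1) / (DIM('a) + 1) * sqrt ((z \<bullet> p)\<^sup>2 + (z \<bullet> q)\<^sup>2))"
proof -
  \<comment> \<open>A linear form in \<open>u\<close>, whose vector is the projection of
    \<open>z\<close> turned by a right angle.\<close>
  have "det2 u z = u \<bullet> ((z \<bullet> q) *\<^sub>R p + (- (z \<bullet> p)) *\<^sub>R q)" for u
    by (simp add: det2_def inner_add_right inner_diff_right algebra_simps)
  then show ?thesis
    using nn_integral_abs_inner_cball'[of "(z \<bullet> q) *\<^sub>R p + (- (z \<bullet> p)) *\<^sub>R q"]
    unfolding norm_pq by (simp add: add.commute)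
qed

text \<open>The norm of the projection is a multiple of the mean of \<open>\<bar>z \<bullet> e\<bar>\<close> over the unit vectors \<open>e\<close> of
  the plane, and the integral of \<open>\<bar>z \<bullet> e\<bar>\<close> over the ball does not depend on \<open>e\<close>.\<close>

lemma nn_integral_norm_proj_cball:
  "(\<integral>\<^sup>+z. ennreal (sqrt ((z \<bullet> p)\<^sup>2 + (z \<bullet> q)\<^sup>2)) * indicator (cball 0 1) z \<partial>lborel)
    = ennreal (pi / 2 * (2 * unit_ball_vol (DIM('a) - 1) / (DIM('a) + 1)))"
proof -
  let ?M = "2 * unit_ball_vol (DIM('a) - 1) / (DIM('a) + 1)"
  let ?I = "(\<integral>\<^sup>+z. ennreal (sqrt ((z \<bullet> p)\<^sup>2 + (z \<bullet> q)\<^sup>2)) * indicator (cball 0 1) (z::'a) \<partial>lborel)"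
  let ?e = "\<lambda>\<theta>. cos \<theta> *\<^sub>R p + sin \<theta> *\<^sub>R q"
  let ?H = "\<lambda>\<theta>. (\<integral>\<^sup>+z. ennreal \<bar>(z \<bullet> p) * cos \<theta> + (z \<bullet> q) * sin \<theta>\<bar> * indicator {0..<2*pi} \<theta> * indicator (cball 0 1) z \<partial>lborel)"
  have "ennreal 4 * ?I = (\<integral>\<^sup>+z. ennreal (4 * sqrt ((z \<bullet> p)\<^sup>2 + (z \<bullet> q)\<^sup>2)) * indicator (cball 0 1) z \<partial>lborel)"
    by (subst nn_integral_cmult[symmetric]) (auto simp: ennreal_mult mult.assoc)
  also have "\<dots> = (\<integral>\<^sup>+z. (\<integral>\<^sup>+\<theta>. ennreal \<bar>(z \<bullet> p) * cos \<theta> + (z \<bullet> q) * sin \<theta>\<bar> * indicator {0..<2*pi} \<theta> * indicator (cball 0 1) z \<partial>lborel) \<partial>lborel)"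
    by (subst nn_integral_multc) (auto simp: nn_integral_abs_sincos)
  also have "\<dots> = (\<integral>\<^sup>+\<theta>. ?H \<theta> \<partial>lborel)"
    by (rule lborel_pair.Fubini'[symmetric]) measurable
  also have "\<dots> = (\<integral>\<^sup>+\<theta>. ennreal ?M * indicator {0..<2*pi} \<theta> \<partial>lborel)"
  proof (rule nn_integral_cong)
    fix \<theta> :: real
    have "norm (?e \<theta>) = 1" unfolding norm_pq by simp
    from nn_integral_abs_inner_cball[OF this]
    have *: "(\<integral>\<^sup>+z. ennreal \<bar>z \<bullet> ?e \<theta>\<bar> * indicator (cball 0 1) z \<partial>lborel) = ennreal ?M" .
    have "?H \<theta>
      = (\<integral>\<^sup>+z. (ennreal \<bar>z \<bullet> ?e \<theta>\<bar> * indicator (cball 0 1) z) * indicator {0..<2*pi} \<theta> \<partial>lborel)"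
      by (intro nn_integral_cong) (simp add: inner_add_right mult_ac)
    also have "\<dots> = ennreal ?M * indicator {0..<2*pi} \<theta>"
      by (subst nn_integral_multc) (auto simp: *)
    finally show "?H \<theta>
      = ennreal ?M * indicator {0..<2*pi} \<theta>" .
  qed
  also have "\<dots> = ennreal ?M * ennreal (2 * pi)"
    by (subst nn_integral_cmult) auto
  also have "\<dots> = ennreal (4 * (pi / 2 * ?M))"
    by (subst ennreal_mult[symmetric]) auto
  also have "\<dots> = ennreal 4 * ennreal (pi / 2 * ?M)"
    by (rule ennreal_mult) auto
  finally show ?thesis by (subst (asm) ennreal_mult_cancel_left) auto
qed

text \<open>The determinant is homogeneous of degree 1 in \<open>u\<close>, and the integral over
  \<open>u\<close> leaves a multiple of the norm of the projection of \<open>z\<close>, again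
  homogeneous of degree 1. Degree 1 in dimension d is the source of the weight r^d and of the two
  factors d + 1.\<close>

lemma nn_integral_det2:
  assumes [measurable]: "g \<in> borel_measurable borel" "h \<in> borel_measurable borel"
  shows "(\<integral>\<^sup>+z. (\<integral>\<^sup>+u. ennreal \<bar>det2 u z\<bar> * g (norm u) * h (norm z) \<partial>lborel) \<partial>lborel)
    = ennreal ((real (DIM('a)) + 1)\<^sup>2 * c_const DIM('a)) *
      (\<integral>\<^sup>+r. ennreal (r ^ DIM('a)) * indicator {0..} r * g r \<partial>lborel) *
      (\<integral>\<^sup>+r. ennreal (r ^ DIM('a)) * indicator {0..} r * h r \<partial>lborel)"
proof -
  let ?M = "2 * unit_ball_vol (DIM('a) - 1) / (DIM('a) + 1)" and ?d = "DIM('a)"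
  let ?J = "\<lambda>g. (\<integral>\<^sup>+r. ennreal (r ^ DIM('a)) * indicator {0..} r * g r \<partial>lborel)"
  let ?\<rho> = "\<lambda>z. sqrt ((z \<bullet> p)\<^sup>2 + (z \<bullet> q)\<^sup>2)"
  let ?G = "\<lambda>z. (\<integral>\<^sup>+u. ennreal \<bar>det2 u z\<bar> * g (norm u) * h (norm z) \<partial>lborel)"
  have M0: "?M \<ge> 0" by simp
  have 1: "(\<integral>\<^sup>+u. ennreal \<bar>det2 u z\<bar> * g (norm u) \<partial>lborel) = ennreal (real (?d + 1) * (?M * ?\<rho> z)) * ?J g" for z
  proof -
    have "det2 (c *\<^sub>R x) z = c * det2 x z" for c x by (simp add: det2_def algebra_simps)
    then show ?thesis
      using nn_integral_homogeneous[of "\<lambda>u. ennreal \<bar>det2 u z\<bar>" 1 "?M * ?\<rho> z" g]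
      by (auto simp: nn_integral_det2_cball ennreal_mult[symmetric] abs_mult)
  qed
  have 2: "(\<integral>\<^sup>+z. ennreal (?\<rho> z) * h (norm z) \<partial>lborel) = ennreal (real (?d + 1) * (pi / 2 * ?M)) * ?J h"
  proof -
    have "?\<rho> (c *\<^sub>R x) = c * ?\<rho> x" if "c > 0" for c x
      using that by (simp add: power_mult_distrib real_sqrt_mult flip: distrib_left)
    then show ?thesis
      using nn_integral_homogeneous[of "\<lambda>z. ennreal (?\<rho> z)" 1 "pi / 2 * ?M" h]
      by (auto simp: nn_integral_norm_proj_cball ennreal_mult[symmetric])
  qed
  have "(\<integral>\<^sup>+z. ?G z \<partial>lborel)
    = (\<integral>\<^sup>+z. (ennreal (real (?d + 1) * ?M) * ?J g) * (ennreal (?\<rho> z) * h (norm z)) \<partial>lborel)"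
  proof (rule nn_integral_cong)
    fix z
    have "?G z = ennreal (real (?d + 1) * ?M * ?\<rho> z) * ?J g * h (norm z)"
      by (subst nn_integral_multc) (auto simp: 1 mult.assoc)
    also have "ennreal (real (?d + 1) * ?M * ?\<rho> z) = ennreal (real (?d + 1) * ?M) * ennreal (?\<rho> z)"
      by (rule ennreal_mult) auto
    finally show "?G z = (ennreal (real (?d + 1) * ?M) * ?J g) * (ennreal (?\<rho> z) * h (norm z))"
      by (simp only: mult_ac)
  qed
  also have "\<dots> = (ennreal (real (?d + 1) * ?M) * ?J g) * (ennreal (real (?d + 1) * (pi / 2 * ?M)) * ?J h)"
    by (subst nn_integral_cmult) (auto simp: 2)
  also have "\<dots> = (ennreal (real (?d + 1) * ?M) * ennreal (real (?d + 1) * (pi / 2 * ?M))) * ?J g * ?J h"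
    by (simp only: mult_ac)
  also have "ennreal (real (?d + 1) * ?M) * ennreal (real (?d + 1) * (pi / 2 * ?M)) = ennreal ((real ?d + 1)\<^sup>2 * (pi / 2 * ?M\<^sup>2))"
    by (subst ennreal_mult[symmetric]) (auto simp: power2_eq_square mult_ac add_ac)
  also have "pi / 2 * ?M\<^sup>2 = c_const ?d"
  proof -
    have "dim L \<le> DIM('a)" by (rule dim_subset_UNIV)
    then show ?thesis using c_const_eq[of ?d] dim_L by (simp add: add.commute)
  qed
  finally show ?thesis .
qed

end

section \<open>Crossing pairs of segments\<close>

text \<open>Two one-dimensional affine substitutions in the manner of Gaussian elimination, with
  Tonelli in between. If \<open>a\<close> vanishes there is no pivot, but then \<open>b\<close> and
  \<open>c\<close> are nonzero and the matrix is triangular up to order.\<close>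

lemma nn_integral_real2_linear:
  fixes \<phi> :: "real \<Rightarrow> real \<Rightarrow> ennreal"
  assumes [measurable]: "(\<lambda>(x, y). \<phi> x y) \<in> borel_measurable (borel \<Otimes>\<^sub>M borel)"
    and D: "a * e - b * c \<noteq> 0"
  shows "(\<integral>\<^sup>+x. (\<integral>\<^sup>+y. \<phi> x y \<partial>lborel) \<partial>lborel)
    = ennreal \<bar>a * e - b * c\<bar> * (\<integral>\<^sup>+s. (\<integral>\<^sup>+r. \<phi> (a * s + c * r) (b * s + e * r) \<partial>lborel) \<partial>lborel)"
proof (cases "a = 0")
  case False
  let ?rhs = "(\<integral>\<^sup>+s. (\<integral>\<^sup>+r. \<phi> (a * s + c * r) (b * s + e * r) \<partial>lborel) \<partial>lborel)"
  \<comment> \<open>First \<open>y = b / a * x + D / a * r\<close> at fixed \<open>x\<close>, then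
    \<open>x = c * r + a * s\<close> at fixed \<open>r\<close>; the Jacobians \<open>D / a\<close>
    and \<open>a\<close> multiply to \<open>D\<close>.\<close>
  define D where "D = a * e - b * c"
  have Da: "D / a \<noteq> 0" "D \<noteq> 0" using D False by (auto simp: D_def)
  have "(\<integral>\<^sup>+x. (\<integral>\<^sup>+y. \<phi> x y \<partial>lborel) \<partial>lborel)
    = (\<integral>\<^sup>+x. ennreal \<bar>D / a\<bar> * (\<integral>\<^sup>+r. \<phi> x (b / a * x + D / a * r) \<partial>lborel) \<partial>lborel)"
    by (intro nn_integral_cong nn_integral_real_affine Da) auto
  also have "\<dots> = ennreal \<bar>D / a\<bar> * (\<integral>\<^sup>+x. (\<integral>\<^sup>+r. \<phi> x (b / a * x + D / a * r) \<partial>lborel) \<partial>lborel)"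
    by (rule nn_integral_cmult) measurable
  also have "(\<integral>\<^sup>+x. (\<integral>\<^sup>+r. \<phi> x (b / a * x + D / a * r) \<partial>lborel) \<partial>lborel)
    = (\<integral>\<^sup>+r. (\<integral>\<^sup>+x. \<phi> x (b / a * x + D / a * r) \<partial>lborel) \<partial>lborel)"
    by (rule lborel_pair.Fubini'[symmetric]) measurable
  also have "\<dots> = (\<integral>\<^sup>+r. ennreal \<bar>a\<bar> * (\<integral>\<^sup>+s. \<phi> (c * r + a * s) (b / a * (c * r + a * s) + D / a * r) \<partial>lborel) \<partial>lborel)"
    by (intro nn_integral_cong nn_integral_real_affine False) auto
  also have "\<dots> = ennreal \<bar>a\<bar> * (\<integral>\<^sup>+r. (\<integral>\<^sup>+s. \<phi> (c * r + a * s) (b / a * (c * r + a * s) + D / a * r) \<partial>lborel) \<partial>lborel)"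
    by (rule nn_integral_cmult) measurable
  also have "(\<integral>\<^sup>+r. (\<integral>\<^sup>+s. \<phi> (c * r + a * s) (b / a * (c * r + a * s) + D / a * r) \<partial>lborel) \<partial>lborel)
    = (\<integral>\<^sup>+r. (\<integral>\<^sup>+s. \<phi> (a * s + c * r) (b * s + e * r) \<partial>lborel) \<partial>lborel)"
  proof -
    have "b / a * (c * r + a * s) + D / a * r = b * s + e * r" for r s
      using False by (simp add: D_def field_simps)
    then show ?thesis by (simp add: add.commute)
  qed
  also have "\<dots> = ?rhs"
    by (rule lborel_pair.Fubini') measurable
  also have "ennreal \<bar>D / a\<bar> * (ennreal \<bar>a\<bar> * ?rhs)
    = ennreal (\<bar>D / a\<bar> * \<bar>a\<bar>) * ?rhs"
    by (subst ennreal_mult) (simp_all only: abs_ge_zero mult.assoc)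
  also have "\<bar>D / a\<bar> * \<bar>a\<bar> = \<bar>D\<bar>" using False by simp
  finally show ?thesis by (simp add: D_def)
next
  case True
  then have bc: "b \<noteq> 0" "c \<noteq> 0" using D by auto
  have "(\<integral>\<^sup>+x. (\<integral>\<^sup>+y. \<phi> x y \<partial>lborel) \<partial>lborel) = ennreal \<bar>c\<bar> * (\<integral>\<^sup>+r. (\<integral>\<^sup>+y. \<phi> (0 + c * r) y \<partial>lborel) \<partial>lborel)"
    by (rule nn_integral_real_affine) (use bc in auto)
  also have "\<dots> = ennreal \<bar>c\<bar> * (\<integral>\<^sup>+r. ennreal \<bar>b\<bar> * (\<integral>\<^sup>+s. \<phi> (0 + c * r) (e * r + b * s) \<partial>lborel) \<partial>lborel)"
    by (intro arg_cong2[where f="(*)"] refl nn_integral_cong nn_integral_real_affine) (use bc in auto)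
  also have "\<dots> = ennreal \<bar>c\<bar> * (ennreal \<bar>b\<bar> * (\<integral>\<^sup>+r. (\<integral>\<^sup>+s. \<phi> (c * r) (e * r + b * s) \<partial>lborel) \<partial>lborel))"
    by (subst nn_integral_cmult) auto
  also have "(\<integral>\<^sup>+r. (\<integral>\<^sup>+s. \<phi> (c * r) (e * r + b * s) \<partial>lborel) \<partial>lborel)
    = (\<integral>\<^sup>+s. (\<integral>\<^sup>+r. \<phi> (c * r) (e * r + b * s) \<partial>lborel) \<partial>lborel)"
    by (rule lborel_pair.Fubini') measurable
  also have "ennreal \<bar>c\<bar> * (ennreal \<bar>b\<bar> * (\<integral>\<^sup>+s. (\<integral>\<^sup>+r. \<phi> (c * r) (e * r + b * s) \<partial>lborel) \<partial>lborel))
    = ennreal (\<bar>c\<bar> * \<bar>b\<bar>) * (\<integral>\<^sup>+s. (\<integral>\<^sup>+r. \<phi> (c * r) (e * r + b * s) \<partial>lborel) \<partial>lborel)"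
    by (simp add: ennreal_mult mult.assoc)
  finally show ?thesis using True by (simp add: abs_mult mult.commute add.commute)
qed

context plane
begin

abbreviation "\<nu> \<equiv> subspace_lborel (L\<^sup>\<bottom>)"

text \<open>The volume of the fibre through \<open>x\<close> as an extended number: unlike in
  \<open>fibre_volume\<close>, the value infinity is kept, so Tonelli applies before finiteness is
  known.\<close>

definition fibre :: "'a set \<Rightarrow> 'a \<Rightarrow> ennreal" where
  "fibre A x = (\<integral>\<^sup>+y. indicator A (x + y) \<partial>\<nu>)"

text \<open>For nonparallel \<open>u\<close>, \<open>z\<close>, Cramer's rule gives \<open>y = s u - r z\<close> modulo \<open>L\<^sup>\<bottom>\<close> with \<open>s\<close>, \<open>r\<close> the two
  quotients.\<close>

definition meet :: "'a \<Rightarrow> 'a \<Rightarrow> 'a \<Rightarrow> ennreal" where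
  "meet u z y = indicator {0..1} (det2 y z / det2 u z) * indicator {0..1} (det2 y u / det2 u z)"

text \<open>Split along \<open>L\<close> and its complement, this is the integral over
  \<open>L\<close> of the product of the two fibre volumes. Written with a full integral over
  \<open>A\<close>, it can be bounded directly by the volume of \<open>A\<close>.\<close>

definition pairing :: "'a set \<Rightarrow> 'a set \<Rightarrow> ennreal" where
  "pairing A B = (\<integral>\<^sup>+v. indicator A v * fibre B v \<partial>lborel)"

lemma sigma_finite_LP: "sigma_finite_measure \<nu>"
  by (rule sigma_finite_subspace_lborel[OF subspace_orthogonal_comp])

lemma fibre_borel [measurable (raw)]:
  assumes [measurable]: "A \<in> sets borel" "f \<in> borel_measurable M"
  shows "(\<lambda>x. fibre A (f x)) \<in> borel_measurable M"
proof -
  interpret sigma_finite_measure \<nu> by (rule sigma_finite_LP)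
  show ?thesis unfolding fibre_def by measurable
qed

lemma meet_borel [measurable (raw)]:
  assumes [measurable]: "f \<in> borel_measurable M" "g \<in> borel_measurable M" "h \<in> borel_measurable M"
  shows "(\<lambda>x. meet (f x) (g x) (h x)) \<in> borel_measurable M"
  unfolding meet_def by measurable

lemma inner_LP:
  assumes "y \<in> L\<^sup>\<bottom>" shows "y \<bullet> p = 0" "y \<bullet> q = 0"
  using assms onb_pq unfolding orthonormal_basis_def orthogonal_comp_def orthogonal_def
  by (auto simp: inner_commute)

lemma LP_iff: "y \<in> L\<^sup>\<bottom> \<longleftrightarrow> y \<bullet> p = 0 \<and> y \<bullet> q = 0"
proof
  assume *: "y \<bullet> p = 0 \<and> y \<bullet> q = 0"
  have "x \<bullet> y = 0" if "x \<in> L" for x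
    by (subst onb_repr[OF onb_pq that]) (use * pq_neq in \<open>simp add: inner_add_right inner_commute\<close>)
  then show "y \<in> L\<^sup>\<bottom>" by (simp add: orthogonal_comp_def orthogonal_def)
qed (auto dest: inner_LP)

lemma fibre_shift:
  assumes A[measurable]: "A \<in> sets borel" and y: "y \<in> L\<^sup>\<bottom>"
  shows "fibre A (x + y) = fibre A x"
proof -
  have "\<nu> = distr \<nu> borel ((+) y)"
    unfolding subspace_lborel_onb
    by (rule distr_onb_lborel_translate[symmetric, OF orthonormal_basis_subspace_basis[OF subspace_orthogonal_comp] y])
  then have "fibre A x = (\<integral>\<^sup>+w. indicator A (x + w) \<partial>distr \<nu> borel ((+) y))"
    unfolding fibre_def by simp
  also have "\<dots> = fibre A (x + y)"
    unfolding fibre_def by (subst nn_integral_distr) (auto simp: add.assoc)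
  finally show ?thesis by simp
qed

lemma fibre_cong_proj:
  assumes "A \<in> sets borel" "x \<bullet> p = y \<bullet> p" "x \<bullet> q = y \<bullet> q"
  shows "fibre A x = fibre A y"
proof -
  have "x - y \<in> L\<^sup>\<bottom>" using assms by (simp add: LP_iff inner_diff_left)
  from fibre_shift[OF assms(1) this, of y] show ?thesis by simp
qed

lemma meet_cong_proj:
  assumes "x \<bullet> p = y \<bullet> p" "x \<bullet> q = y \<bullet> q"
  shows "meet u z x = meet u z y"
  using assms by (simp add: meet_def det2_def)

lemma nn_integral_subspace_L:
  assumes [measurable]: "f \<in> borel_measurable borel"
  shows "(\<integral>\<^sup>+x. f x \<partial>subspace_lborel L) = (\<integral>\<^sup>+a. (\<integral>\<^sup>+b. f (a *\<^sub>R p + b *\<^sub>R q) \<partial>lborel) \<partial>lborel)"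
proof -
  interpret product_sigma_finite "\<lambda>_. lborel :: real measure" ..
  have "(\<integral>\<^sup>+x. f x \<partial>subspace_lborel L) = (\<integral>\<^sup>+\<omega>. f (\<Sum>b\<in>{p, q}. \<omega> b *\<^sub>R b) \<partial>(\<Pi>\<^sub>M b\<in>{p, q}. lborel))"
    unfolding subspace_lborel_onb basis_L by (rule nn_integral_onb_lborel) simp
  also have "\<dots> = (\<integral>\<^sup>+\<omega>. f (\<omega> p *\<^sub>R p + \<omega> q *\<^sub>R q) \<partial>(\<Pi>\<^sub>M b\<in>{p, q}. lborel))"
    using pq_neq by simp
  also have "\<dots> = (\<integral>\<^sup>+a. (\<integral>\<^sup>+\<omega>. f (a *\<^sub>R p + \<omega> q *\<^sub>R q) \<partial>(\<Pi>\<^sub>M b\<in>{q}. lborel)) \<partial>lborel)"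
    using pq_neq by (subst product_nn_integral_insert_rev) auto
  also have "\<dots> = (\<integral>\<^sup>+a. (\<integral>\<^sup>+b. f (a *\<^sub>R p + b *\<^sub>R q) \<partial>lborel) \<partial>lborel)"
    by (intro nn_integral_cong product_nn_integral_singleton) auto
  finally show ?thesis .
qed

lemma nn_integral_split:
  fixes f :: "'a \<Rightarrow> ennreal"
  assumes [measurable]: "f \<in> borel_measurable borel"
  shows "(\<integral>\<^sup>+x. f x \<partial>lborel) = (\<integral>\<^sup>+x. (\<integral>\<^sup>+y. f (x + y) \<partial>\<nu>) \<partial>subspace_lborel L)"
  by (rule nn_integral_lborel_subspace_split[OF subspace_L]) simp

text \<open>\<open>meet\<close> sees only the projection of w - v, so integrating out the complement
  turns \<open>B\<close> into \<open>fibre B\<close>. On \<open>L\<close> the coordinates s, r of s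
  u - r z have Jacobian \<open>\<bar>det2 u z\<bar>\<close>, and in them \<open>meet\<close> is the
  indicator of the unit square.\<close>

lemma nn_integral_meet:
  assumes B[measurable]: "B \<in> sets borel" and D: "det2 u z \<noteq> 0"
  shows "(\<integral>\<^sup>+w. indicator B w * meet u z (w - v) \<partial>lborel) = ennreal \<bar>det2 u z\<bar> *
    (\<integral>\<^sup>+s. (\<integral>\<^sup>+r. indicator {0..1} s * indicator {0..1} r * fibre B (v + s *\<^sub>R u - r *\<^sub>R z) \<partial>lborel) \<partial>lborel)"
proof -
  let ?y = "\<lambda>s r. ((u \<bullet> p) * s + - (z \<bullet> p) * r) *\<^sub>R p + ((u \<bullet> q) * s + - (z \<bullet> q) * r) *\<^sub>R q"
  interpret P: sigma_finite_measure \<nu> by (rule sigma_finite_LP)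
  have "(\<integral>\<^sup>+w. indicator B w * meet u z (w - v) \<partial>lborel) = (\<integral>\<^sup>+w. indicator B (v + w) * meet u z (v + w - v) \<partial>lborel)"
    by (rule nn_integral_lborel_translate[symmetric]) measurable
  also have "\<dots> = (\<integral>\<^sup>+w. indicator B (v + w) * meet u z w \<partial>lborel)" by simp
  also have "\<dots> = (\<integral>\<^sup>+x. (\<integral>\<^sup>+y. indicator B (v + (x + y)) * meet u z (x + y) \<partial>\<nu>) \<partial>subspace_lborel L)"
    by (rule nn_integral_split) measurable
  also have "\<dots> = (\<integral>\<^sup>+x. fibre B (v + x) * meet u z x \<partial>subspace_lborel L)"
  proof (rule nn_integral_cong)
    fix x
    have "(\<integral>\<^sup>+y. indicator B (v + (x + y)) * meet u z (x + y) \<partial>\<nu>) = (\<integral>\<^sup>+y. indicator B (v + x + y) * meet u z x \<partial>\<nu>)"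
    proof (rule nn_integral_cong_AE)
      show "AE y in \<nu>. indicator B (v + (x + y)) * meet u z (x + y) = indicator B (v + x + y) * meet u z x"
        using AE_subspace_lborel[OF subspace_orthogonal_comp]
      proof eventually_elim
        case (elim y)
        then have "meet u z (x + y) = meet u z x"
          by (intro meet_cong_proj) (auto simp: inner_add_left inner_LP)
        then show ?case by (simp add: add.assoc)
      qed
    qed
    also have "\<dots> = fibre B (v + x) * meet u z x"
      unfolding fibre_def by (rule nn_integral_multc) measurable
    finally show "(\<integral>\<^sup>+y. indicator B (v + (x + y)) * meet u z (x + y) \<partial>\<nu>) = fibre B (v + x) * meet u z x" .
  qed
  also have "\<dots> = (\<integral>\<^sup>+a. (\<integral>\<^sup>+b. fibre B (v + (a *\<^sub>R p + b *\<^sub>R q)) * meet u z (a *\<^sub>R p + b *\<^sub>R q) \<partial>lborel) \<partial>lborel)"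
    by (rule nn_integral_subspace_L) measurable
  also have "\<dots> = ennreal \<bar>(u \<bullet> p) * - (z \<bullet> q) - (u \<bullet> q) * - (z \<bullet> p)\<bar> *
    (\<integral>\<^sup>+s. (\<integral>\<^sup>+r. fibre B (v + (?y s r))
      * meet u z (?y s r) \<partial>lborel) \<partial>lborel)"
    by (rule nn_integral_real2_linear) (use D in \<open>auto simp: det2_def\<close>)
  also have "\<bar>(u \<bullet> p) * - (z \<bullet> q) - (u \<bullet> q) * - (z \<bullet> p)\<bar> = \<bar>det2 u z\<bar>"
    by (simp add: det2_def algebra_simps abs_minus_commute)
  also have "(\<integral>\<^sup>+s. (\<integral>\<^sup>+r. fibre B (v + (?y s r))
      * meet u z (?y s r) \<partial>lborel) \<partial>lborel)
    = (\<integral>\<^sup>+s. (\<integral>\<^sup>+r. indicator {0..1} s * indicator {0..1} r * fibre B (v + s *\<^sub>R u - r *\<^sub>R z) \<partial>lborel) \<partial>lborel)"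
  proof (intro nn_integral_cong)
    fix s r :: real
    have y: "(?y s r) \<bullet> p = (s *\<^sub>R u - r *\<^sub>R z) \<bullet> p" "(?y s r) \<bullet> q = (s *\<^sub>R u - r *\<^sub>R z) \<bullet> q"
      by (simp_all add: inner_add_left inner_diff_left mult.commute)
    have "fibre B (v + (?y s r)) = fibre B (v + s *\<^sub>R u - r *\<^sub>R z)"
      by (rule fibre_cong_proj[OF B]) (use y in \<open>auto simp: inner_add_left inner_diff_left\<close>)
    moreover have "meet u z (?y s r) = meet u z (s *\<^sub>R u - r *\<^sub>R z)"
      by (rule meet_cong_proj) (use y in auto)
    \<comment> \<open>The determinant is alternating, so Cramer's quotients return \<open>s\<close>
      and \<open>r\<close>.\<close>
    moreover have "det2 (s *\<^sub>R u - r *\<^sub>R z) z = s * det2 u z" "det2 (s *\<^sub>R u - r *\<^sub>R z) u = r * det2 u z"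
      by (simp_all add: det2_def inner_diff_left algebra_simps)
    ultimately show "fibre B (v + (?y s r)) * meet u z (?y s r) = indicator {0..1} s * indicator {0..1} r * fibre B (v + s *\<^sub>R u - r *\<^sub>R z)"
      using D by (simp add: meet_def mult_ac)
  qed
  finally show ?thesis .
qed

text \<open>The possible positions of the point at parameter \<open>s\<close> on a segment with edge
  vector \<open>u\<close> and both ends in \<open>W\<close>.\<close>

definition chord_dom :: "'a set \<Rightarrow> real \<Rightarrow> 'a \<Rightarrow> 'a set" where
  "chord_dom W s u = {v. v - s *\<^sub>R u \<in> W \<and> v + (1 - s) *\<^sub>R u \<in> W}"

lemma nn_integral_crossing:
  assumes W[measurable]: "W \<in> sets borel" and D: "det2 u z \<noteq> 0"
  shows "(\<integral>\<^sup>+v. (\<integral>\<^sup>+w. indicator W v * indicator W (v + u) * (indicator W w * indicator W (w + z)) * meet u z (w - v) \<partial>lborel) \<partial>lborel)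
    = ennreal \<bar>det2 u z\<bar> *
     (\<integral>\<^sup>+s. (\<integral>\<^sup>+r. indicator {0..1} s * indicator {0..1} r * pairing (chord_dom W s u) (chord_dom W r z) \<partial>lborel) \<partial>lborel)"
proof -
  define B where "B = {w. w \<in> W \<and> w + z \<in> W}"
  have B[measurable]: "B \<in> sets borel" unfolding B_def by measurable
  have indB: "indicator B w = (indicator W w * indicator W (w + z) :: ennreal)" for w
    by (auto simp: B_def indicator_def)
  let ?A = "\<lambda>v. indicator W v * indicator W (v + u) :: ennreal"
  let ?h = "\<lambda>s r v. indicator {0..1} s * indicator {0..1} r * fibre B (v + s *\<^sub>R u - r *\<^sub>R z)"
  have "(\<integral>\<^sup>+v. (\<integral>\<^sup>+w. ?A v * (indicator W w * indicator W (w + z)) * meet u z (w - v) \<partial>lborel) \<partial>lborel)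
    = (\<integral>\<^sup>+v. ?A v * (\<integral>\<^sup>+w. indicator B w * meet u z (w - v) \<partial>lborel) \<partial>lborel)"
    by (subst nn_integral_cmult[symmetric]) (auto simp: indB mult.assoc)
  also have "\<dots> = (\<integral>\<^sup>+v. ennreal \<bar>det2 u z\<bar> * (?A v * (\<integral>\<^sup>+s. (\<integral>\<^sup>+r. ?h s r v \<partial>lborel) \<partial>lborel)) \<partial>lborel)"
    by (simp add: nn_integral_meet[OF B D] mult_ac)
  also have "\<dots> = ennreal \<bar>det2 u z\<bar> * (\<integral>\<^sup>+v. ?A v * (\<integral>\<^sup>+s. (\<integral>\<^sup>+r. ?h s r v \<partial>lborel) \<partial>lborel) \<partial>lborel)"
    by (rule nn_integral_cmult) measurable
  also have "(\<integral>\<^sup>+v. ?A v * (\<integral>\<^sup>+s. (\<integral>\<^sup>+r. ?h s r v \<partial>lborel) \<partial>lborel) \<partial>lborel)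
    = (\<integral>\<^sup>+v. (\<integral>\<^sup>+s. (\<integral>\<^sup>+r. ?A v * ?h s r v \<partial>lborel) \<partial>lborel) \<partial>lborel)"
    by (simp add: nn_integral_cmult)
  also have "\<dots> = (\<integral>\<^sup>+s. (\<integral>\<^sup>+v. (\<integral>\<^sup>+r. ?A v * ?h s r v \<partial>lborel) \<partial>lborel) \<partial>lborel)"
    by (rule lborel_pair.Fubini'[symmetric]) measurable
  also have "\<dots> = (\<integral>\<^sup>+s. (\<integral>\<^sup>+r. (\<integral>\<^sup>+v. ?A v * ?h s r v \<partial>lborel) \<partial>lborel) \<partial>lborel)"
    by (intro nn_integral_cong, rule lborel_pair.Fubini'[symmetric]) measurable
  also have "\<dots> = (\<integral>\<^sup>+s. (\<integral>\<^sup>+r. indicator {0..1} s * indicator {0..1} r * pairing (chord_dom W s u) (chord_dom W r z) \<partial>lborel) \<partial>lborel)"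
  proof (intro nn_integral_cong)
    fix s r :: real
    have "(\<integral>\<^sup>+v. ?A v * ?h s r v \<partial>lborel)
      = (\<integral>\<^sup>+v. indicator {0..1} s * indicator {0..1} r * (?A v * fibre B (v + s *\<^sub>R u - r *\<^sub>R z)) \<partial>lborel)"
      by (simp add: mult_ac)
    also have "\<dots> = indicator {0..1} s * indicator {0..1} r * (\<integral>\<^sup>+v. ?A v * fibre B (v + s *\<^sub>R u - r *\<^sub>R z) \<partial>lborel)"
      by (rule nn_integral_cmult) measurable
    \<comment> \<open>The translation moves the base point from the start of the first edge to its
      point at parameter \<open>s\<close>, where the crossing takes place; from there both edges are
      described by \<open>chord_dom\<close>.\<close>
    also have "(\<integral>\<^sup>+v. ?A v * fibre B (v + s *\<^sub>R u - r *\<^sub>R z) \<partial>lborel)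
      = (\<integral>\<^sup>+v. ?A (- s *\<^sub>R u + v) * fibre B (- s *\<^sub>R u + v + s *\<^sub>R u - r *\<^sub>R z) \<partial>lborel)"
      by (rule nn_integral_lborel_translate[symmetric]) measurable
    also have "\<dots> = pairing (chord_dom W s u) (chord_dom W r z)"
      unfolding pairing_def fibre_def
    proof (intro nn_integral_cong arg_cong2[where f="(*)"])
      fix v y
      have e: "- s *\<^sub>R u + v = v - s *\<^sub>R u" "v - s *\<^sub>R u + u = v + (1 - s) *\<^sub>R u" by (simp_all add: algebra_simps)
      show "?A (- s *\<^sub>R u + v) = indicator (chord_dom W s u) v"
        by (simp only: indicator_def chord_dom_def e mem_Collect_eq) auto
      have "v + y + (1 - r) *\<^sub>R z = v + y - r *\<^sub>R z + z" by (simp add: algebra_simps)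
      then show "indicator B (- s *\<^sub>R u + v + s *\<^sub>R u - r *\<^sub>R z + y) = (indicator (chord_dom W r z) (v + y) :: ennreal)"
        by (auto simp: indicator_def chord_dom_def B_def algebra_simps)
    qed
    finally show "(\<integral>\<^sup>+v. ?A v * ?h s r v \<partial>lborel)
      = indicator {0..1} s * indicator {0..1} r * pairing (chord_dom W s u) (chord_dom W r z)" .
  qed
  finally show ?thesis .
qed

end

section \<open>Volume estimates for a convex body\<close>

text \<open>Apart from convexity and unit volume, the shape of \<open>W\<close> enters through a
  bound \<open>D\<close> on the diameter and an inscribed ball of radius \<rho>; all constants are
  made of \<open>D\<close>, \<rho> and the dimension.\<close>

locale body = plane +
  fixes W :: "'a set" and D \<rho> :: real and p0 :: 'a
  assumes W_borel [measurable]: "W \<in> sets borel" and W_convex: "convex W"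
    and W_vol: "emeasure lborel W = 1"
    and D_pos: "D > 0" and \<rho>_pos: "\<rho> > 0" and ball_W: "cball p0 \<rho> \<subseteq> W"
    and diam_W: "\<And>x y. x \<in> W \<Longrightarrow> y \<in> W \<Longrightarrow> norm (x - y) \<le> D"
begin

lemma chord_dom_subset:
  assumes "0 \<le> s" "s \<le> 1" shows "chord_dom W s u \<subseteq> W"
proof
  fix v assume "v \<in> chord_dom W s u"
  then have v: "v - s *\<^sub>R u \<in> W" "v + (1 - s) *\<^sub>R u \<in> W" by (auto simp: chord_dom_def)
  have "(1 - s) *\<^sub>R (v - s *\<^sub>R u) + s *\<^sub>R (v + (1 - s) *\<^sub>R u) \<in> W"
    by (rule convexD[OF W_convex v]) (use assms in auto)
  also have "(1 - s) *\<^sub>R (v - s *\<^sub>R u) + s *\<^sub>R (v + (1 - s) *\<^sub>R u) = v"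
    by (simp add: algebra_simps)
  finally show "v \<in> W" .
qed

lemma chord_dom_borel [measurable]: "chord_dom W s u \<in> sets borel"
  unfolding chord_dom_def by measurable

text \<open>The homothetic copy of \<open>W\<close> with centre \<open>p0\<close> and factor \<open>1 - norm u / \<rho>\<close> lies in \<open>chord_dom W s u\<close>.\<close>

lemma emeasure_diff_chord_dom:
  assumes s: "0 \<le> s" "s \<le> 1"
  shows "emeasure lborel (W - chord_dom W s u) \<le> ennreal (DIM('a) * norm u / \<rho>)"
proof (cases "norm u \<ge> \<rho>")
  \<comment> \<open>For a vector at least as long as \<rho> the right side is at least 1, the volume
    of \<open>W\<close>.\<close>
  case True
  have "emeasure lborel (W - chord_dom W s u) \<le> emeasure lborel W" by (intro emeasure_mono) auto
  also have "\<dots> = ennreal 1" by (simp add: W_vol)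
  also have "\<dots> \<le> ennreal (DIM('a) * norm u / \<rho>)"
  proof (rule ennreal_leI)
    have "1 * \<rho> \<le> DIM('a) * norm u" using True \<rho>_pos by (intro mult_mono) (auto simp: Suc_leI)
    then show "1 \<le> DIM('a) * norm u / \<rho>" using \<rho>_pos by (simp add: le_divide_eq)
  qed
  finally show ?thesis .
next
  case False
  show ?thesis
  proof (cases "u = 0")
    case True
    then have "W - chord_dom W s u = {}" by (auto simp: chord_dom_def)
    then show ?thesis by (simp only: emeasure_empty zero_le)
  next
    case u0: False
    define \<epsilon> where "\<epsilon> = norm u / \<rho>"
    have \<epsilon>: "0 < \<epsilon>" "\<epsilon> < 1" using u0 False \<rho>_pos unfolding \<epsilon>_def by (simp_all add: divide_less_eq)
    \<comment> \<open>As \<epsilon> is norm u / \<rho>, the point p0 + (c / \<epsilon>) u still lies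
      in the inscribed ball; mixing it with weight \<epsilon> into the homothetic copy shifts that
      copy by exactly c u. The shifts wanted are - s u and (1 - s) u.\<close>
    have cvx: "\<epsilon> *\<^sub>R p0 + (1 - \<epsilon>) *\<^sub>R x + c *\<^sub>R u \<in> W" if x: "x \<in> W" and c: "\<bar>c\<bar> \<le> 1" for x c
    proof -
      have "norm ((c / \<epsilon>) *\<^sub>R u) = \<bar>c\<bar> * \<rho>" using u0 \<rho>_pos by (simp add: \<epsilon>_def abs_mult)
      also have "\<dots> \<le> \<rho>" using c \<rho>_pos by (simp add: mult_le_cancel_right1)
      finally have "p0 + (c / \<epsilon>) *\<^sub>R u \<in> W" using ball_W by (auto simp: dist_norm)
      from convexD[OF W_convex x this, of "1 - \<epsilon>" \<epsilon>] \<epsilon>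
      have "(1 - \<epsilon>) *\<^sub>R x + \<epsilon> *\<^sub>R (p0 + (c / \<epsilon>) *\<^sub>R u) \<in> W" by auto
      also have "(1 - \<epsilon>) *\<^sub>R x + \<epsilon> *\<^sub>R (p0 + (c / \<epsilon>) *\<^sub>R u) = \<epsilon> *\<^sub>R p0 + (1 - \<epsilon>) *\<^sub>R x + c *\<^sub>R u"
        using \<epsilon> by (simp add: algebra_simps)
      finally show ?thesis .
    qed
    have sub: "\<epsilon> *\<^sub>R p0 + (1 - \<epsilon>) *\<^sub>R x \<in> chord_dom W s u" if "x \<in> W" for x
      using cvx[OF that, of "- s"] cvx[OF that, of "1 - s"] s by (simp add: chord_dom_def)
    let ?C = "chord_dom W s u"
    have "ennreal ((1 - \<epsilon>) ^ DIM('a)) = ennreal ((1 - \<epsilon>) ^ DIM('a)) * (\<integral>\<^sup>+x. indicator W x \<partial>lborel)"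
      by (simp add: W_vol)
    also have "\<dots> \<le> ennreal ((1 - \<epsilon>) ^ DIM('a)) * (\<integral>\<^sup>+x. indicator ?C (\<epsilon> *\<^sub>R p0 + (1 - \<epsilon>) *\<^sub>R x) \<partial>lborel)"
      using sub by (intro mult_left_mono nn_integral_mono) (auto simp: indicator_def)
    also have "\<dots> = (\<integral>\<^sup>+x. indicator ?C (\<epsilon> *\<^sub>R p0 + x) \<partial>lborel)"
      using \<epsilon> by (subst nn_integral_lborel_scaleR[of "\<lambda>x. indicator ?C (\<epsilon> *\<^sub>R p0 + x)" "1 - \<epsilon>"]) auto
    also have "\<dots> = (\<integral>\<^sup>+x. indicator ?C x \<partial>lborel)"
      by (rule nn_integral_lborel_translate) measurable
    also have "\<dots> = emeasure lborel ?C" by simp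
    finally have C: "ennreal ((1 - \<epsilon>) ^ DIM('a)) \<le> emeasure lborel ?C" .
    have "emeasure lborel ?C \<le> emeasure lborel W" using chord_dom_subset[OF s] by (intro emeasure_mono) auto
    then have fin: "emeasure lborel ?C \<noteq> \<infinity>" by (auto simp: W_vol top_unique)
    \<comment> \<open>By Bernoulli the copy keeps the volume 1 - d \<epsilon>, so at most d
      \<epsilon> is lost.\<close>
    have "1 + real DIM('a) * (- \<epsilon>) \<le> (1 + - \<epsilon>) ^ DIM('a)"
      using \<epsilon> by (intro Bernoulli_inequality) auto
    then have "1 \<le> ennreal ((1 - \<epsilon>) ^ DIM('a)) + ennreal (real DIM('a) * \<epsilon>)"
    proof -
      have "ennreal 1 \<le> ennreal ((1 - \<epsilon>) ^ DIM('a) + real DIM('a) * \<epsilon>)"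
        using \<open>1 + real DIM('a) * (- \<epsilon>) \<le> _\<close> by (intro ennreal_leI) simp
      then show ?thesis using \<epsilon> by simp
    qed
    also have "\<dots> \<le> emeasure lborel ?C + ennreal (real DIM('a) * \<epsilon>)" by (intro add_right_mono C)
    finally have "emeasure lborel W \<le> emeasure lborel ?C + ennreal (real DIM('a) * \<epsilon>)" by (simp add: W_vol)
    moreover have "emeasure lborel (W - ?C) = emeasure lborel W - emeasure lborel ?C"
      using chord_dom_subset[OF s] fin by (intro emeasure_Diff) auto
    ultimately have "emeasure lborel (W - ?C) \<le> ennreal (real DIM('a) * \<epsilon>)"
      by (simp add: W_vol ennreal_minus_le_iff add.commute)
    then show ?thesis by (simp add: \<epsilon>_def)
  qed
qed

text \<open>Bounds every fibre volume of \<open>W\<close>: seen from one of its points, a fibre lies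
  in a ball of radius \<open>D\<close> and dimension d - 2.\<close>

definition h_max :: real where "h_max = unit_ball_vol (DIM('a) - 2) * D ^ (DIM('a) - 2)"

lemma h_max_nonneg: "h_max \<ge> 0" using D_pos by (simp add: h_max_def)

lemma emeasure_LP_ball: "emeasure \<nu> (cball 0 D) = ennreal h_max"
  using emeasure_subspace_lborel_cball[OF subspace_orthogonal_comp D_pos, of L]
  by (simp add: dim_orthogonal_comp[OF subspace_L] dim_L h_max_def)

lemma fibre_mono: "A \<subseteq> B \<Longrightarrow> fibre A x \<le> fibre B x"
  unfolding fibre_def by (intro nn_integral_mono) (auto simp: indicator_def)

lemma pairing_mono: "A \<subseteq> A' \<Longrightarrow> B \<subseteq> B' \<Longrightarrow> pairing A B \<le> pairing A' B'"
  unfolding pairing_def by (intro nn_integral_mono mult_mono fibre_mono) (auto simp: indicator_def)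

lemma fibre_W_le:
  assumes "x \<in> W" shows "fibre W x \<le> ennreal h_max"
proof -
  have "fibre W x \<le> (\<integral>\<^sup>+y. indicator (cball 0 D) y \<partial>\<nu>)"
    unfolding fibre_def using diam_W[OF _ assms] by (intro nn_integral_mono) (force simp: indicator_def)
  then show ?thesis by (simp add: emeasure_LP_ball)
qed

lemma pairing_left_le:
  assumes [measurable]: "A \<in> sets borel" and A: "A \<subseteq> W"
  shows "pairing A W \<le> ennreal h_max * emeasure lborel A"
proof -
  have "pairing A W \<le> (\<integral>\<^sup>+v. ennreal h_max * indicator A v \<partial>lborel)"
    unfolding pairing_def using A fibre_W_le
    by (intro nn_integral_mono) (auto simp: indicator_def)
  then show ?thesis by (simp add: nn_integral_cmult)
qed

text \<open>Here the small set sits inside the fibre, and bounding the fibre at each point would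
  lose the factor \<open>emeasure lborel A\<close>. Exchanging the integrals and moving the base
  point into \<open>A\<close> restores it; the remaining shift is a difference of two points of
  \<open>W\<close>, hence at most \<open>D\<close> long.\<close>

lemma pairing_right_le:
  assumes A[measurable]: "A \<in> sets borel" and AW: "A \<subseteq> W"
  shows "pairing W A \<le> ennreal h_max * emeasure lborel A"
proof -
  interpret P: sigma_finite_measure \<nu> by (rule sigma_finite_LP)
  interpret PL: pair_sigma_finite "lborel :: 'a measure" \<nu> ..
  have "pairing W A = (\<integral>\<^sup>+v. (\<integral>\<^sup>+y. indicator W v * indicator A (v + y) \<partial>\<nu>) \<partial>lborel)"
    unfolding pairing_def fibre_def by (subst nn_integral_cmult) auto
  also have "\<dots> = (\<integral>\<^sup>+y. (\<integral>\<^sup>+v. indicator W v * indicator A (v + y) \<partial>lborel) \<partial>\<nu>)"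
    by (rule PL.Fubini'[symmetric]) measurable
  also have "\<dots> = (\<integral>\<^sup>+y. (\<integral>\<^sup>+v. indicator W (- y + v) * indicator A (- y + v + y) \<partial>lborel) \<partial>\<nu>)"
    by (intro nn_integral_cong nn_integral_lborel_translate[symmetric]) measurable
  also have "\<dots> \<le> (\<integral>\<^sup>+y. (\<integral>\<^sup>+v. indicator (cball 0 D) y * indicator A v \<partial>lborel) \<partial>\<nu>)"
  proof (intro nn_integral_mono)
    fix y v
    have "y \<in> cball 0 D" if "- y + v \<in> W" "v \<in> A"
      using diam_W[of v "- y + v"] that AW by auto
    then show "indicator W (- y + v) * indicator A (- y + v + y) \<le> (indicator (cball 0 D) y * indicator A v :: ennreal)"
      by (auto simp: indicator_def)
  qed
  also have "\<dots> = ennreal h_max * emeasure lborel A"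
    by (simp add: nn_integral_cmult nn_integral_multc emeasure_LP_ball)
  finally show ?thesis .
qed

text \<open>The pairing is additive in each argument, so the two sets are cut down one at a time;
  each loss is an instance of the preceding two bounds.\<close>

lemma pairing_diff_le:
  assumes [measurable]: "A \<in> sets borel" "B \<in> sets borel" and "A \<subseteq> W" "B \<subseteq> W"
  shows "pairing W W \<le> pairing A B + ennreal h_max * (emeasure lborel (W - A) + emeasure lborel (W - B))"
proof -
  have fib: "fibre W v \<le> fibre B v + fibre (W - B) v" for v
    unfolding fibre_def by (subst nn_integral_add[symmetric], measurable, intro nn_integral_mono)
      (auto simp: indicator_def)
  have "pairing W W \<le> (\<integral>\<^sup>+v. indicator A v * fibre B v + (indicator (W - A) v * fibre W v + indicator W v * fibre (W - B) v) \<partial>lborel)"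
    unfolding pairing_def
  proof (rule nn_integral_mono)
    fix v
    show "indicator W v * fibre W v \<le> indicator A v * fibre B v + (indicator (W - A) v * fibre W v + indicator W v * fibre (W - B) v)"
      using fib[of v] assms by (auto simp: indicator_def)
  qed
  also have "\<dots> = pairing A B + (pairing (W - A) W + pairing W (W - B))"
  proof -
    have "(\<integral>\<^sup>+v. indicator (W - A) v * fibre W v + indicator W v * fibre (W - B) v \<partial>lborel)
      = pairing (W - A) W + pairing W (W - B)"
      unfolding pairing_def by (rule nn_integral_add) measurable
    moreover have "(\<integral>\<^sup>+v. indicator A v * fibre B v + (indicator (W - A) v * fibre W v + indicator W v * fibre (W - B) v) \<partial>lborel)
      = pairing A B + (\<integral>\<^sup>+v. indicator (W - A) v * fibre W v + indicator W v * fibre (W - B) v \<partial>lborel)"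
      unfolding pairing_def by (rule nn_integral_add) measurable
    ultimately show ?thesis by simp
  qed
  also have "\<dots> \<le> pairing A B + (ennreal h_max * emeasure lborel (W - A) + ennreal h_max * emeasure lborel (W - B))"
    by (intro add_mono order_refl pairing_left_le pairing_right_le) auto
  finally show ?thesis by (simp add: distrib_left)
qed

lemma pairing_W_le: "pairing W W \<le> ennreal h_max"
  using pairing_left_le[of W] by (simp add: W_vol)

text \<open>\<open>fibre W\<close> is constant along the complement, so integrating the indicator
  there yields the fibre volume a second time.\<close>

lemma pairing_W_eq: "pairing W W = (\<integral>\<^sup>+x. (fibre W x)\<^sup>2 \<partial>subspace_lborel L)"
proof -
  interpret P: sigma_finite_measure \<nu> by (rule sigma_finite_LP)
  have "pairing W W = (\<integral>\<^sup>+x. (\<integral>\<^sup>+y. indicator W (x + y) * fibre W (x + y) \<partial>\<nu>) \<partial>subspace_lborel L)"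
    unfolding pairing_def by (rule nn_integral_split) measurable
  also have "\<dots> = (\<integral>\<^sup>+x. (\<integral>\<^sup>+y. indicator W (x + y) * fibre W x \<partial>\<nu>) \<partial>subspace_lborel L)"
  proof (rule nn_integral_cong, rule nn_integral_cong_AE)
    fix x
    show "AE y in \<nu>. indicator W (x + y) * fibre W (x + y) = indicator W (x + y) * fibre W x"
      using AE_subspace_lborel[OF subspace_orthogonal_comp]
      by eventually_elim (simp add: fibre_shift)
  qed
  also have "\<dots> = (\<integral>\<^sup>+x. (fibre W x)\<^sup>2 \<partial>subspace_lborel L)"
    by (subst nn_integral_multc) (auto simp: fibre_def power2_eq_square)
  finally show ?thesis .
qed

lemma fibre_fibre_volume:
  "AE x in subspace_lborel L. fibre W x = ennreal (fibre_volume W L x)"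
  using AE_subspace_lborel[OF subspace_L]
proof eventually_elim
  case (elim x)
  have Lp: "L\<^sup>\<bottom> \<in> sets borel" by (simp add: borel_closed closed_subspace subspace_orthogonal_comp)
  have "{y \<in> L\<^sup>\<bottom>. x + y \<in> W} = L\<^sup>\<bottom> \<inter> {y. x + y \<in> W}" by auto
  then have [measurable]: "{y \<in> L\<^sup>\<bottom>. x + y \<in> W} \<in> sets borel" using Lp by auto
  have eq: "fibre W x = emeasure \<nu> {y \<in> L\<^sup>\<bottom>. x + y \<in> W}"
  proof -
    have "fibre W x = (\<integral>\<^sup>+y. indicator {y \<in> L\<^sup>\<bottom>. x + y \<in> W} y \<partial>\<nu>)"
      unfolding fibre_def
      by (rule nn_integral_cong_AE) (use AE_subspace_lborel[OF subspace_orthogonal_comp] in eventually_elim, auto simp: indicator_def)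
    then show ?thesis by simp
  qed
  \<comment> \<open>\<open>measure\<close> assigns 0 to sets of infinite measure, so finiteness
    comes before the comparison. A nonempty fibre is anchored at one of its own points in
    \<open>W\<close>.\<close>
  have "fibre W x \<noteq> \<top>"
  proof (cases "\<exists>y\<in>L\<^sup>\<bottom>. x + y \<in> W")
    case True
    then obtain y where y: "y \<in> L\<^sup>\<bottom>" "x + y \<in> W" by auto
    have "fibre W x \<le> ennreal h_max" using fibre_W_le[OF y(2)] by (simp add: fibre_shift[OF W_borel y(1)])
    then show ?thesis by (metis ennreal_neq_top neq_top_trans)
  next
    case False
    then have "{y \<in> L\<^sup>\<bottom>. x + y \<in> W} = {}" by auto
    with eq show ?thesis by (simp only: emeasure_empty) simp
  qed
  then show ?case
    unfolding fibre_volume_def using eq by (simp add: emeasure_eq_ennreal_measure)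
qed

lemma pairing_W_I_W: "pairing W W = ennreal (I_W W L)"
proof -
  let ?f = "\<lambda>x. enn2real ((fibre W x)\<^sup>2)"
  have m: "(\<lambda>x. fibre W x) \<in> borel_measurable (subspace_lborel L)" by measurable
  have fv: "(\<integral>x. (fibre_volume W L x)\<^sup>2 \<partial>subspace_lborel L) = (\<integral>x. ?f x \<partial>subspace_lborel L)"
  proof (rule integral_cong_AE)
    have Lp: "L\<^sup>\<bottom> \<in> sets borel" by (simp add: borel_closed closed_subspace subspace_orthogonal_comp)
    interpret P: sigma_finite_measure \<nu> by (rule sigma_finite_LP)
    have "(\<lambda>x. emeasure \<nu> {y \<in> space \<nu>. y \<in> L\<^sup>\<bottom> \<and> x + y \<in> W}) \<in> borel_measurable (subspace_lborel L)"
      using Lp by measurable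
    then show "(\<lambda>x. (fibre_volume W L x)\<^sup>2) \<in> borel_measurable (subspace_lborel L)"
      unfolding fibre_volume_def measure_def by simp
    show "AE x in subspace_lborel L. (fibre_volume W L x)\<^sup>2 = ?f x"
      using fibre_fibre_volume by eventually_elim (simp add: ennreal_power fibre_volume_def)
  qed (use m in measurable)
  have "(\<integral>\<^sup>+x. (fibre W x)\<^sup>2 \<partial>subspace_lborel L) = (\<integral>\<^sup>+x. ennreal (?f x) \<partial>subspace_lborel L)"
    using fibre_fibre_volume by (intro nn_integral_cong_AE) (auto simp: ennreal_power fibre_volume_def elim!: eventually_mono)
  also have "\<dots> = ennreal (\<integral>x. ?f x \<partial>subspace_lborel L)"
  \<comment> \<open>Without integrability the Bochner integral in \<open>I_W\<close> would default
    to 0; \<open>pairing_W_le\<close> excludes this.\<close>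
  proof (rule nn_integral_eq_integral)
    have "(\<integral>\<^sup>+x. ennreal (?f x) \<partial>subspace_lborel L) < \<top>"
      using pairing_W_le calculation unfolding pairing_W_eq[symmetric]
      by (metis ennreal_less_top order_le_less_trans)
    then show "integrable (subspace_lborel L) ?f"
      using m by (intro integrableI_nonneg) auto
  qed auto
  finally show ?thesis unfolding I_W_def fv pairing_W_eq .
qed

text \<open>A tangent-line form of the Cauchy--Schwarz inequality: integrate \<open>2 a h \<le> h\<^sup>2 + a\<^sup>2\<close> over the projection of
  \<open>W\<close>, which lies in a disc of radius \<open>D\<close>.\<close>

lemma I_W_ge: "I_W W L \<ge> 1 / (pi * D\<^sup>2)"
proof -
  define x0 where "x0 = (p0 \<bullet> p) *\<^sub>R p + (p0 \<bullet> q) *\<^sub>R q"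
  have p0: "p0 \<in> W" using ball_W \<rho>_pos by auto
  \<comment> \<open>The value that maximises 2 a - a^2 pi D^2, which is the lower bound obtained
    from fibre volumes of total integral 1 over a disc of area pi D^2.\<close>
  define a where "a = 1 / (pi * D\<^sup>2)"
  have a: "a > 0" using D_pos by (simp add: a_def)
  have pqL: "p \<in> L" "q \<in> L" using onb_pq by (auto simp: orthonormal_basis_def)
  have x0L: "x0 \<in> L" unfolding x0_def using pqL subspace_L by (intro subspace_add subspace_scale)
  \<comment> \<open>Projection does not increase distances, so a fibre over a point outside the disc
    of radius \<open>D\<close> about the projection of \<open>p0\<close> misses
    \<open>W\<close>.\<close>
  have supp: "fibre W x = 0" if x: "x \<in> L" "x \<notin> cball x0 D" for x
  proof -
    have "AE y in \<nu>. indicator W (x + y) = (0 :: ennreal)"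
      using AE_subspace_lborel[OF subspace_orthogonal_comp]
    proof eventually_elim
      case (elim y)
      have "x + y \<notin> W"
      proof
        assume "x + y \<in> W"
        then have le: "norm (x + y - p0) \<le> D" using p0 by (rule diam_W)
        define e where "e = x + y - p0 - (x - x0)"
        have "x - x0 \<in> L" using x x0L subspace_L by (simp add: subspace_diff)
        moreover have "e \<in> L\<^sup>\<bottom>"
          unfolding LP_iff e_def x0_def using inner_LP[OF elim] by (simp add: inner_diff_left inner_add_left)
        ultimately have "(x - x0) \<bullet> e = 0" by (auto simp: orthogonal_comp_def orthogonal_def)
        then have "(norm (x - x0 + e))\<^sup>2 = (norm (x - x0))\<^sup>2 + (norm e)\<^sup>2"
          unfolding power2_norm_eq_inner by (simp add: inner_add_left inner_add_right inner_commute)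
        moreover have "x - x0 + e = x + y - p0" by (simp add: e_def)
        ultimately have "(norm (x - x0))\<^sup>2 \<le> (norm (x + y - p0))\<^sup>2" by simp
        then have "norm (x - x0) \<le> norm (x + y - p0)" by (rule power2_le_imp_le) simp
        then show False using le x by (simp add: dist_norm norm_minus_commute)
      qed
      then show ?case by simp
    qed
    then show ?thesis unfolding fibre_def by (subst nn_integral_0_iff_AE) auto
  qed
  have area: "emeasure (subspace_lborel L) (cball x0 D) = ennreal (pi * D\<^sup>2)"
  proof -
    have "emeasure (subspace_lborel L) (cball x0 D) = emeasure (distr (subspace_lborel L) borel ((+) x0)) (cball x0 D)"
      unfolding subspace_lborel_onb using distr_onb_lborel_translate[OF orthonormal_basis_subspace_basis[OF subspace_L] x0L] by simp
    also have "\<dots> = emeasure (subspace_lborel L) ((+) x0 -` cball x0 D)"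
      by (subst emeasure_distr) auto
    also have "(+) x0 -` cball x0 D = cball 0 D" by (auto simp: dist_norm)
    finally show ?thesis using emeasure_subspace_lborel_cball[OF subspace_L D_pos] by (simp add: dim_L unit_ball_vol_2)
  qed
  have "ennreal (2 * a) = ennreal (2 * a) * (\<integral>\<^sup>+x. indicator W x \<partial>lborel)" by (simp add: W_vol)
  also have "(\<integral>\<^sup>+x. indicator W x \<partial>lborel) = (\<integral>\<^sup>+x. fibre W x \<partial>subspace_lborel L)"
    unfolding fibre_def by (rule nn_integral_split) measurable
  also have "ennreal (2 * a) * \<dots> = (\<integral>\<^sup>+x. ennreal (2 * a) * fibre W x \<partial>subspace_lborel L)"
    by (rule nn_integral_cmult[symmetric]) measurable
  also have "\<dots> \<le> (\<integral>\<^sup>+x. (fibre W x)\<^sup>2 + ennreal (a\<^sup>2) * indicator (cball x0 D) x \<partial>subspace_lborel L)"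
  proof (rule nn_integral_mono_AE)
    show "AE x in subspace_lborel L. ennreal (2 * a) * fibre W x \<le> (fibre W x)\<^sup>2 + ennreal (a\<^sup>2) * indicator (cball x0 D) x"
      using AE_subspace_lborel[OF subspace_L] fibre_fibre_volume
    proof eventually_elim
      case (elim x)
      show ?case
      proof (cases "x \<in> cball x0 D")
        case True
        have "0 \<le> fibre_volume W L x" by (simp add: fibre_volume_def)
        moreover have "2 * a * fibre_volume W L x \<le> (fibre_volume W L x)\<^sup>2 + a\<^sup>2"
          using zero_le_power2[of "fibre_volume W L x - a"] by (simp add: power2_diff mult_ac)
        ultimately show ?thesis using True a unfolding elim(2)
          by (simp add: ennreal_power ennreal_mult[symmetric] ennreal_plus[symmetric] del: ennreal_plus)
      next
        case False
        then show ?thesis using supp[OF elim(1) False] by simp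
      qed
    qed
  qed
  also have "\<dots> = pairing W W + ennreal (a\<^sup>2) * ennreal (pi * D\<^sup>2)"
    by (subst nn_integral_add) (auto simp: pairing_W_eq nn_integral_cmult area)
  also have "ennreal (a\<^sup>2) * ennreal (pi * D\<^sup>2) = ennreal a"
    using D_pos by (subst ennreal_mult[symmetric]) (auto simp: a_def power2_eq_square)
  also have "pairing W W + ennreal a = ennreal (I_W W L + a)"
    using a by (subst ennreal_plus) (auto simp: pairing_W_I_W I_W_def)
  finally have "2 * a \<le> I_W W L + a"
    using a by (subst (asm) ennreal_le_iff) (auto simp: I_W_def)
  then show ?thesis by (simp add: a_def)
qed

lemma I_W_pos: "I_W W L > 0"
  using I_W_ge D_pos by (smt (verit) divide_pos_pos mult_pos_pos pi_gt_zero zero_less_power)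

lemma I_W_le: "I_W W L \<le> h_max"
  using pairing_W_le h_max_nonneg unfolding pairing_W_I_W by (simp add: ennreal_le_iff)

section \<open>Volume of the crossing positions of two given edge vectors\<close>

definition crossing_vol :: "'a \<Rightarrow> 'a \<Rightarrow> ennreal" where
  "crossing_vol u z = (\<integral>\<^sup>+v. (\<integral>\<^sup>+w. indicator W v * indicator W (v + u) * (indicator W w * indicator W (w + z)) * meet u z (w - v) \<partial>lborel) \<partial>lborel)"

lemma nn_integral_unit_square:
  "(\<integral>\<^sup>+s. (\<integral>\<^sup>+r. indicator {0..1::real} s * indicator {0..1::real} r * c \<partial>lborel) \<partial>lborel) = (c :: ennreal)"
proof -
  have "(\<integral>\<^sup>+s. (\<integral>\<^sup>+r. indicator {0..1::real} s * indicator {0..1::real} r * c \<partial>lborel) \<partial>lborel)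
    = (\<integral>\<^sup>+s. (\<integral>\<^sup>+r. (indicator {0..1::real} s * c) * indicator {0..1::real} r \<partial>lborel) \<partial>lborel)"
    by (intro nn_integral_cong) (simp only: mult_ac)
  also have "\<dots> = (\<integral>\<^sup>+s. c * indicator {0..1::real} s \<partial>lborel)"
    by (subst nn_integral_cmult) (auto simp: mult.commute)
  also have "\<dots> = c" by (subst nn_integral_cmult) auto
  finally show ?thesis .
qed

lemma crossing_vol_le:
  assumes "det2 u z \<noteq> 0"
  shows "crossing_vol u z \<le> ennreal \<bar>det2 u z\<bar> * ennreal (I_W W L)"
proof -
  have "crossing_vol u z = ennreal \<bar>det2 u z\<bar> *
     (\<integral>\<^sup>+s. (\<integral>\<^sup>+r. indicator {0..1} s * indicator {0..1} r * pairing (chord_dom W s u) (chord_dom W r z) \<partial>lborel) \<partial>lborel)"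
    unfolding crossing_vol_def by (rule nn_integral_crossing[OF W_borel assms])
  also have "\<dots> \<le> ennreal \<bar>det2 u z\<bar> *
     (\<integral>\<^sup>+s. (\<integral>\<^sup>+r. indicator {0..1::real} s * indicator {0..1::real} r * pairing W W \<partial>lborel) \<partial>lborel)"
  proof (rule mult_left_mono, rule nn_integral_mono, rule nn_integral_mono)
    fix s r :: real
    show "indicator {0..1} s * indicator {0..1} r * pairing (chord_dom W s u) (chord_dom W r z)
      \<le> indicator {0..1} s * indicator {0..1} r * pairing W W"
      using pairing_mono[OF chord_dom_subset chord_dom_subset, of s r u z] by (auto simp: indicator_def)
  qed simp
  finally show ?thesis by (simp add: nn_integral_unit_square pairing_W_I_W)
qed

text \<open>\<open>h_max\<close> comes from \<open>pairing_diff_le\<close> and d / \<rho> from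
  \<open>emeasure_diff_chord_dom\<close>; the product is the loss of crossing volume per unit of
  edge length, measured in multiples of the determinant.\<close>

definition slope :: real where "slope = h_max * (DIM('a) / \<rho>)"

lemma slope_nonneg: "slope \<ge> 0" using h_max_nonneg \<rho>_pos by (simp add: slope_def)

text \<open>Each pairing of chord domains in the average falls short of \<open>pairing W W\<close>
  by at most the slope times the sum of the lengths. The error stands on the right because
  subtraction of \<open>ennreal\<close> is truncated.\<close>

lemma crossing_vol_ge:
  assumes "det2 u z \<noteq> 0"
  shows "ennreal \<bar>det2 u z\<bar> * ennreal (I_W W L)
    \<le> crossing_vol u z + ennreal \<bar>det2 u z\<bar> * ennreal (slope * (norm u + norm z))"
proof -
  let ?Q = "\<lambda>s r. indicator {0..1} s * indicator {0..1} r * pairing (chord_dom W s u) (chord_dom W r z)"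
  let ?I = "\<lambda>s r. indicator {0..1::real} s * indicator {0..1::real} r * ennreal (slope * (norm u + norm z))"
  interpret P: sigma_finite_measure \<nu> by (rule sigma_finite_LP)
  have [measurable]: "(\<lambda>(s, r). pairing (chord_dom W s u) (chord_dom W r z)) \<in> borel_measurable (borel \<Otimes>\<^sub>M borel)"
    unfolding pairing_def fibre_def chord_dom_def indicator_def mem_Collect_eq by measurable
  have "ennreal (I_W W L) = (\<integral>\<^sup>+s. (\<integral>\<^sup>+r. indicator {0..1::real} s * indicator {0..1::real} r * pairing W W \<partial>lborel) \<partial>lborel)"
    by (simp add: nn_integral_unit_square pairing_W_I_W)
  also have "\<dots> \<le> (\<integral>\<^sup>+s. (\<integral>\<^sup>+r. ?Q s r + ?I s r \<partial>lborel) \<partial>lborel)"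
  proof (intro nn_integral_mono)
    fix s r :: real
    show "indicator {0..1} s * indicator {0..1} r * pairing W W \<le> ?Q s r + ?I s r"
    proof (cases "s \<in> {0..1} \<and> r \<in> {0..1}")
      case True
      have "pairing W W \<le> pairing (chord_dom W s u) (chord_dom W r z)
        + ennreal h_max * (emeasure lborel (W - chord_dom W s u) + emeasure lborel (W - chord_dom W r z))"
        using True by (intro pairing_diff_le chord_dom_subset) auto
      also have "\<dots> \<le> pairing (chord_dom W s u) (chord_dom W r z)
        + ennreal h_max * (ennreal (DIM('a) * norm u / \<rho>) + ennreal (DIM('a) * norm z / \<rho>))"
        using True by (intro add_mono order_refl mult_left_mono emeasure_diff_chord_dom) auto
      also have "ennreal h_max * (ennreal (DIM('a) * norm u / \<rho>) + ennreal (DIM('a) * norm z / \<rho>))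
        = ennreal (h_max * (DIM('a) * norm u / \<rho> + DIM('a) * norm z / \<rho>))"
        using h_max_nonneg \<rho>_pos by (simp add: ennreal_mult)
      also have "h_max * (DIM('a) * norm u / \<rho> + DIM('a) * norm z / \<rho>) = slope * (norm u + norm z)"
        by (simp add: slope_def distrib_left add_divide_distrib mult.assoc)
      finally show ?thesis using True by simp
    qed (auto simp: indicator_def)
  qed
  also have "\<dots> = (\<integral>\<^sup>+s. (\<integral>\<^sup>+r. ?Q s r \<partial>lborel) \<partial>lborel) + (\<integral>\<^sup>+s. (\<integral>\<^sup>+r. ?I s r \<partial>lborel) \<partial>lborel)"
    by (simp add: nn_integral_add)
  finally have "ennreal (I_W W L) \<le> (\<integral>\<^sup>+s. (\<integral>\<^sup>+r. ?Q s r \<partial>lborel) \<partial>lborel) + ennreal (slope * (norm u + norm z))"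
    by (simp add: nn_integral_unit_square)
  from mult_left_mono[OF this, of "ennreal \<bar>det2 u z\<bar>"] show ?thesis
    unfolding crossing_vol_def nn_integral_crossing[OF W_borel assms] by (simp add: distrib_left)
qed

text \<open>An edge longer than \<open>D\<close> does not fit into \<open>W\<close>. This is why the
  integrals of g may stop at c2 = \<open>D\<close>.\<close>

lemma crossing_vol_eq_0:
  assumes "norm u > D \<or> norm z > D"
  shows "crossing_vol u z = 0"
proof -
  have "indicator W v * indicator W (v + u) * (indicator W w * indicator W (w + z)) = (0 :: ennreal)" for v w
    using assms diam_W[of "v + u" v] diam_W[of "w + z" w] by (auto simp: indicator_def)
  then show ?thesis unfolding crossing_vol_def by (simp only:) simp
qed

end

section \<open>Factorial moments of a Poisson process\<close>

lemma nn_integral_poisson_count: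
  assumes "prob_space M" and X[measurable]: "X \<in> measurable M (count_space UNIV)" and \<mu>: "\<mu> \<ge> 0"
    and pois: "\<And>k::nat. measure M {\<omega> \<in> space M. X \<omega> = k} = \<mu> ^ k / fact k * exp (- \<mu>)"
  shows "(\<integral>\<^sup>+\<omega>. of_nat (X \<omega>) \<partial>M) = ennreal \<mu>"
proof -
  interpret prob_space M by fact
  have "(\<integral>\<^sup>+\<omega>. of_nat (X \<omega>) \<partial>M) = (\<integral>\<^sup>+\<omega>. (\<Sum>k. ennreal (real k) * indicator {\<omega> \<in> space M. X \<omega> = k} \<omega>) \<partial>M)"
  proof (rule nn_integral_cong)
    fix \<omega> assume "\<omega> \<in> space M"
    then have "(\<Sum>k. ennreal (real k) * indicator {\<omega> \<in> space M. X \<omega> = k} \<omega>) = (\<Sum>k\<in>{X \<omega>}. ennreal (real k) * indicator {\<omega> \<in> space M. X \<omega> = k} \<omega>)"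
      by (intro suminf_finite) auto
    then show "of_nat (X \<omega>) = (\<Sum>k. ennreal (real k) * indicator {\<omega> \<in> space M. X \<omega> = k} \<omega>)"
      using \<open>\<omega> \<in> space M\<close> by (simp add: ennreal_of_nat_eq_real_of_nat)
  qed
  also have "\<dots> = (\<Sum>k. \<integral>\<^sup>+\<omega>. ennreal (real k) * indicator {\<omega> \<in> space M. X \<omega> = k} \<omega> \<partial>M)"
    by (rule nn_integral_suminf) measurable
  also have "\<dots> = (\<Sum>k. ennreal (real k * (\<mu> ^ k / fact k * exp (- \<mu>))))"
  proof (rule suminf_cong)
    fix k
    have "(\<integral>\<^sup>+\<omega>. ennreal (real k) * indicator {\<omega> \<in> space M. X \<omega> = k} \<omega> \<partial>M) = ennreal (real k) * ennreal (\<mu> ^ k / fact k * exp (- \<mu>))"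
      by (subst nn_integral_cmult) (auto simp: emeasure_eq_measure pois)
    then show "(\<integral>\<^sup>+\<omega>. ennreal (real k) * indicator {\<omega> \<in> space M. X \<omega> = k} \<omega> \<partial>M) = ennreal (real k * (\<mu> ^ k / fact k * exp (- \<mu>)))"
      using \<mu> by (subst (asm) ennreal_mult[symmetric]) auto
  qed
  also have "\<dots> = ennreal \<mu>"
  proof (rule suminf_ennreal_eq)
    have "(\<lambda>k. \<mu> ^ k /\<^sub>R fact k) sums exp \<mu>" by (rule exp_converges)
    from sums_mult[OF this, of "\<mu> * exp (- \<mu>)"]
    have "(\<lambda>k. \<mu> * exp (- \<mu>) * (\<mu> ^ k /\<^sub>R fact k)) sums (\<mu> * exp (- \<mu>) * exp \<mu>)" .
    moreover have "\<mu> * exp (- \<mu>) * exp \<mu> = \<mu>" by (simp add: exp_minus)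
    ultimately have "(\<lambda>k. \<mu> * exp (- \<mu>) * (\<mu> ^ k /\<^sub>R fact k)) sums \<mu>" by (simp only:)
    moreover have "(\<lambda>k. \<mu> * exp (- \<mu>) * (\<mu> ^ k /\<^sub>R fact k)) = (\<lambda>k. real (Suc k) * (\<mu> ^ Suc k / fact (Suc k) * exp (- \<mu>)))"
    proof (rule ext)
      fix k
      have "real (Suc k) / fact (Suc k) = 1 / fact k" by (simp add: fact_Suc del: of_nat_Suc)
      moreover have "real (Suc k) * (\<mu> ^ Suc k / fact (Suc k) * exp (- \<mu>)) = \<mu> * exp (- \<mu>) * \<mu> ^ k * (real (Suc k) / fact (Suc k))"
        by (simp only: power_Suc divide_inverse mult_ac)
      ultimately show "\<mu> * exp (- \<mu>) * (\<mu> ^ k /\<^sub>R fact k) = real (Suc k) * (\<mu> ^ Suc k / fact (Suc k) * exp (- \<mu>))"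
        by (simp add: divide_inverse)
    qed
    ultimately have "(\<lambda>k. real (Suc k) * (\<mu> ^ Suc k / fact (Suc k) * exp (- \<mu>))) sums \<mu>" by simp
    \<comment> \<open>The term with k = 0 vanishes, so the shifted series has the same sum.\<close>
    then show "(\<lambda>k. real k * (\<mu> ^ k / fact k * exp (- \<mu>))) sums \<mu>"
      by (subst (asm) sums_Suc_iff) simp
  qed (use \<mu> in auto)
  finally show ?thesis .
qed

lemma disjoint_basis_neighbourhoods:
  fixes x :: "nat \<Rightarrow> 'a::metric_space"
  assumes B: "topological_basis B" and inj: "inj_on x {..<m}"
  obtains U where "U \<in> {..<m} \<rightarrow>\<^sub>E B" "disjoint_family_on U {..<m}" "\<And>i. i < m \<Longrightarrow> x i \<in> U i"
proof -
  \<comment> \<open>The pairwise distances; half of their minimum is a radius for disjoint balls.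
    For \<open>m <= 1\<close> there are none, and radius 1 serves.\<close>
  define S where "S = (\<lambda>(i, j). dist (x i) (x j)) ` {(i, j). i < m \<and> j < m \<and> i \<noteq> j}"
  have "finite S" unfolding S_def
    by (intro finite_imageI finite_subset[of "{(i, j). i < m \<and> j < m \<and> i \<noteq> j}" "{..<m} \<times> {..<m}"]) auto
  moreover have "s > 0" if "s \<in> S" for s using that inj by (auto simp: S_def inj_on_def)
  ultimately obtain r where r: "r > 0" "\<And>s. s \<in> S \<Longrightarrow> r \<le> s"
  proof (cases "S = {}")
    case True then show ?thesis using that[of 1] by auto
  next
    case False then show ?thesis using that[of "Min S"] \<open>finite S\<close> \<open>\<And>s. s \<in> S \<Longrightarrow> s > 0\<close> by auto
  qed
  have "\<exists>V. V \<in> B \<and> x i \<in> V \<and> V \<subseteq> ball (x i) (r / 2)" for i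
    using topological_basisE[OF B, of "ball (x i) (r / 2)" "x i"] r(1)
    by (metis centre_in_ball half_gt_zero open_ball)
  then obtain V where V: "\<And>i. V i \<in> B" "\<And>i. x i \<in> V i" "\<And>i. V i \<subseteq> ball (x i) (r / 2)" by metis
  have disj: "V i \<inter> V j = {}" if "i < m" "j < m" "i \<noteq> j" for i j
  proof (rule ccontr)
    assume "V i \<inter> V j \<noteq> {}"
    then obtain y where "y \<in> V i" "y \<in> V j" by auto
    then have "y \<in> ball (x i) (r / 2)" "y \<in> ball (x j) (r / 2)" using V(3) by blast+
    then have "dist (x i) y < r / 2" "dist (x j) y < r / 2" by simp_all
    then have "dist (x i) (x j) < r" using dist_triangle2[of "x i" "x j" y] by linarith
    moreover have "r \<le> dist (x i) (x j)" using that by (intro r(2)) (auto simp: S_def)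
    ultimately show False by simp
  qed
  show ?thesis
  proof (rule that[of "restrict V {..<m}"])
    show "restrict V {..<m} \<in> {..<m} \<rightarrow>\<^sub>E B" using V(1) by auto
    show "disjoint_family_on (restrict V {..<m}) {..<m}"
      using disj by (auto simp: disjoint_family_on_def)
  qed (use V(2) in auto)
qed

lemma prod_indicator_PiE:
  assumes "finite I" "x \<in> extensional I"
  shows "(\<Prod>i\<in>I. indicator (A i) (x i)) = (indicator (Pi\<^sub>E I A) x :: ennreal)"
proof (cases "x \<in> Pi\<^sub>E I A")
  case True
  then show ?thesis by (auto simp: PiE_iff intro!: prod.neutral)
next
  case False
  then obtain i where "i \<in> I" "x i \<notin> A i" using assms(2) by (auto simp: PiE_iff)
  then have "(\<Prod>i\<in>I. indicator (A i) (x i)) = (0 :: ennreal)"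
    using assms(1) by (intro prod_zero bexI[of _ i]) auto
  then show ?thesis using False by simp
qed

text \<open>The tuples without repetition are covered by countably many products of disjoint basic open sets.\<close>

lemma PiM_borel_eqI_disjoint:
  fixes M N :: "(nat \<Rightarrow> 'a::euclidean_space) measure"
  assumes sM: "sets M = sets (\<Pi>\<^sub>M i\<in>{..<m}. borel)" and sN: "sets N = sets (\<Pi>\<^sub>M i\<in>{..<m}. borel)"
    and injM: "AE x in M. inj_on x {..<m}" and injN: "AE x in N. inj_on x {..<m}"
    and eq: "\<And>A. (\<And>i. i < m \<Longrightarrow> A i \<in> sets borel) \<Longrightarrow> disjoint_family_on A {..<m} \<Longrightarrow>
      emeasure M (Pi\<^sub>E {..<m} A) = emeasure N (Pi\<^sub>E {..<m} A)"
    and fin: "\<And>A. (\<And>i. i < m \<Longrightarrow> A i \<in> sets borel) \<Longrightarrow> disjoint_family_on A {..<m} \<Longrightarrow>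
      emeasure M (Pi\<^sub>E {..<m} A) \<noteq> \<infinity>"
  shows "M = N"
proof -
  let ?S = "\<Pi>\<^sub>M i\<in>{..<m}. borel :: 'a measure"
  obtain B :: "'a set set" where B: "countable B" "topological_basis B"
    using ex_countable_basis by auto
  have Bb: "b \<in> sets borel" if "b \<in> B" for b using topological_basis_open[OF B(2) that] by auto
  define \<U> where "\<U> = {U \<in> {..<m} \<rightarrow>\<^sub>E B. disjoint_family_on U {..<m}}"
  have cU: "countable \<U>"
    unfolding \<U>_def by (rule countable_subset[OF _ countable_PiE[of "{..<m}" "\<lambda>_. B"]]) (use B in auto)
  have PiE_sets: "Pi\<^sub>E {..<m} A \<in> sets ?S" if "\<And>i. i < m \<Longrightarrow> A i \<in> sets borel" for A
    using that by (intro sets_PiM_I_finite) auto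
  have local: "emeasure M (X \<inter> Pi\<^sub>E {..<m} U) = emeasure N (X \<inter> Pi\<^sub>E {..<m} U)" if U: "U \<in> \<U>" and X: "X \<in> sets ?S" for U X
  proof -
    have Ub: "U i \<in> sets borel" if "i < m" for i using U that Bb by (auto simp: \<U>_def)
    let ?U = "Pi\<^sub>E {..<m} U"
    have US: "?U \<in> sets ?S" by (rule PiE_sets[OF Ub])
    \<comment> \<open>Restriction to a box with disjoint sides. Intersecting any box with it gives
      disjoint sides again, so the hypothesis covers a generator of the product
      sigma-algebra.\<close>
    define M' where "M' = density M (indicator ?U)"
    define N' where "N' = density N (indicator ?U)"
    have M': "emeasure M' Y = emeasure M (Y \<inter> ?U)" if "Y \<in> sets ?S" for Y
      unfolding M'_def using that US sM by (subst emeasure_density) (auto simp: indicator_inter_arith[symmetric] Int_commute)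
    have N': "emeasure N' Y = emeasure N (Y \<inter> ?U)" if "Y \<in> sets ?S" for Y
      unfolding N'_def using that US sN by (subst emeasure_density) (auto simp: indicator_inter_arith[symmetric] Int_commute)
    have "M' = N'"
    proof (rule measure_eqI_PiM_finite[where I="{..<m}" and M="\<lambda>_. borel" and A="\<lambda>_. Pi\<^sub>E {..<m} (\<lambda>_. UNIV)"])
      fix A :: "nat \<Rightarrow> 'a set" assume A: "\<And>i. i \<in> {..<m} \<Longrightarrow> A i \<in> sets borel"
      have "disjoint_family_on (\<lambda>i. A i \<inter> U i) {..<m}"
        using U by (auto simp: \<U>_def disjoint_family_on_def)
      from eq[OF _ this] A Ub show "emeasure M' (Pi\<^sub>E {..<m} A) = emeasure N' (Pi\<^sub>E {..<m} A)"
        using M'[OF PiE_sets[of A]] N'[OF PiE_sets[of A]] by (simp add: PiE_Int)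
    next
      have "emeasure M' (Pi\<^sub>E {..<m} (\<lambda>_. UNIV)) = emeasure M (Pi\<^sub>E {..<m} (\<lambda>_. UNIV) \<inter> ?U)"
        by (rule M'[OF PiE_sets]) auto
      also have "Pi\<^sub>E {..<m} (\<lambda>_. UNIV) \<inter> ?U = ?U" by auto
      also have "emeasure M ?U \<noteq> \<infinity>" using U by (intro fin Ub) (auto simp: \<U>_def)
      finally show "emeasure M' (Pi\<^sub>E {..<m} (\<lambda>_. UNIV)) \<noteq> \<infinity>" .
    qed (auto simp: M'_def N'_def sM sN space_PiM intro!: prod_algebraI_finite)
    then show ?thesis using M'[OF X] N'[OF X] by simp
  qed
  \<comment> \<open>The empty set makes the countable family nonempty, as its enumeration by
    \<open>from_nat_into\<close> requires.\<close>
  define F where "F = insert {} (Pi\<^sub>E {..<m} ` \<U>)"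
  define C where "C = from_nat_into F"
  have cF: "countable F" "F \<noteq> {}" using cU by (auto simp: F_def)
  have rC: "range C = F" unfolding C_def using cF by (simp add: range_from_nat_into)
  have FS: "c \<in> sets ?S" if "c \<in> F" for c
  proof (cases "c = {}")
    case False
    then have "c \<in> Pi\<^sub>E {..<m} ` \<U>" using that by (simp add: F_def)
    then obtain U where U: "U \<in> \<U>" "c = Pi\<^sub>E {..<m} U" by (elim imageE)
    then show ?thesis using Bb by (auto simp: \<U>_def intro!: PiE_sets)
  qed auto
  have CS: "range C \<subseteq> sets ?S" using rC FS by auto
  have Cn: "emeasure M (X \<inter> C n) = emeasure N (X \<inter> C n)" if "X \<in> sets ?S" for X n
  proof -
    have "C n \<in> F" using rC by auto
    then show ?thesis using local that by (auto simp: F_def)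
  qed
  have cover: "x \<in> (\<Union>n. C n)" if xS: "x \<in> space ?S" and xi: "inj_on x {..<m}" for x
  proof -
    obtain U where U: "U \<in> {..<m} \<rightarrow>\<^sub>E B" "disjoint_family_on U {..<m}" "\<And>i. i < m \<Longrightarrow> x i \<in> U i"
      using disjoint_basis_neighbourhoods[OF B(2) xi] by blast
    then have "x \<in> Pi\<^sub>E {..<m} U" using xS by (auto simp: space_PiM PiE_iff)
    moreover have "Pi\<^sub>E {..<m} U \<in> F" using U by (auto simp: F_def \<U>_def)
    ultimately show ?thesis using rC by (metis UN_iff UNIV_I image_iff)
  qed
  \<comment> \<open>Local equality becomes global by cutting along the disjointed cover; the tuples
    with a repetition, left uncovered, are null for both measures.\<close>
  have dis: "emeasure K X = (\<Sum>n. emeasure K (X \<inter> disjointed C n))"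
    if X: "X \<in> sets ?S" and K: "sets K = sets ?S" "AE x in K. inj_on x {..<m}" for K X
  proof -
    have dS: "disjointed C n \<in> sets ?S" for n using sets.range_disjointed_sets[OF CS] by auto
    have "emeasure K X = emeasure K (\<Union>n. X \<inter> disjointed C n)"
    proof (rule emeasure_eq_AE)
      show "AE x in K. (x \<in> X) = (x \<in> (\<Union>n. X \<inter> disjointed C n))"
        using K(2) AE_space
      proof eventually_elim
        case (elim x)
        then have "x \<in> (\<Union>n. disjointed C n)"
          using cover sets_eq_imp_space_eq[OF K(1)] by (simp add: UN_disjointed_eq)
        then show ?case by auto
      qed
    qed (use X dS K in \<open>auto intro!: sets.countable_UN\<close>)
    also have "\<dots> = (\<Sum>n. emeasure K (X \<inter> disjointed C n))"
    proof (rule suminf_emeasure[symmetric])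
      show "disjoint_family (\<lambda>n. X \<inter> disjointed C n)"
        using disjoint_family_disjointed[of C] by (auto simp: disjoint_family_on_def)
    qed (use X dS K in auto)
    finally show ?thesis .
  qed
  show ?thesis
  proof (rule measure_eqI)
    fix X assume "X \<in> sets M"
    then have X: "X \<in> sets ?S" by (simp add: sM)
    have dS: "disjointed C n \<in> sets ?S" for n using sets.range_disjointed_sets[OF CS] by auto
    have "emeasure M (X \<inter> disjointed C n) = emeasure N (X \<inter> disjointed C n)" for n
      using Cn[of "X \<inter> disjointed C n" n] X dS disjointed_subset[of C n]
      by (simp add: Int_assoc Int_absorb2)
    then show "emeasure M X = emeasure N X"
      using dis[OF X sM injM] dis[OF X sN injN] by simp
  qed (simp add: sM sN)
qed

text \<open>Tuples of distinct labels. As labels almost surely enumerate the points without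
  repetition, summing over them is summing over ordered tuples of distinct points.\<close>

definition inj_tuples :: "nat \<Rightarrow> nat \<Rightarrow> (nat \<Rightarrow> nat) set" where
  "inj_tuples m n = {\<sigma> \<in> {..<m} \<rightarrow>\<^sub>E {..<n}. inj_on \<sigma> {..<m}}"

lemma finite_inj_tuples: "finite (inj_tuples m n)"
  unfolding inj_tuples_def by (rule finite_subset[of _ "{..<m} \<rightarrow>\<^sub>E {..<n}"]) (auto intro: finite_PiE)

text \<open>With all coordinates but the \<open>i\<close>-th fixed, a coincidence forces
  \<open>x i\<close> to hit the single point \<open>x j\<close>, a null set of a diffuse
  measure.\<close>

lemma AE_PiM_inj:
  assumes sf: "sigma_finite_measure (\<mu> :: 'a::euclidean_space measure)" and s\<mu>: "sets \<mu> = sets borel" and diffuse: "\<And>c. emeasure \<mu> {c} = 0"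
  shows "AE x in (\<Pi>\<^sub>M i\<in>{..<m::nat}. \<mu>). inj_on x {..<m}"
proof -
  note s\<mu>[measurable_cong]
  interpret product_sigma_finite "\<lambda>_::nat. \<mu>" using sf by (simp add: product_sigma_finite_def)
  have "AE x in (\<Pi>\<^sub>M i\<in>{..<m}. \<mu>). x i \<noteq> x j" if ij: "i < m" "j < m" "i \<noteq> j" for i j
  proof -
    let ?I = "{..<m} - {i}"
    have I: "{..<m} = insert i ?I" using ij by auto
    interpret F: finite_product_sigma_finite "\<lambda>_::nat. \<mu>" ?I by standard auto
    have [measurable]: "(\<lambda>x. x i) \<in> borel_measurable (\<Pi>\<^sub>M i\<in>{..<m}. \<mu>)" "(\<lambda>x. x j) \<in> borel_measurable (\<Pi>\<^sub>M i\<in>{..<m}. \<mu>)"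
      using ij measurable_component_singleton[of _ "{..<m}" "\<lambda>_. \<mu>"] measurable_cong_sets[OF refl s\<mu>] by auto
    have D[measurable]: "{x \<in> space (\<Pi>\<^sub>M i\<in>{..<m}. \<mu>). x i = x j} \<in> sets (\<Pi>\<^sub>M i\<in>{..<m}. \<mu>)" by measurable
    let ?f = "indicator {x \<in> space (\<Pi>\<^sub>M i\<in>{..<m}. \<mu>). x i = x j} :: _ \<Rightarrow> ennreal"
    have f: "?f \<in> borel_measurable (\<Pi>\<^sub>M i\<in>insert i ?I. \<mu>)" unfolding I[symmetric] by measurable
    have "emeasure (\<Pi>\<^sub>M i\<in>{..<m}. \<mu>) {x \<in> space (\<Pi>\<^sub>M i\<in>{..<m}. \<mu>). x i = x j} = integral\<^sup>N (\<Pi>\<^sub>M i\<in>insert i ?I. \<mu>) ?f"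
      unfolding I[symmetric] by simp
    also have "\<dots> = (\<integral>\<^sup>+x. (\<integral>\<^sup>+y. ?f (x(i := y)) \<partial>\<mu>) \<partial>(\<Pi>\<^sub>M i\<in>?I. \<mu>))"
      by (rule product_nn_integral_insert[OF _ _ f]) auto
    also have "\<dots> \<le> (\<integral>\<^sup>+x. (\<integral>\<^sup>+y. indicator {x j} y \<partial>\<mu>) \<partial>(\<Pi>\<^sub>M i\<in>?I. \<mu>))"
      using ij by (intro nn_integral_mono) (auto simp: indicator_def)
    also have "\<dots> = 0" using diffuse s\<mu> by simp
    finally show ?thesis using D by (intro AE_I[where N="{x \<in> space (\<Pi>\<^sub>M i\<in>{..<m}. \<mu>). x i = x j}"]) auto
  qed
  then have "AE x in (\<Pi>\<^sub>M i\<in>{..<m}. \<mu>). \<forall>i\<in>{..<m}. \<forall>j\<in>{..<m}. i \<noteq> j \<longrightarrow> x i \<noteq> x j"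
    by (simp add: AE_ball_countable countable_finite)
  then show ?thesis by eventually_elim (auto simp: inj_on_def)
qed

lemma poisson_nn_integral_count:
  fixes W :: "'a::euclidean_space set"
  assumes pp: "poisson_process W t P" and t: "t > 0" and A: "A \<in> sets borel"
    and W: "W \<in> sets borel" "emeasure lborel W < \<infinity>"
  shows "(\<integral>\<^sup>+\<omega>. of_nat (card (points \<omega> \<inter> A)) \<partial>P) = ennreal t * emeasure lborel (W \<inter> A)"
proof -
  interpret prob_space P using pp by (simp add: poisson_process_def)
  \<comment> \<open>Independence of a family of one set carries no probabilistic content, but it
    includes the measurability of the count.\<close>
  have "indep_vars (\<lambda>_. count_space UNIV) (\<lambda>i \<omega>. card (points \<omega> \<inter> (\<lambda>_. A) i)) {..<1::nat}"
    using pp A unfolding poisson_process_def by (elim conjE allE[of _ 1] allE[of _ "\<lambda>_. A"]) (auto simp: disjoint_family_on_def)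
  then have X: "(\<lambda>\<omega>. card (points \<omega> \<inter> A)) \<in> measurable P (count_space UNIV)"
    by (auto simp: indep_vars_def)
  have "(\<integral>\<^sup>+\<omega>. of_nat (card (points \<omega> \<inter> A)) \<partial>P) = ennreal (t * measure lborel (W \<inter> A))"
    using pp A t unfolding poisson_process_def
    by (intro nn_integral_poisson_count[OF prob_space_axioms X]) auto
  also have "\<dots> = ennreal t * emeasure lborel (W \<inter> A)"
  proof -
    have "emeasure lborel (W \<inter> A) \<le> emeasure lborel W" using W A by (intro emeasure_mono) auto
    then have "emeasure lborel (W \<inter> A) \<noteq> \<infinity>" using W(2) by (auto simp: top_unique)
    then show ?thesis using t by (simp add: ennreal_mult emeasure_eq_ennreal_measure)
  qed
  finally show ?thesis .
qed

definition intensity :: "'a::euclidean_space set \<Rightarrow> real \<Rightarrow> 'a measure" where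
  "intensity W t = density lborel (\<lambda>x. ennreal t * indicator W x)"

lemma sets_intensity[simp, measurable_cong]: "sets (intensity W t) = sets borel"
  by (simp add: intensity_def)

lemma space_intensity[simp]: "space (intensity W t) = UNIV"
  by (simp add: intensity_def)

lemma emeasure_intensity:
  assumes "W \<in> sets borel" "A \<in> sets borel"
  shows "emeasure (intensity W t) A = ennreal t * emeasure lborel (W \<inter> A)"
  using assms unfolding intensity_def
  by (subst emeasure_density) (auto simp: nn_integral_cmult mult.assoc indicator_inter_arith[symmetric])

lemma sigma_finite_intensity:
  assumes "W \<in> sets borel" "emeasure lborel W < \<infinity>"
  shows "sigma_finite_measure (intensity W t)"
proof -
  have "finite_measure (intensity W t)"
    using assms by (intro finite_measureI) (simp add: emeasure_intensity ennreal_mult_eq_top_iff)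
  then show ?thesis by (rule finite_measure.axioms)
qed

text \<open>The left side integrates \<open>f\<close> against the factorial moment measure. On a
  product of disjoint sets a tuple with a repeated label contributes nothing, so the sum over
  injective tuples is a product of counts, and independence factors its mean. Such products
  determine the measure by \<open>PiM_borel_eqI_disjoint\<close>.\<close>

theorem poisson_factorial_moment:
  fixes W :: "'a::euclidean_space set" and f :: "(nat \<Rightarrow> 'a) \<Rightarrow> ennreal"
  assumes pp: "poisson_process W t P" and t: "t > 0"
    and W: "W \<in> sets borel" "emeasure lborel W < \<infinity>"
    and f[measurable]: "f \<in> borel_measurable (\<Pi>\<^sub>M i\<in>{..<m}. borel)"
  shows "(\<integral>\<^sup>+\<omega>. (\<Sum>\<sigma>\<in>inj_tuples m (fst \<omega>). f (\<lambda>i\<in>{..<m}. snd \<omega> (\<sigma> i))) \<partial>P)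
    = (\<integral>\<^sup>+x. f x \<partial>(\<Pi>\<^sub>M i\<in>{..<m}. intensity W t))"
proof -
  let ?pt = "\<lambda>\<omega> \<sigma>. \<lambda>i\<in>{..<m}. snd \<omega> (\<sigma> i)"
  interpret P: prob_space P using pp by (simp add: poisson_process_def)
  have sP[measurable_cong]: "sets P = sets (count_space UNIV \<Otimes>\<^sub>M (\<Pi>\<^sub>M i\<in>UNIV. borel))"
    and Pinj: "AE \<omega> in P. inj_on (snd \<omega>) {..<fst \<omega>}"
    using pp by (auto simp: poisson_process_def)
  \<comment> \<open>A fixed countable set of label tuples: the random range of summation becomes the
    indicator \<open>?d\<close> on it, and Tonelli applies with a counting measure.\<close>
  define T where "T = {..<m} \<rightarrow>\<^sub>E (UNIV :: nat set)"
  have cT: "countable T" unfolding T_def by (intro countable_PiE) auto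
  interpret T: sigma_finite_measure "count_space T" by (rule sigma_finite_measure_count_space_countable[OF cT])
  interpret TP: pair_sigma_finite "count_space T" P ..
  let ?S = "\<Pi>\<^sub>M i\<in>{..<m}. borel :: 'a measure"
  let ?d = "\<lambda>(\<sigma>, \<omega>). indicator (inj_tuples m (fst \<omega>)) \<sigma> :: ennreal"
  let ?h = "\<lambda>(\<sigma>, \<omega>). \<lambda>i\<in>{..<m}. snd \<omega> (\<sigma> i)"
  have fst_m: "fst \<in> measurable P (count_space UNIV)" and snd_m: "(\<lambda>\<omega>. snd \<omega> k) \<in> borel_measurable P" for k
    by measurable
  have d[measurable]: "?d \<in> borel_measurable (count_space T \<Otimes>\<^sub>M P)"
  proof (rule measurable_pair_measure_countable1[OF cT])
    fix \<sigma>
    have "(\<lambda>n. indicator (inj_tuples m n) \<sigma> :: ennreal) \<in> measurable (count_space UNIV) borel" by simp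
    from measurable_compose[OF fst_m this] show "(\<lambda>\<omega>. ?d (\<sigma>, \<omega>)) \<in> borel_measurable P" by simp
  qed
  have h[measurable]: "?h \<in> measurable (count_space T \<Otimes>\<^sub>M P) ?S"
  proof (rule measurable_pair_measure_countable1[OF cT])
    fix \<sigma>
    show "(\<lambda>\<omega>. ?h (\<sigma>, \<omega>)) \<in> measurable P ?S"
      by (auto intro!: measurable_restrict snd_m)
  qed
  define M where "M = distr (density (count_space T \<Otimes>\<^sub>M P) ?d) ?S ?h"
  define N where "N = (\<Pi>\<^sub>M i\<in>{..<m}. intensity W t)"
  have nnM: "(\<integral>\<^sup>+x. k x \<partial>M) = (\<integral>\<^sup>+\<omega>. (\<Sum>\<sigma>\<in>inj_tuples m (fst \<omega>). k (?pt \<omega> \<sigma>)) \<partial>P)"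
    if [measurable]: "k \<in> borel_measurable ?S" for k
  proof -
    have "(\<integral>\<^sup>+x. k x \<partial>M) = (\<integral>\<^sup>+x. ?d x * k (?h x) \<partial>(count_space T \<Otimes>\<^sub>M P))"
      unfolding M_def by (subst nn_integral_distr, measurable, subst nn_integral_density) auto
    also have "\<dots> = (\<integral>\<^sup>+\<omega>. (\<integral>\<^sup>+\<sigma>. ?d (\<sigma>, \<omega>) * k (?h (\<sigma>, \<omega>)) \<partial>count_space T) \<partial>P)"
      by (rule TP.nn_integral_snd[symmetric]) measurable
    also have "\<dots> = (\<integral>\<^sup>+\<omega>. (\<Sum>\<sigma>\<in>inj_tuples m (fst \<omega>). k (?pt \<omega> \<sigma>)) \<partial>P)"
    proof (rule nn_integral_cong)
      fix \<omega> :: "'a config"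
      have "inj_tuples m (fst \<omega>) \<subseteq> T" by (auto simp: inj_tuples_def T_def PiE_iff extensional_def)
      then have "(\<integral>\<^sup>+\<sigma>. ?d (\<sigma>, \<omega>) * k (?h (\<sigma>, \<omega>)) \<partial>count_space T) = (\<Sum>\<sigma>\<in>inj_tuples m (fst \<omega>). ?d (\<sigma>, \<omega>) * k (?h (\<sigma>, \<omega>)))"
        by (intro nn_integral_count_space' finite_inj_tuples) auto
      then show "(\<integral>\<^sup>+\<sigma>. ?d (\<sigma>, \<omega>) * k (?h (\<sigma>, \<omega>)) \<partial>count_space T) = (\<Sum>\<sigma>\<in>inj_tuples m (fst \<omega>). k (?pt \<omega> \<sigma>))"
        by simp
    qed
    finally show ?thesis .
  qed
  have rect: "emeasure M (Pi\<^sub>E {..<m} A) = (\<Prod>i<m. emeasure (intensity W t) (A i))"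
    if A: "\<And>i. i < m \<Longrightarrow> A i \<in> sets borel" and dA: "disjoint_family_on A {..<m}" for A
  proof -
    have PA[measurable]: "Pi\<^sub>E {..<m} A \<in> sets ?S" using A by (intro sets_PiM_I_finite) auto
    have "emeasure M (Pi\<^sub>E {..<m} A) = (\<integral>\<^sup>+x. indicator (Pi\<^sub>E {..<m} A) x \<partial>M)"
      by (rule nn_integral_indicator[symmetric]) (simp add: M_def)
    also have "\<dots> = (\<integral>\<^sup>+\<omega>. (\<Sum>\<sigma>\<in>inj_tuples m (fst \<omega>). indicator (Pi\<^sub>E {..<m} A) (?pt \<omega> \<sigma>)) \<partial>P)"
      by (rule nnM) measurable
    also have "\<dots> = (\<integral>\<^sup>+\<omega>. (\<Prod>i<m. of_nat (card (points \<omega> \<inter> A i))) \<partial>P)"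
    proof (rule nn_integral_cong_AE)
      show "AE \<omega> in P. (\<Sum>\<sigma>\<in>inj_tuples m (fst \<omega>). indicator (Pi\<^sub>E {..<m} A) (?pt \<omega> \<sigma>))
        = (\<Prod>i<m. of_nat (card (points \<omega> \<inter> A i)) :: ennreal)"
        using Pinj
      proof eventually_elim
        case (elim \<omega>)
        obtain n y where \<omega>: "\<omega> = (n, y)" by (cases \<omega>)
        have inj: "inj_on y {..<n}" using elim \<omega> by simp
        let ?g = "\<lambda>\<sigma>. \<Prod>i<m. indicator (A i) (y (\<sigma> i)) :: ennreal"
        have "(\<Sum>\<sigma>\<in>inj_tuples m n. indicator (Pi\<^sub>E {..<m} A) (\<lambda>i\<in>{..<m}. y (\<sigma> i))) = (\<Sum>\<sigma>\<in>inj_tuples m n. ?g \<sigma>)"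
          by (intro sum.cong refl, subst prod_indicator_PiE[symmetric]) auto
        also have "\<dots> = (\<Sum>\<sigma>\<in>{..<m} \<rightarrow>\<^sub>E {..<n}. ?g \<sigma>)"
        proof (rule sum.mono_neutral_left)
          show "\<forall>\<sigma>\<in>({..<m} \<rightarrow>\<^sub>E {..<n}) - inj_tuples m n. ?g \<sigma> = 0"
          proof
            fix \<sigma> assume "\<sigma> \<in> ({..<m} \<rightarrow>\<^sub>E {..<n}) - inj_tuples m n"
            then obtain i j where ij: "i < m" "j < m" "i \<noteq> j" "\<sigma> i = \<sigma> j" by (auto simp: inj_tuples_def inj_on_def)
            then have "A i \<inter> A j = {}" using dA by (auto simp: disjoint_family_on_def)
            then have "y (\<sigma> i) \<notin> A i \<or> y (\<sigma> j) \<notin> A j" using ij by auto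
            then obtain i' where "i' < m" "y (\<sigma> i') \<notin> A i'" using ij by auto
            then show "?g \<sigma> = 0" by (intro prod_zero bexI[of _ i']) auto
          qed
        qed (auto simp: inj_tuples_def intro!: finite_PiE)
        also have "\<dots> = (\<Prod>i<m. \<Sum>j<n. indicator (A i) (y j))"
          by (rule prod_sum_PiE[symmetric]) auto
        also have "\<dots> = (\<Prod>i<m. of_nat (card (points \<omega> \<inter> A i)))"
        proof (rule prod.cong[OF refl])
          fix i
          have "(\<Sum>j<n. indicator (A i) (y j)) = (\<Sum>j\<in>{j \<in> {..<n}. y j \<in> A i}. 1 :: ennreal)"
            by (rule sum.mono_neutral_cong_right) (auto simp: indicator_def)
          also have "\<dots> = of_nat (card {j \<in> {..<n}. y j \<in> A i})" by simp
          also have "card {j \<in> {..<n}. y j \<in> A i} = card (y ` {j \<in> {..<n}. y j \<in> A i})"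
            by (rule card_image[symmetric]) (rule inj_on_subset[OF inj], auto)
          also have "y ` {j \<in> {..<n}. y j \<in> A i} = points \<omega> \<inter> A i"
            by (auto simp: points_def \<omega>)
          finally show "(\<Sum>j<n. indicator (A i) (y j)) = (of_nat (card (points \<omega> \<inter> A i)) :: ennreal)" .
        qed
        finally show ?case by (simp add: \<omega>)
      qed
    qed
    also have "\<dots> = (\<Prod>i<m. \<integral>\<^sup>+\<omega>. of_nat (card (points \<omega> \<inter> A i)) \<partial>P)"
    proof (rule P.indep_vars_nn_integral)
      have "P.indep_vars (\<lambda>_. count_space UNIV) (\<lambda>i \<omega>. card (points \<omega> \<inter> A i)) {..<m}"
        using pp A dA unfolding poisson_process_def by blast
      from P.indep_vars_compose2[OF this, of "\<lambda>_ n. of_nat n :: ennreal" "\<lambda>_. borel"]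
      show "P.indep_vars (\<lambda>_. borel) (\<lambda>i \<omega>. of_nat (card (points \<omega> \<inter> A i)) :: ennreal) {..<m}" by simp
    qed auto
    also have "\<dots> = (\<Prod>i<m. emeasure (intensity W t) (A i))"
      using A by (intro prod.cong refl) (simp add: poisson_nn_integral_count[OF pp t _ W] emeasure_intensity W)
    finally show ?thesis .
  qed
  interpret N: product_sigma_finite "\<lambda>_::nat. intensity W t"
    by (simp add: product_sigma_finite_def sigma_finite_intensity[OF W])
  have sN: "sets N = sets ?S" unfolding N_def by (intro sets_PiM_cong) auto
  have "M = N"
  proof (rule PiM_borel_eqI_disjoint)
    show "sets M = sets ?S" by (simp add: M_def)
    show "sets N = sets ?S" by (rule sN)
    have I: "{x \<in> space ?S. inj_on x {..<m}} \<in> sets ?S"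
    proof -
      have "Measurable.pred ?S (\<lambda>x. x i = x j \<longrightarrow> i = j)" if ij: "i \<in> {..<m}" "j \<in> {..<m}" for i j
      proof -
        have [measurable]: "(\<lambda>x. x i) \<in> borel_measurable ?S" "(\<lambda>x. x j) \<in> borel_measurable ?S"
          using measurable_component_singleton[OF ij(1), of "\<lambda>_. borel"] measurable_component_singleton[OF ij(2), of "\<lambda>_. borel"] by auto
        have "{x \<in> space ?S. x i = x j} \<in> sets ?S" by (rule measurable_equality_set) measurable
        then have "Measurable.pred ?S (\<lambda>x. x i = x j)" by (simp add: pred_def)
        then show ?thesis by (cases "i = j") auto
      qed
      then have "Measurable.pred ?S (\<lambda>x. \<forall>i\<in>{..<m}. \<forall>j\<in>{..<m}. x i = x j \<longrightarrow> i = j)"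
        by (intro pred_intros_finite) auto
      then show ?thesis by (simp add: inj_on_def pred_def)
    qed
    have nI: "{x \<in> space ?S. \<not> inj_on x {..<m}} \<in> sets ?S" using sets.sets_Collect_neg[OF I] by simp
    have "(\<integral>\<^sup>+x. indicator {x \<in> space ?S. \<not> inj_on x {..<m}} x \<partial>M) = (\<integral>\<^sup>+\<omega>. (\<Sum>\<sigma>\<in>inj_tuples m (fst \<omega>). indicator {x \<in> space ?S. \<not> inj_on x {..<m}} (?pt \<omega> \<sigma>)) \<partial>P)"
      by (intro nnM borel_measurable_indicator nI)
    also have "\<dots> = (\<integral>\<^sup>+\<omega>. 0 \<partial>P)"
    proof (rule nn_integral_cong_AE)
      show "AE \<omega> in P. (\<Sum>\<sigma>\<in>inj_tuples m (fst \<omega>). indicator {x \<in> space ?S. \<not> inj_on x {..<m}} (?pt \<omega> \<sigma>)) = (0 :: ennreal)"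
        using Pinj
      proof eventually_elim
        case (elim \<omega>)
        show ?case
        proof (rule sum.neutral, rule ballI)
          fix \<sigma> assume \<sigma>: "\<sigma> \<in> inj_tuples m (fst \<omega>)"
          have "inj_on (?pt \<omega> \<sigma>) {..<m}"
          proof (rule inj_onI)
            fix i j assume *: "i \<in> {..<m}" "j \<in> {..<m}" "(?pt \<omega> \<sigma>) i = (?pt \<omega> \<sigma>) j"
            then have "\<sigma> i = \<sigma> j" using \<sigma> elim by (auto simp: inj_tuples_def inj_on_def PiE_iff)
            then show "i = j" using \<sigma> * by (auto simp: inj_tuples_def inj_on_def)
          qed
          then show "indicator {x \<in> space ?S. \<not> inj_on x {..<m}} (?pt \<omega> \<sigma>) = (0 :: ennreal)" by simp
        qed
      qed
    qed
    finally have "(\<integral>\<^sup>+x. indicator {x \<in> space ?S. \<not> inj_on x {..<m}} x \<partial>M) = 0" by simp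
    then have "emeasure M {x \<in> space ?S. \<not> inj_on x {..<m}} = 0"
      using nI by (subst (asm) nn_integral_indicator) (auto simp: M_def)
    then show "AE x in M. inj_on x {..<m}"
      by (intro AE_I[where N="{x \<in> space ?S. \<not> inj_on x {..<m}}"]) (use nI in \<open>auto simp: M_def\<close>)
    show "AE x in N. inj_on x {..<m}"
      unfolding N_def
    proof (intro AE_PiM_inj sigma_finite_intensity W)
      fix c :: 'a
      have "emeasure lborel (W \<inter> {c}) \<le> emeasure lborel {c}" by (intro emeasure_mono) auto
      then show "emeasure (intensity W t) {c} = 0" using W by (simp add: emeasure_intensity)
    qed simp
  next
    fix A :: "nat \<Rightarrow> 'a set" assume A: "\<And>i. i < m \<Longrightarrow> A i \<in> sets borel" "disjoint_family_on A {..<m}"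
    have "emeasure N (Pi\<^sub>E {..<m} A) = (\<Prod>i<m. emeasure (intensity W t) (A i))"
      unfolding N_def by (rule N.emeasure_PiM) (use A in auto)
    then show "emeasure M (Pi\<^sub>E {..<m} A) = emeasure N (Pi\<^sub>E {..<m} A)"
      using rect[OF A] by simp
    have "emeasure (intensity W t) (A i) \<noteq> \<top>" if "i < m" for i
    proof -
      have "emeasure lborel (W \<inter> A i) \<le> emeasure lborel W" using W A that by (intro emeasure_mono) auto
      then have "emeasure lborel (W \<inter> A i) \<noteq> \<top>" using W(2) by (auto simp: top_unique)
      then show ?thesis using A(1)[OF that] W by (simp add: emeasure_intensity ennreal_mult_eq_top_iff)
    qed
    then show "emeasure M (Pi\<^sub>E {..<m} A) \<noteq> \<infinity>"
      using rect[OF A] by (auto simp: ennreal_prod_eq_top)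
  qed
  then show ?thesis using nnM[OF f] by (simp add: N_def)
qed

section \<open>Integrating out the marks\<close>

lemma (in product_prob_space) nn_integral_PiM_restrict:
  assumes J: "finite J" "J \<subseteq> I" and f: "f \<in> borel_measurable (PiM J M)"
  shows "(\<integral>\<^sup>+x. f (restrict x J) \<partial>PiM I M) = (\<integral>\<^sup>+x. f x \<partial>PiM J M)"
  by (subst distr_PiM_restrict_finite[OF J, symmetric])
     (subst nn_integral_distr, use f J in \<open>auto intro!: measurable_restrict_subset\<close>)

lemma (in product_prob_space) nn_integral_PiM_2:
  assumes ab: "a \<noteq> b" "a \<in> I" "b \<in> I"
    and f[measurable]: "(\<lambda>(s, t). f s t) \<in> borel_measurable (M a \<Otimes>\<^sub>M M b)"
  shows "(\<integral>\<^sup>+x. f (x a) (x b) \<partial>PiM I M) = (\<integral>\<^sup>+s. (\<integral>\<^sup>+t. f s t \<partial>M b) \<partial>M a)"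
proof -
  have m: "(\<lambda>x. f (x a) (x b)) \<in> borel_measurable (PiM {a, b} M)" by measurable
  have "(\<integral>\<^sup>+x. f (x a) (x b) \<partial>PiM I M) = (\<integral>\<^sup>+x. f (restrict x {a, b} a) (restrict x {a, b} b) \<partial>PiM I M)" by simp
  also have "\<dots> = (\<integral>\<^sup>+x. f (x a) (x b) \<partial>PiM {a, b} M)"
    by (rule nn_integral_PiM_restrict[OF _ _ m]) (use ab in auto)
  also have "\<dots> = (\<integral>\<^sup>+s. (\<integral>\<^sup>+x. f s (x b) \<partial>PiM {b} M) \<partial>M a)"
    using ab m by (subst product_nn_integral_insert_rev) auto
  also have "\<dots> = (\<integral>\<^sup>+s. (\<integral>\<^sup>+t. f s t \<partial>M b) \<partial>M a)"
    by (intro nn_integral_cong product_nn_integral_singleton) measurable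
  finally show ?thesis .
qed

lemma (in product_sigma_finite) nn_integral_PiM_4:
  assumes d: "distinct [a, b, c, d]"
    and f[measurable]: "(\<lambda>(s, t, u, v). f s t u v) \<in> borel_measurable (M a \<Otimes>\<^sub>M M b \<Otimes>\<^sub>M M c \<Otimes>\<^sub>M M d)"
  shows "(\<integral>\<^sup>+x. f (x a) (x b) (x c) (x d) \<partial>PiM {a, b, c, d} M)
    = (\<integral>\<^sup>+s. (\<integral>\<^sup>+t. (\<integral>\<^sup>+u. (\<integral>\<^sup>+v. f s t u v \<partial>M d) \<partial>M c) \<partial>M b) \<partial>M a)"
proof -
  have "(\<integral>\<^sup>+x. f (x a) (x b) (x c) (x d) \<partial>PiM {a, b, c, d} M)
    = (\<integral>\<^sup>+s. (\<integral>\<^sup>+x. f s (x b) (x c) (x d) \<partial>PiM {b, c, d} M) \<partial>M a)"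
  proof -
    have "(\<lambda>x. (x a, x b, x c, x d)) \<in> PiM (insert a {b, c, d}) M \<rightarrow>\<^sub>M M a \<Otimes>\<^sub>M M b \<Otimes>\<^sub>M M c \<Otimes>\<^sub>M M d"
      by (intro measurable_Pair measurable_component_singleton) auto
    from measurable_compose[OF this f]
    have "(\<lambda>x. f (x a) (x b) (x c) (x d)) \<in> borel_measurable (PiM (insert a {b, c, d}) M)" by simp
    then show ?thesis using d by (subst product_nn_integral_insert_rev) auto
  qed
  also have "\<dots> = (\<integral>\<^sup>+s. (\<integral>\<^sup>+t. (\<integral>\<^sup>+x. f s t (x c) (x d) \<partial>PiM {c, d} M) \<partial>M b) \<partial>M a)"
  proof (rule nn_integral_cong)
    fix s assume [measurable]: "s \<in> space (M a)"
    have "(\<lambda>x. (s, x b, x c, x d)) \<in> PiM (insert b {c, d}) M \<rightarrow>\<^sub>M M a \<Otimes>\<^sub>M M b \<Otimes>\<^sub>M M c \<Otimes>\<^sub>M M d"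
      by (intro measurable_Pair measurable_component_singleton) auto
    from measurable_compose[OF this f]
    have "(\<lambda>x. f s (x b) (x c) (x d)) \<in> borel_measurable (PiM (insert b {c, d}) M)" by simp
    then show "(\<integral>\<^sup>+x. f s (x b) (x c) (x d) \<partial>PiM {b, c, d} M) = (\<integral>\<^sup>+t. (\<integral>\<^sup>+x. f s t (x c) (x d) \<partial>PiM {c, d} M) \<partial>M b)"
      using d by (subst product_nn_integral_insert_rev) auto
  qed
  also have "\<dots> = (\<integral>\<^sup>+s. (\<integral>\<^sup>+t. (\<integral>\<^sup>+u. (\<integral>\<^sup>+x. f s t u (x d) \<partial>PiM {d} M) \<partial>M c) \<partial>M b) \<partial>M a)"
  proof (rule nn_integral_cong, rule nn_integral_cong)
    fix s t assume [measurable]: "s \<in> space (M a)" "t \<in> space (M b)"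
    have "(\<lambda>x. f s t (x c) (x d)) \<in> borel_measurable (PiM (insert c {d}) M)" by measurable
    then show "(\<integral>\<^sup>+x. f s t (x c) (x d) \<partial>PiM {c, d} M) = (\<integral>\<^sup>+u. (\<integral>\<^sup>+x. f s t u (x d) \<partial>PiM {d} M) \<partial>M c)"
      using d by (subst product_nn_integral_insert_rev) auto
  qed
  also have "\<dots> = (\<integral>\<^sup>+s. (\<integral>\<^sup>+t. (\<integral>\<^sup>+u. (\<integral>\<^sup>+v. f s t u v \<partial>M d) \<partial>M c) \<partial>M b) \<partial>M a)"
  proof (rule nn_integral_cong, rule nn_integral_cong, rule nn_integral_cong)
    fix s t u assume [measurable]: "s \<in> space (M a)" "t \<in> space (M b)" "u \<in> space (M c)"
    have "f s t u \<in> borel_measurable (M d)" by measurable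
    then show "(\<integral>\<^sup>+x. f s t u (x d) \<partial>PiM {d} M) = (\<integral>\<^sup>+v. f s t u v \<partial>M d)"
      by (rule product_nn_integral_singleton)
  qed
  finally show ?thesis .
qed

locale marks =
  fixes \<kappa>v \<kappa>e :: "real measure" and \<phi> :: "real \<Rightarrow> real \<Rightarrow> real \<Rightarrow> real"
  assumes prob_v: "prob_space \<kappa>v" and sets_v: "sets \<kappa>v = sets nonneg_borel"
    and prob_e: "prob_space \<kappa>e" and sets_e: "sets \<kappa>e = sets nonneg_borel"
    and \<phi>_meas: "(\<lambda>(a, b, w). \<phi> a b w) \<in> nonneg_borel \<Otimes>\<^sub>M nonneg_borel \<Otimes>\<^sub>M nonneg_borel \<rightarrow>\<^sub>M nonneg_borel"
begin

sublocale v: prob_space \<kappa>v by (rule prob_v)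
sublocale e: prob_space \<kappa>e by (rule prob_e)
sublocale vv: pair_sigma_finite \<kappa>v \<kappa>v ..
sublocale ve: pair_sigma_finite \<kappa>v \<kappa>e ..

abbreviation "\<R> \<equiv> (\<Pi>\<^sub>M i\<in>(UNIV :: nat set). \<kappa>v)"
abbreviation "\<E> \<equiv> (\<Pi>\<^sub>M e\<in>{e :: nat set. card e = 2}. \<kappa>e)"
abbreviation "g \<equiv> connection_fun \<kappa>v \<kappa>e \<phi>"

sublocale R: product_prob_space "\<lambda>_. \<kappa>v" "UNIV :: nat set"
  by unfold_locales
sublocale E: product_prob_space "\<lambda>_. \<kappa>e" "{e :: nat set. card e = 2}"
  by unfold_locales

lemma \<phi>_borel [measurable]: "(\<lambda>(a, b, w). \<phi> a b w) \<in> borel_measurable (\<kappa>v \<Otimes>\<^sub>M \<kappa>v \<Otimes>\<^sub>M \<kappa>e)"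
proof -
  have "sets (\<kappa>v \<Otimes>\<^sub>M \<kappa>v \<Otimes>\<^sub>M \<kappa>e) = sets (nonneg_borel \<Otimes>\<^sub>M nonneg_borel \<Otimes>\<^sub>M nonneg_borel)"
    by (intro sets_pair_measure_cong sets_v sets_e)
  from measurable_cong_sets[OF this refl, of nonneg_borel] \<phi>_meas
  have "(\<lambda>(a, b, w). \<phi> a b w) \<in> \<kappa>v \<Otimes>\<^sub>M \<kappa>v \<Otimes>\<^sub>M \<kappa>e \<rightarrow>\<^sub>M nonneg_borel" by simp
  then show ?thesis by (simp add: measurable_restrict_space2_iff)
qed

lemma \<phi>_measurable [measurable (raw)]:
  assumes "a \<in> M \<rightarrow>\<^sub>M \<kappa>v" "b \<in> M \<rightarrow>\<^sub>M \<kappa>v" "w \<in> M \<rightarrow>\<^sub>M \<kappa>e"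
  shows "(\<lambda>x. \<phi> (a x) (b x) (w x)) \<in> borel_measurable M"
  using measurable_compose[OF measurable_Pair[OF assms(1) measurable_Pair[OF assms(2,3)]] \<phi>_borel] by simp

lemma g_bounds: "0 \<le> g x" "g x \<le> 1"
proof -
  interpret ee: prob_space "\<kappa>v \<Otimes>\<^sub>M \<kappa>v \<Otimes>\<^sub>M \<kappa>e"
  proof -
    interpret pair_prob_space \<kappa>v \<kappa>e ..
    interpret q: pair_prob_space \<kappa>v "\<kappa>v \<Otimes>\<^sub>M \<kappa>e" ..
    show "prob_space (\<kappa>v \<Otimes>\<^sub>M \<kappa>v \<Otimes>\<^sub>M \<kappa>e)" by (rule q.prob_space_axioms)
  qed
  show "0 \<le> g x" "g x \<le> 1" by (auto simp: connection_fun_def)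
qed

lemma g_antimono: "x \<le> y \<Longrightarrow> g y \<le> g x"
proof -
  interpret ee: prob_space "\<kappa>v \<Otimes>\<^sub>M \<kappa>v \<Otimes>\<^sub>M \<kappa>e"
  proof -
    interpret pair_prob_space \<kappa>v \<kappa>e ..
    interpret q: pair_prob_space \<kappa>v "\<kappa>v \<Otimes>\<^sub>M \<kappa>e" ..
    show "prob_space (\<kappa>v \<Otimes>\<^sub>M \<kappa>v \<Otimes>\<^sub>M \<kappa>e)" by (rule q.prob_space_axioms)
  qed
  assume "x \<le> y"
  moreover have "{z \<in> space (\<kappa>v \<Otimes>\<^sub>M \<kappa>v \<Otimes>\<^sub>M \<kappa>e). case z of (a, b, w) \<Rightarrow> x \<le> \<phi> a b w} \<in> sets (\<kappa>v \<Otimes>\<^sub>M \<kappa>v \<Otimes>\<^sub>M \<kappa>e)"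
    by measurable
  ultimately show ?thesis unfolding connection_fun_def by (intro ee.finite_measure_mono) auto
qed

lemma g_borel [measurable]: "g \<in> borel_measurable borel"
proof -
  have "mono (\<lambda>x. - g x)" by (intro monoI) (simp add: g_antimono)
  then have "(\<lambda>x. - g x) \<in> borel_measurable borel" by (rule borel_measurable_mono)
  then have "(\<lambda>x. - (- g x)) \<in> borel_measurable borel" by (rule borel_measurable_uminus)
  then show ?thesis by simp
qed

lemma nn_integral_g:
  "(\<integral>\<^sup>+a. (\<integral>\<^sup>+b. (\<integral>\<^sup>+w. indicator {x..} (\<phi> a b w) \<partial>\<kappa>e) \<partial>\<kappa>v) \<partial>\<kappa>v) = ennreal (g x)"
proof -
  interpret pair_prob_space \<kappa>v \<kappa>e ..
  interpret q: pair_prob_space \<kappa>v "\<kappa>v \<Otimes>\<^sub>M \<kappa>e" ..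
  let ?A = "{z \<in> space (\<kappa>v \<Otimes>\<^sub>M \<kappa>v \<Otimes>\<^sub>M \<kappa>e). case z of (a, b, w) \<Rightarrow> x \<le> \<phi> a b w}"
  have "ennreal (g x) = emeasure (\<kappa>v \<Otimes>\<^sub>M \<kappa>v \<Otimes>\<^sub>M \<kappa>e) ?A"
    unfolding connection_fun_def by (simp add: q.emeasure_eq_measure)
  also have "\<dots> = (\<integral>\<^sup>+z. indicator ?A z \<partial>(\<kappa>v \<Otimes>\<^sub>M \<kappa>v \<Otimes>\<^sub>M \<kappa>e))"
    by (rule nn_integral_indicator[symmetric]) measurable
  also have "\<dots> = (\<integral>\<^sup>+z. indicator {x..} (case z of (a, b, w) \<Rightarrow> \<phi> a b w) \<partial>(\<kappa>v \<Otimes>\<^sub>M \<kappa>v \<Otimes>\<^sub>M \<kappa>e))"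
    by (intro nn_integral_cong) (auto simp: indicator_def)
  also have "\<dots> = (\<integral>\<^sup>+a. (\<integral>\<^sup>+z. indicator {x..} (case (a, z) of (a, b, w) \<Rightarrow> \<phi> a b w) \<partial>(\<kappa>v \<Otimes>\<^sub>M \<kappa>e)) \<partial>\<kappa>v)"
    by (rule sigma_finite_measure.nn_integral_fst[OF prob_space_imp_sigma_finite[OF prob_space_pair[OF prob_v prob_e]], symmetric]) measurable
  also have "\<dots> = (\<integral>\<^sup>+a. (\<integral>\<^sup>+b. (\<integral>\<^sup>+w. indicator {x..} (\<phi> a b w) \<partial>\<kappa>e) \<partial>\<kappa>v) \<partial>\<kappa>v)"
  proof (rule nn_integral_cong)
    fix a assume [measurable]: "a \<in> space \<kappa>v"
    have "(\<lambda>z. indicator {x..} (case (a, z) of (a, b, w) \<Rightarrow> \<phi> a b w) :: ennreal) \<in> borel_measurable (\<kappa>v \<Otimes>\<^sub>M \<kappa>e)"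
      by measurable
    from e.nn_integral_fst[OF this]
    show "(\<integral>\<^sup>+z. indicator {x..} (case (a, z) of (a, b, w) \<Rightarrow> \<phi> a b w) \<partial>(\<kappa>v \<Otimes>\<^sub>M \<kappa>e)) = (\<integral>\<^sup>+b. (\<integral>\<^sup>+w. indicator {x..} (\<phi> a b w) \<partial>\<kappa>e) \<partial>\<kappa>v)"
      by simp
  qed
  finally show ?thesis by simp
qed

text \<open>Four distinct labels carry independent vertex marks, and the two unordered pairs are
  different indices of the edge marks, so the two edge events are independent once the lengths are
  fixed.\<close>

lemma nn_integral_edges:
  assumes d: "distinct [i, j, k, l]"
  shows "(\<integral>\<^sup>+r. (\<integral>\<^sup>+w. indicator {x..} (\<phi> (r i) (r j) (w {i, j})) * indicator {y..} (\<phi> (r k) (r l) (w {k, l})) \<partial>\<E>) \<partial>\<R>)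
    = ennreal (g x) * ennreal (g y)"
proof -
  let ?E = "\<lambda>r. (\<integral>\<^sup>+w. indicator {x..} (\<phi> (r i) (r j) (w {i, j})) * indicator {y..} (\<phi> (r k) (r l) (w {k, l})) \<partial>\<E>) :: ennreal"
  define G where "G x a b = (\<integral>\<^sup>+w. indicator {x..} (\<phi> a b w) \<partial>\<kappa>e)" for x a b
  have G[measurable]: "(\<lambda>(a, b). G x a b) \<in> borel_measurable (\<kappa>v \<Otimes>\<^sub>M \<kappa>v)" for x
    unfolding G_def by measurable
  have e: "{i, j} \<noteq> {k, l}" "card {i, j} = 2" "card {k, l} = 2" using d by (auto simp: doubleton_eq_iff)
  have "?E r
    = G x (r i) (r j) * G y (r k) (r l)" if r: "r \<in> space \<R>" for r
  proof -
    have [measurable]: "r i \<in> space \<kappa>v" for i using r by (auto simp: space_PiM PiE_iff)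
    have "?E r
      = (\<integral>\<^sup>+s. (\<integral>\<^sup>+t. indicator {x..} (\<phi> (r i) (r j) s) * indicator {y..} (\<phi> (r k) (r l) t) \<partial>\<kappa>e) \<partial>\<kappa>e)"
      by (rule E.nn_integral_PiM_2) (use e in auto)
    also have "\<dots> = G x (r i) (r j) * G y (r k) (r l)"
      unfolding G_def by (subst nn_integral_cmult) (auto simp: nn_integral_multc)
    finally show ?thesis .
  qed
  then have "(\<integral>\<^sup>+r. ?E r \<partial>\<R>)
    = (\<integral>\<^sup>+r. G x (r i) (r j) * G y (r k) (r l) \<partial>\<R>)"
    by (intro nn_integral_cong) auto
  also have "\<dots> = (\<integral>\<^sup>+r. G x (restrict r {i, j, k, l} i) (restrict r {i, j, k, l} j) * G y (restrict r {i, j, k, l} k) (restrict r {i, j, k, l} l) \<partial>\<R>)"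
    by simp
  also have "\<dots> = (\<integral>\<^sup>+r. G x (r i) (r j) * G y (r k) (r l) \<partial>(\<Pi>\<^sub>M i\<in>{i, j, k, l}. \<kappa>v))"
    by (rule R.nn_integral_PiM_restrict) auto
  also have "\<dots> = (\<integral>\<^sup>+a. (\<integral>\<^sup>+b. (\<integral>\<^sup>+c. (\<integral>\<^sup>+d. G x a b * G y c d \<partial>\<kappa>v) \<partial>\<kappa>v) \<partial>\<kappa>v) \<partial>\<kappa>v)"
    by (rule R.nn_integral_PiM_4[OF d]) measurable
  also have "\<dots> = (\<integral>\<^sup>+a. (\<integral>\<^sup>+b. G x a b * ennreal (g y) \<partial>\<kappa>v) \<partial>\<kappa>v)"
  proof (rule nn_integral_cong, rule nn_integral_cong)
    fix a b assume [measurable]: "a \<in> space \<kappa>v" "b \<in> space \<kappa>v"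
    have "(\<integral>\<^sup>+c. (\<integral>\<^sup>+d. G x a b * G y c d \<partial>\<kappa>v) \<partial>\<kappa>v) = (\<integral>\<^sup>+c. G x a b * (\<integral>\<^sup>+d. G y c d \<partial>\<kappa>v) \<partial>\<kappa>v)"
    proof (rule nn_integral_cong)
      fix c assume [measurable]: "c \<in> space \<kappa>v"
      show "(\<integral>\<^sup>+d. G x a b * G y c d \<partial>\<kappa>v) = G x a b * (\<integral>\<^sup>+d. G y c d \<partial>\<kappa>v)"
        by (rule nn_integral_cmult) measurable
    qed
    also have "\<dots> = G x a b * (\<integral>\<^sup>+c. (\<integral>\<^sup>+d. G y c d \<partial>\<kappa>v) \<partial>\<kappa>v)"
      by (rule nn_integral_cmult) measurable
    finally show "(\<integral>\<^sup>+c. (\<integral>\<^sup>+d. G x a b * G y c d \<partial>\<kappa>v) \<partial>\<kappa>v) = G x a b * ennreal (g y)"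
      by (simp only: nn_integral_g[of y, folded G_def])
  qed
  also have "\<dots> = (\<integral>\<^sup>+a. (\<integral>\<^sup>+b. G x a b \<partial>\<kappa>v) * ennreal (g y) \<partial>\<kappa>v)"
    by (intro nn_integral_cong nn_integral_multc) measurable
  also have "\<dots> = ennreal (g x) * ennreal (g y)"
    by (subst nn_integral_multc) (auto simp: nn_integral_g[of x, folded G_def])
  finally show ?thesis .
qed

end

section \<open>Measurability of the crossing relation\<close>

context plane
begin

lemma orth_proj_eq: "orth_proj L x = (x \<bullet> p) *\<^sub>R p + (x \<bullet> q) *\<^sub>R q"
proof -
  let ?y = "(x \<bullet> p) *\<^sub>R p + (x \<bullet> q) *\<^sub>R q"
  have pqL: "p \<in> L" "q \<in> L" using onb_pq by (auto simp: orthonormal_basis_def)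
  have y: "?y \<in> L" using pqL subspace_L by (intro subspace_add subspace_scale)
  have yp: "x - ?y \<in> L\<^sup>\<bottom>" by (simp add: LP_iff inner_diff_left inner_add_left)
  show ?thesis unfolding orth_proj_def
  proof (rule the_equality)
    fix z assume z: "z \<in> L \<and> x - z \<in> L\<^sup>\<bottom>"
    have "?y - z \<in> L" using z y subspace_L by (simp add: subspace_diff)
    moreover have "?y - z \<in> L\<^sup>\<bottom>"
    proof -
      have "(x - z) - (x - ?y) \<in> L\<^sup>\<bottom>" 
        by (rule subspace_diff[OF subspace_orthogonal_comp]) (use z yp in simp_all)
      also have "(x - z) - (x - ?y) = ?y - z" by (simp only: diff_diff_eq2 diff_add_eq) simp
      finally show ?thesis .
    qed
    ultimately have "(?y - z) \<bullet> (?y - z) = 0" unfolding orthogonal_comp_def orthogonal_def by blast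
    then show "z = ?y" by simp
  qed (use y yp in auto)
qed

lemma orth_proj_eq_iff: "orth_proj L x = orth_proj L y \<longleftrightarrow> x \<bullet> p = y \<bullet> p \<and> x \<bullet> q = y \<bullet> q"
proof
  assume "orth_proj L x = orth_proj L y"
  then have *: "(x \<bullet> p) *\<^sub>R p + (x \<bullet> q) *\<^sub>R q = (y \<bullet> p) *\<^sub>R p + (y \<bullet> q) *\<^sub>R q" by (simp add: orth_proj_eq)
  from arg_cong[OF *, of "\<lambda>x. x \<bullet> p"] arg_cong[OF *, of "\<lambda>x. x \<bullet> q"]
  show "x \<bullet> p = y \<bullet> p \<and> x \<bullet> q = y \<bullet> q" by (simp add: inner_add_left)
qed (simp add: orth_proj_eq)

definition seg_meet :: "'a \<Rightarrow> 'a \<Rightarrow> 'a \<Rightarrow> 'a \<Rightarrow> bool" where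
  "seg_meet a b c d \<longleftrightarrow> orth_proj L ` closed_segment a b \<inter> orth_proj L ` closed_segment c d \<noteq> {}"

lemma seg_meet_iff:
  "seg_meet a b c d \<longleftrightarrow> (\<exists>s\<in>{0..1}. \<exists>r\<in>{0..1}. \<forall>n\<in>{p, q}. (a + s *\<^sub>R (b - a)) \<bullet> n = (c + r *\<^sub>R (d - c)) \<bullet> n)"
proof -
  have cs: "closed_segment a b = (\<lambda>s. a + s *\<^sub>R (b - a)) ` {0..1}" for a b :: 'a
    unfolding closed_segment_image_interval by (intro image_cong) (auto simp: algebra_simps)
  have "seg_meet a b c d \<longleftrightarrow> (\<exists>s\<in>{0..1}. \<exists>r\<in>{0..1}. orth_proj L (a + s *\<^sub>R (b - a)) = orth_proj L (c + r *\<^sub>R (d - c)))"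
    unfolding seg_meet_def cs by blast
  then show ?thesis by (simp add: orth_proj_eq_iff)
qed

text \<open>Closedness yields the measurability of a relation defined by an existential quantifier
  over real parameters. The parameters range over a compact square, so along a subsequence they
  converge to parameters at which the projections of the limit segments meet.\<close>

lemma closed_seg_meet: "closed {(a, b, c, d). seg_meet a b c d}"
  unfolding closed_sequential_limits
proof (intro allI impI, elim conjE)
  fix X :: "nat \<Rightarrow> 'a \<times> 'a \<times> 'a \<times> 'a" and l
  assume X: "\<forall>n. X n \<in> {(a, b, c, d). seg_meet a b c d}" and lim: "X \<longlonglongrightarrow> l"
  define A where "A n = fst (X n)" for n
  define B where "B n = fst (snd (X n))" for n
  define C where "C n = fst (snd (snd (X n)))" for n
  define D where "D n = snd (snd (snd (X n)))" for n
  obtain a b c d where l: "l = (a, b, c, d)" by (metis prod_cases4)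
  have L: "A \<longlonglongrightarrow> a" "B \<longlonglongrightarrow> b" "C \<longlonglongrightarrow> c" "D \<longlonglongrightarrow> d"
    unfolding A_def B_def C_def D_def
    using tendsto_fst[OF lim] tendsto_fst[OF tendsto_snd[OF lim]] tendsto_fst[OF tendsto_snd[OF tendsto_snd[OF lim]]]
      tendsto_snd[OF tendsto_snd[OF tendsto_snd[OF lim]]] by (simp_all add: l)
  have "\<forall>n. \<exists>s r. s \<in> {0..1} \<and> r \<in> {0..1} \<and> (\<forall>m\<in>{p, q}. (A n + s *\<^sub>R (B n - A n)) \<bullet> m = (C n + r *\<^sub>R (D n - C n)) \<bullet> m)"
  proof
    fix n
    have "seg_meet (A n) (B n) (C n) (D n)" using X[rule_format, of n] by (auto simp: A_def B_def C_def D_def)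
    then show "\<exists>s r. s \<in> {0..1} \<and> r \<in> {0..1} \<and> (\<forall>m\<in>{p, q}. (A n + s *\<^sub>R (B n - A n)) \<bullet> m = (C n + r *\<^sub>R (D n - C n)) \<bullet> m)"
      unfolding seg_meet_iff by blast
  qed
  then obtain s r where sr: "\<And>n. s n \<in> {0..1::real}" "\<And>n. r n \<in> {0..1::real}"
    "\<And>n m. m \<in> {p, q} \<Longrightarrow> (A n + s n *\<^sub>R (B n - A n)) \<bullet> m = (C n + r n *\<^sub>R (D n - C n)) \<bullet> m"
    by metis
  have "compact ({0..1::real} \<times> {0..1::real})" by (intro compact_Times compact_Icc)
  then obtain z \<sigma> where z: "z \<in> {0..1::real} \<times> {0..1::real}" "strict_mono \<sigma>" "((\<lambda>n. (s n, r n)) \<circ> \<sigma>) \<longlonglongrightarrow> z"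
    unfolding compact_def using sr(1,2) by (elim allE[of _ "\<lambda>n. (s n, r n)"]) auto
  have S: "(\<lambda>n. s (\<sigma> n)) \<longlonglongrightarrow> fst z" and R: "(\<lambda>n. r (\<sigma> n)) \<longlonglongrightarrow> snd z"
    using tendsto_fst[OF z(3)] tendsto_snd[OF z(3)] by (simp_all add: comp_def)
  have L': "(\<lambda>n. A (\<sigma> n)) \<longlonglongrightarrow> a" "(\<lambda>n. B (\<sigma> n)) \<longlonglongrightarrow> b" "(\<lambda>n. C (\<sigma> n)) \<longlonglongrightarrow> c" "(\<lambda>n. D (\<sigma> n)) \<longlonglongrightarrow> d"
    using L[THEN LIMSEQ_subseq_LIMSEQ, OF z(2)] by (simp_all add: comp_def)
  have "(a + fst z *\<^sub>R (b - a)) \<bullet> m = (c + snd z *\<^sub>R (d - c)) \<bullet> m" if m: "m \<in> {p, q}" for m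
  proof (rule LIMSEQ_unique)
    show "(\<lambda>n. (A (\<sigma> n) + s (\<sigma> n) *\<^sub>R (B (\<sigma> n) - A (\<sigma> n))) \<bullet> m) \<longlonglongrightarrow> (a + fst z *\<^sub>R (b - a)) \<bullet> m"
      by (intro tendsto_intros S L')
    have "(\<lambda>n. (C (\<sigma> n) + r (\<sigma> n) *\<^sub>R (D (\<sigma> n) - C (\<sigma> n))) \<bullet> m) \<longlonglongrightarrow> (c + snd z *\<^sub>R (d - c)) \<bullet> m"
      by (intro tendsto_intros R L')
    then show "(\<lambda>n. (A (\<sigma> n) + s (\<sigma> n) *\<^sub>R (B (\<sigma> n) - A (\<sigma> n))) \<bullet> m) \<longlonglongrightarrow> (c + snd z *\<^sub>R (d - c)) \<bullet> m"
      using sr(3)[OF m] by simp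
  qed
  then have "seg_meet a b c d" unfolding seg_meet_iff using z(1)
    by (intro bexI[of _ "fst z"] bexI[of _ "snd z"]) auto
  then show "l \<in> {(a, b, c, d). seg_meet a b c d}" by (simp add: l)
qed

lemma seg_meet_measurable [measurable (raw)]:
  assumes [measurable]: "a \<in> borel_measurable M" "b \<in> borel_measurable M" "c \<in> borel_measurable M" "d \<in> borel_measurable M"
  shows "Measurable.pred M (\<lambda>x. seg_meet (a x) (b x) (c x) (d x))"
proof -
  have "(\<lambda>x. (a x, b x, c x, d x)) \<in> borel_measurable M" by (intro borel_measurable_Pair) measurable
  from measurable_sets[OF this borel_closed[OF closed_seg_meet]]
  have "{x \<in> space M. seg_meet (a x) (b x) (c x) (d x)} \<in> sets M"
    by (simp add: vimage_def Int_def conj_commute)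
  then show ?thesis by (simp add: pred_def)
qed

lemma seg_meet_meet:
  assumes D: "det2 u z \<noteq> 0"
  shows "of_bool (seg_meet v (v + u) w (w + z)) = meet u z (w - v)"
proof -
  have "seg_meet v (v + u) w (w + z) \<longleftrightarrow> det2 (w - v) z / det2 u z \<in> {0..1} \<and> det2 (w - v) u / det2 u z \<in> {0..1}"
  proof
    assume "seg_meet v (v + u) w (w + z)"
    then obtain s r where sr: "s \<in> {0..1}" "r \<in> {0..1}"
      "(v + s *\<^sub>R u) \<bullet> p = (w + r *\<^sub>R z) \<bullet> p" "(v + s *\<^sub>R u) \<bullet> q = (w + r *\<^sub>R z) \<bullet> q"
      unfolding seg_meet_iff by auto
    then have y: "(w - v) \<bullet> p = s * (u \<bullet> p) - r * (z \<bullet> p)" "(w - v) \<bullet> q = s * (u \<bullet> q) - r * (z \<bullet> q)"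
      by (simp_all add: inner_add_left inner_diff_left)
    have "det2 (w - v) z = s * det2 u z" "det2 (w - v) u = r * det2 u z"
      unfolding det2_def y by (simp_all add: algebra_simps)
    then show "det2 (w - v) z / det2 u z \<in> {0..1} \<and> det2 (w - v) u / det2 u z \<in> {0..1}" using sr D by simp
  next
    assume *: "det2 (w - v) z / det2 u z \<in> {0..1} \<and> det2 (w - v) u / det2 u z \<in> {0..1}"
    let ?y = "w - v"
    \<comment> \<open>Cramer's rule without division: any three planar vectors satisfy this linear
      relation.\<close>
    have "det2 ?y z * (u \<bullet> n) - det2 ?y u * (z \<bullet> n) = det2 u z * (?y \<bullet> n)" if "n \<in> {p, q}" for n
      using that unfolding det2_def by (auto simp: algebra_simps)
    then have "?y \<bullet> n = det2 ?y z / det2 u z * (u \<bullet> n) - det2 ?y u / det2 u z * (z \<bullet> n)" if "n \<in> {p, q}" for n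
      using D that by (simp add: diff_divide_distrib[symmetric] eq_divide_eq mult.commute)
    then have "(v + (det2 ?y z / det2 u z) *\<^sub>R (v + u - v)) \<bullet> n = (w + (det2 ?y u / det2 u z) *\<^sub>R (w + z - w)) \<bullet> n" if "n \<in> {p, q}" for n
      using that by (simp add: inner_add_left inner_diff_left algebra_simps)
    then show "seg_meet v (v + u) w (w + z)" unfolding seg_meet_iff using * by blast
  qed
  then show ?thesis by (auto simp: meet_def indicator_def)
qed

end

section \<open>The expected number of crossings\<close>

lemma AE_lborel_inner_neq_0:
  fixes n :: "'a::euclidean_space"
  assumes "n \<noteq> 0" shows "AE x in lborel. x \<bullet> n \<noteq> 0"
proof -
  have b: "{x. n \<bullet> x = 0} \<in> sets borel" by measurable
  have "{x. n \<bullet> x = 0} \<in> null_sets lebesgue"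
    using negligible_hyperplane[of n 0] assms by (simp add: negligible_iff_null_sets)
  then have "{x. n \<bullet> x = 0} \<in> null_sets lborel"
    using b null_sets_completion_iff[of "{x. n \<bullet> x = 0}" lborel] by simp
  then show ?thesis by (rule AE_I'[of _ lborel]) (auto simp: inner_commute)
qed

context plane
begin

text \<open>Pairs with parallel projections, for which \<open>meet\<close> divides by 0, are
  negligible: once \<open>z\<close> has a nonzero component along \<open>p\<close>, a vanishing
  determinant confines \<open>u\<close> to a hyperplane.\<close>

lemma AE_det2: "AE z in lborel. AE u in lborel. det2 u z \<noteq> 0"
proof -
  have "p \<noteq> 0" using inner_pq(1) by (metis inner_zero_left zero_neq_one)
  from AE_lborel_inner_neq_0[OF this] show ?thesis
  proof eventually_elim
    case (elim z)
    let ?n = "(z \<bullet> q) *\<^sub>R p - (z \<bullet> p) *\<^sub>R q"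
    have "?n \<bullet> q = - (z \<bullet> p)" by (simp add: inner_diff_left)
    then have "?n \<noteq> 0" using elim by auto
    moreover have "det2 u z = u \<bullet> ?n" for u by (simp add: det2_def inner_diff_right)
    ultimately show ?case using AE_lborel_inner_neq_0[of ?n] by simp
  qed
qed

end

lemma sum_4_tuples:
  "(\<Sum>(i, j, k, l) \<in> {(i, j, k, l). {i, j, k, l} \<subseteq> {..<n} \<and> distinct [i, j, k, l]}. F i j k l)
    = (\<Sum>\<sigma>\<in>inj_tuples 4 n. F (\<sigma> 0) (\<sigma> 1) (\<sigma> 2) (\<sigma> (3::nat)))"
proof (rule sum.reindex_bij_witness[where i="\<lambda>\<sigma>. (\<sigma> 0, \<sigma> 1, \<sigma> 2, \<sigma> 3)"
      and j="\<lambda>(i, j, k, l). \<lambda>x\<in>{..<4}. if x = 0 then i else if x = 1 then j else if x = 2 then k else l"])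
  have less4: "x < 4 \<longleftrightarrow> x = 0 \<or> x = 1 \<or> x = 2 \<or> x = 3" for x :: nat by auto
  fix \<sigma> assume \<sigma>: "\<sigma> \<in> inj_tuples 4 n"
  have "\<sigma> x \<noteq> \<sigma> y" if "x \<noteq> y" "x < 4" "y < 4" for x y using \<sigma> that by (auto simp: inj_tuples_def inj_on_def)
  then show "(\<sigma> 0, \<sigma> 1, \<sigma> 2, \<sigma> 3) \<in> {(i, j, k, l). {i, j, k, l} \<subseteq> {..<n} \<and> distinct [i, j, k, l]}"
    using \<sigma> by (auto simp: inj_tuples_def PiE_iff)
  show "(case (\<sigma> 0, \<sigma> 1, \<sigma> 2, \<sigma> 3) of (i, j, k, l) \<Rightarrow> \<lambda>x\<in>{..<4}. if x = 0 then i else if x = 1 then j else if x = 2 then k else l) = \<sigma>"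
    using \<sigma> by (auto simp: inj_tuples_def PiE_iff extensional_def fun_eq_iff less4)
next
  have less4: "x < 4 \<longleftrightarrow> x = 0 \<or> x = 1 \<or> x = 2 \<or> x = 3" for x :: nat by auto
  fix a :: "nat \<times> nat \<times> nat \<times> nat"
  assume a: "a \<in> {(i, j, k, l). {i, j, k, l} \<subseteq> {..<n} \<and> distinct [i, j, k, l]}"
  obtain i j k l where [simp]: "a = (i, j, k, l)" by (metis prod_cases4)
  show "(case a of (i, j, k, l) \<Rightarrow> \<lambda>x\<in>{..<4}. if x = 0 then i else if x = 1 then j else if x = 2 then k else l) \<in> inj_tuples 4 n"
    using a by (auto simp: inj_tuples_def inj_on_def less4)
qed auto

text \<open>One intensity \<open>t\<close> with its own marks; the limit in t is taken only after
  the estimates of this locale.\<close>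

locale crossing_model = body L p q W D \<rho> p0 + marks \<kappa>v \<kappa>e \<phi>
  for L :: "'a::euclidean_space set" and p q W D \<rho> p0 \<kappa>v \<kappa>e \<phi> +
  fixes t :: real and P :: "'a config measure"
  assumes poisson: "poisson_process W t P" and t_pos: "t > 0"
begin

sublocale P: prob_space P using poisson by (simp add: poisson_process_def)

lemma sets_P [measurable_cong]: "sets P = sets (count_space UNIV \<Otimes>\<^sub>M (\<Pi>\<^sub>M i\<in>UNIV. borel))"
  using poisson by (simp add: poisson_process_def)

lemma prob_marks: "prob_space (\<R> \<Otimes>\<^sub>M \<E>)"
  by (intro prob_space_pair R.P.prob_space_axioms E.P.prob_space_axioms)

lemma point_measurable: "(\<lambda>c. snd c i) \<in> borel_measurable P"
  by measurable

abbreviation "\<Omega> \<equiv> rgg_space P \<kappa>v \<kappa>e"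

lemma edge_iff: "edge \<phi> \<omega> i j \<longleftrightarrow> norm (snd (fst \<omega>) i - snd (fst \<omega>) j) \<le> \<phi> (fst (snd \<omega>) i) (fst (snd \<omega>) j) (snd (snd \<omega>) {i, j})"
  by (simp add: edge_def case_prod_unfold)

lemma segments_meet_iff: "segments_meet L \<omega> i j k l \<longleftrightarrow> seg_meet (snd (fst \<omega>) i) (snd (fst \<omega>) j) (snd (fst \<omega>) k) (snd (fst \<omega>) l)"
  by (simp add: segments_meet_def case_prod_unfold seg_meet_def)

definition crossing_term :: "'a outcome \<Rightarrow> nat \<Rightarrow> nat \<Rightarrow> nat \<Rightarrow> nat \<Rightarrow> ennreal" where
  "crossing_term \<omega> i j k l = of_bool (edge \<phi> \<omega> i j \<and> edge \<phi> \<omega> k l \<and> segments_meet L \<omega> i j k l)"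

lemma point_measurable': "(\<lambda>\<omega>. snd (fst \<omega>) i) \<in> borel_measurable \<Omega>"
  unfolding rgg_space_def using measurable_compose[OF measurable_fst point_measurable] by simp

lemma edge_measurable:
  assumes "i \<noteq> j" shows "Measurable.pred \<Omega> (\<lambda>\<omega>. edge \<phi> \<omega> i j)"
proof -
  note [measurable] = point_measurable'
  \<comment> \<open>Edge marks are indexed by two-element sets, so the component at {i, j} exists
    for distinct labels only.\<close>
  have "card {i, j} = 2" using assms by simp
  then have "(\<lambda>w. w {i, j}) \<in> \<E> \<rightarrow>\<^sub>M \<kappa>e" by (intro measurable_component_singleton) simp
  from measurable_compose[OF measurable_snd measurable_compose[OF measurable_snd this]]
  have [measurable]: "(\<lambda>\<omega>. snd (snd \<omega>) {i, j}) \<in> \<Omega> \<rightarrow>\<^sub>M \<kappa>e" unfolding rgg_space_def .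
  have "(\<lambda>r. r i) \<in> \<R> \<rightarrow>\<^sub>M \<kappa>v" for i by (intro measurable_component_singleton) simp
  from measurable_compose[OF measurable_snd measurable_compose[OF measurable_fst this]]
  have [measurable]: "(\<lambda>\<omega>. fst (snd \<omega>) i) \<in> \<Omega> \<rightarrow>\<^sub>M \<kappa>v" for i unfolding rgg_space_def .
  show ?thesis unfolding edge_iff by measurable
qed

lemma crossing_term_measurable:
  assumes "i \<noteq> j" "k \<noteq> l" shows "(\<lambda>\<omega>. crossing_term \<omega> i j k l) \<in> borel_measurable \<Omega>"
proof -
  note [measurable] = point_measurable' edge_measurable[OF assms(1)] edge_measurable[OF assms(2)]
  show ?thesis unfolding crossing_term_def segments_meet_iff by measurable
qed

text \<open>The conditional mean of \<open>crossing_term\<close> given the positions of the four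
  points, by \<open>nn_integral_crossing_term\<close>.\<close>

definition \<Gamma> :: "'a \<Rightarrow> 'a \<Rightarrow> 'a \<Rightarrow> 'a \<Rightarrow> ennreal" where
  "\<Gamma> a b c d = ennreal (g (norm (a - b))) * ennreal (g (norm (c - d))) * of_bool (seg_meet a b c d)"

lemma \<Gamma>_measurable [measurable (raw)]:
  assumes [measurable]: "a \<in> borel_measurable M" "b \<in> borel_measurable M" "c \<in> borel_measurable M" "d \<in> borel_measurable M"
  shows "(\<lambda>x. \<Gamma> (a x) (b x) (c x) (d x)) \<in> borel_measurable M"
  unfolding \<Gamma>_def by measurable

lemma nn_integral_crossing_term:
  assumes d: "distinct [i, j, k, l]" and c: "c \<in> space P"
  shows "(\<integral>\<^sup>+m. crossing_term (c, m) i j k l \<partial>(\<R> \<Otimes>\<^sub>M \<E>)) = \<Gamma> (snd c i) (snd c j) (snd c k) (snd c l)"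
proof -
  let ?y = "snd c"
  have m: "(\<lambda>m. crossing_term (c, m) i j k l) \<in> borel_measurable (\<R> \<Otimes>\<^sub>M \<E>)"
    using measurable_compose[OF measurable_Pair1'[OF c] crossing_term_measurable[of i j k l, unfolded rgg_space_def]] d by simp
  have "(\<integral>\<^sup>+m. crossing_term (c, m) i j k l \<partial>(\<R> \<Otimes>\<^sub>M \<E>)) = (\<integral>\<^sup>+r. (\<integral>\<^sup>+w. crossing_term (c, r, w) i j k l \<partial>\<E>) \<partial>\<R>)"
    by (rule sigma_finite_measure.nn_integral_fst[OF prob_space_imp_sigma_finite[OF E.P.prob_space_axioms] m, symmetric])
  also have "\<dots> = (\<integral>\<^sup>+r. (\<integral>\<^sup>+w. of_bool (seg_meet (?y i) (?y j) (?y k) (?y l)) *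
      (indicator {norm (?y i - ?y j)..} (\<phi> (r i) (r j) (w {i, j})) * indicator {norm (?y k - ?y l)..} (\<phi> (r k) (r l) (w {k, l}))) \<partial>\<E>) \<partial>\<R>)"
    by (intro nn_integral_cong) (auto simp: crossing_term_def edge_iff segments_meet_iff indicator_def)
  also have "\<dots> = of_bool (seg_meet (?y i) (?y j) (?y k) (?y l)) * (\<integral>\<^sup>+r. (\<integral>\<^sup>+w.
      indicator {norm (?y i - ?y j)..} (\<phi> (r i) (r j) (w {i, j})) * indicator {norm (?y k - ?y l)..} (\<phi> (r k) (r l) (w {k, l})) \<partial>\<E>) \<partial>\<R>)"
    by (cases "seg_meet (?y i) (?y j) (?y k) (?y l)") simp_all
  also have "\<dots> = \<Gamma> (?y i) (?y j) (?y k) (?y l)"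
    unfolding nn_integral_edges[OF d] by (simp add: \<Gamma>_def mult_ac)
  finally show ?thesis .
qed

definition tuples4 :: "nat \<Rightarrow> (nat \<times> nat \<times> nat \<times> nat) set" where
  "tuples4 n = {(i, j, k, l). {i, j, k, l} \<subseteq> {..<n} \<and> distinct [i, j, k, l]}"

lemma crossings_ennreal:
  "ennreal (crossings \<phi> L \<omega>) = ennreal (1 / 24) * (\<Sum>(i, j, k, l) \<in> tuples4 (fst (fst \<omega>)).
     crossing_term \<omega> i j k l + crossing_term \<omega> i k j l + crossing_term \<omega> i l j k)"
proof -
  have h: "ennreal (h_cross \<phi> L \<omega> i j k l) = crossing_term \<omega> i j k l + crossing_term \<omega> i k j l + crossing_term \<omega> i l j k" for i j k l
    by (simp add: h_cross_def crossing_term_def)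
  have "h_cross \<phi> L \<omega> i j k l \<ge> 0" for i j k l by (simp add: h_cross_def)
  then show ?thesis
    unfolding crossings_def tuples4_def
    by (subst ennreal_mult) (auto simp: h[symmetric] case_prod_unfold sum_ennreal intro!: sum_nonneg)
qed

lemma fst_measurable: "(\<lambda>\<omega>. fst (fst \<omega>)) \<in> \<Omega> \<rightarrow>\<^sub>M count_space UNIV"
proof -
  have "fst \<in> P \<rightarrow>\<^sub>M count_space UNIV" by measurable
  from measurable_compose[OF measurable_fst this] show ?thesis unfolding rgg_space_def .
qed

lemma crossings_measurable: "(\<lambda>\<omega>. ennreal (crossings \<phi> L \<omega>)) \<in> borel_measurable \<Omega>"
  unfolding crossings_ennreal
\<comment> \<open>The range of summation is random; fixing the number of points, which has countably
  many values, makes it deterministic.\<close>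
proof (rule measurable_compose_countable[OF _ fst_measurable])
  fix n
  show "(\<lambda>\<omega>. ennreal (1 / 24) * (\<Sum>(i, j, k, l) \<in> tuples4 n.
     crossing_term \<omega> i j k l + crossing_term \<omega> i k j l + crossing_term \<omega> i l j k)) \<in> borel_measurable \<Omega>"
    by (intro borel_measurable_times_ennreal borel_measurable_const borel_measurable_sum)
       (auto simp: tuples4_def intro!: borel_measurable_add crossing_term_measurable)
qed

text \<open>Permuting labels carries the three pairings of four points into each other, so they
  contribute equally after summation over all tuples: 1/24 becomes 3/24 = 1/8.\<close>

lemma nn_integral_crossings_marks:
  assumes c: "c \<in> space P"
  shows "(\<integral>\<^sup>+m. ennreal (crossings \<phi> L (c, m)) \<partial>(\<R> \<Otimes>\<^sub>M \<E>))
    = ennreal (1 / 8) * (\<Sum>\<sigma>\<in>inj_tuples 4 (fst c). \<Gamma> (snd c (\<sigma> 0)) (snd c (\<sigma> 1)) (snd c (\<sigma> 2)) (snd c (\<sigma> 3)))"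
proof -
  let ?y = "snd c" and ?T = "tuples4 (fst c)"
  let ?S = "(\<Sum>(i, j, k, l) \<in> ?T. \<Gamma> (?y i) (?y j) (?y k) (?y l))"
  have m: "(\<lambda>m. crossing_term (c, m) i j k l) \<in> borel_measurable (\<R> \<Otimes>\<^sub>M \<E>)" if "i \<noteq> j" "k \<noteq> l" for i j k l
    using measurable_compose[OF measurable_Pair1'[OF c] crossing_term_measurable[OF that, unfolded rgg_space_def]] by simp
  have "(\<integral>\<^sup>+m. ennreal (crossings \<phi> L (c, m)) \<partial>(\<R> \<Otimes>\<^sub>M \<E>))
    = ennreal (1 / 24) * (\<integral>\<^sup>+m. (\<Sum>(i, j, k, l) \<in> ?T.
     crossing_term (c, m) i j k l + crossing_term (c, m) i k j l + crossing_term (c, m) i l j k) \<partial>(\<R> \<Otimes>\<^sub>M \<E>))"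
    unfolding crossings_ennreal fst_conv
    by (intro nn_integral_cmult borel_measurable_sum) (auto simp: tuples4_def intro!: borel_measurable_add m)
  also have "(\<integral>\<^sup>+m. (\<Sum>(i, j, k, l) \<in> ?T.
     crossing_term (c, m) i j k l + crossing_term (c, m) i k j l + crossing_term (c, m) i l j k) \<partial>(\<R> \<Otimes>\<^sub>M \<E>))
    = (\<Sum>x \<in> ?T. (\<integral>\<^sup>+m. (case x of (i, j, k, l) \<Rightarrow>
     crossing_term (c, m) i j k l + crossing_term (c, m) i k j l + crossing_term (c, m) i l j k) \<partial>(\<R> \<Otimes>\<^sub>M \<E>)))"
    by (intro nn_integral_sum) (auto simp: tuples4_def intro!: borel_measurable_add m)
  also have "\<dots> = (\<Sum>(i, j, k, l) \<in> ?T. \<Gamma> (?y i) (?y j) (?y k) (?y l) + \<Gamma> (?y i) (?y k) (?y j) (?y l) + \<Gamma> (?y i) (?y l) (?y j) (?y k))"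
  proof (rule sum.cong[OF refl])
    fix x assume x: "x \<in> ?T"
    obtain i j k l where [simp]: "x = (i, j, k, l)" by (metis prod_cases4)
    have d: "distinct [i, j, k, l]" "distinct [i, k, j, l]" "distinct [i, l, j, k]" using x by (auto simp: tuples4_def)
    have ms: "(\<lambda>m. crossing_term (c, m) i j k l) \<in> borel_measurable (\<R> \<Otimes>\<^sub>M \<E>)"
      "(\<lambda>m. crossing_term (c, m) i k j l) \<in> borel_measurable (\<R> \<Otimes>\<^sub>M \<E>)"
      "(\<lambda>m. crossing_term (c, m) i l j k) \<in> borel_measurable (\<R> \<Otimes>\<^sub>M \<E>)" using d by (auto intro!: m)
    show "(\<integral>\<^sup>+m. (case x of (i, j, k, l) \<Rightarrow>
     crossing_term (c, m) i j k l + crossing_term (c, m) i k j l + crossing_term (c, m) i l j k) \<partial>(\<R> \<Otimes>\<^sub>M \<E>))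
     = (case x of (i, j, k, l) \<Rightarrow> \<Gamma> (?y i) (?y j) (?y k) (?y l) + \<Gamma> (?y i) (?y k) (?y j) (?y l) + \<Gamma> (?y i) (?y l) (?y j) (?y k))"
      by (simp add: nn_integral_add ms borel_measurable_add nn_integral_crossing_term[OF d(1) c] nn_integral_crossing_term[OF d(2) c]
          nn_integral_crossing_term[OF d(3) c])
  qed
  also have "\<dots> = 3 * ?S"
  proof -
    have 1: "(\<Sum>(i, j, k, l) \<in> ?T. \<Gamma> (?y i) (?y k) (?y j) (?y l)) = ?S"
      by (rule sum.reindex_bij_witness[where i="\<lambda>(i, j, k, l). (i, k, j, l)" and j="\<lambda>(i, j, k, l). (i, k, j, l)"])
         (auto simp: tuples4_def)
    have 2: "(\<Sum>(i, j, k, l) \<in> ?T. \<Gamma> (?y i) (?y l) (?y j) (?y k)) = ?S"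
      by (rule sum.reindex_bij_witness[where i="\<lambda>(i, j, k, l). (i, k, l, j)" and j="\<lambda>(i, j, k, l). (i, l, j, k)"])
         (auto simp: tuples4_def)
    have three: "(s + s) + s = 3 * s" for s :: ennreal 
    proof -
      have "(2 + 1) * s = 2 * s + 1 * s" by (rule distrib_right)
      then show ?thesis by (simp add: mult_2)
    qed
    show ?thesis
      unfolding case_prod_unfold sum.distrib
      using 1 2 by (simp add: case_prod_unfold three)
  qed
  also have "ennreal (1 / 24) * (3 * ?S)
    = ennreal (1 / 8) * ?S"
  proof -
    have "ennreal (1 / 24) * 3 = ennreal (1 / 24) * ennreal 3" by simp
    also have "\<dots> = ennreal (1 / 8)" by (subst ennreal_mult[symmetric]) auto
    finally show ?thesis by (simp add: mult.assoc[symmetric])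
  qed
  also have "?S
    = (\<Sum>\<sigma>\<in>inj_tuples 4 (fst c). \<Gamma> (?y (\<sigma> 0)) (?y (\<sigma> 1)) (?y (\<sigma> 2)) (?y (\<sigma> 3)))"
    unfolding tuples4_def by (rule sum_4_tuples)
  finally show ?thesis .
qed

lemma W_finite: "emeasure lborel W < \<infinity>" by (simp add: W_vol)

lemma nn_integral_intensity:
  assumes [measurable]: "f \<in> borel_measurable borel"
  shows "(\<integral>\<^sup>+x. f x \<partial>intensity W t) = ennreal t * (\<integral>\<^sup>+x. indicator W x * f x \<partial>lborel)"
  unfolding intensity_def by (subst nn_integral_density) (auto simp: mult.assoc nn_integral_cmult)

lemma nn_integral_crossings_points:
  "(\<integral>\<^sup>+\<omega>. ennreal (crossings \<phi> L \<omega>) \<partial>\<Omega>) = ennreal (1 / 8) *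
    (\<integral>\<^sup>+a. (\<integral>\<^sup>+b. (\<integral>\<^sup>+c. (\<integral>\<^sup>+d. \<Gamma> a b c d \<partial>intensity W t) \<partial>intensity W t) \<partial>intensity W t) \<partial>intensity W t)"
proof -
  let ?S = "\<lambda>c. (\<Sum>\<sigma>\<in>inj_tuples 4 (fst c). \<Gamma> (snd c (\<sigma> 0)) (snd c (\<sigma> 1)) (snd c (\<sigma> 2)) (snd c (\<sigma> 3)))"
  let ?f = "\<lambda>x. \<Gamma> (x 0) (x 1) (x 2) (x (3::nat))"
  interpret N: product_sigma_finite "\<lambda>_::nat. intensity W t"
    by (simp add: product_sigma_finite_def sigma_finite_intensity[OF W_borel W_finite])
  have f: "?f \<in> borel_measurable (\<Pi>\<^sub>M i\<in>{..<4}. borel)"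
    by (intro \<Gamma>_measurable measurable_component_singleton[where M="\<lambda>_. borel"]) auto
  have S: "{..<4::nat} = {0, 1, 2, 3}" by auto
  have "(\<integral>\<^sup>+\<omega>. ennreal (crossings \<phi> L \<omega>) \<partial>\<Omega>) = (\<integral>\<^sup>+c. (\<integral>\<^sup>+m. ennreal (crossings \<phi> L (c, m)) \<partial>(\<R> \<Otimes>\<^sub>M \<E>)) \<partial>P)"
    unfolding rgg_space_def
    by (rule sigma_finite_measure.nn_integral_fst[OF prob_space_imp_sigma_finite[OF prob_marks] crossings_measurable[unfolded rgg_space_def], symmetric])
  also have "\<dots> = (\<integral>\<^sup>+c. ennreal (1 / 8) * ?S c \<partial>P)"
    by (intro nn_integral_cong nn_integral_crossings_marks)
  also have "\<dots> = ennreal (1 / 8) * (\<integral>\<^sup>+c. ?S c \<partial>P)"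
  proof (rule nn_integral_cmult)
    have fst_m: "fst \<in> P \<rightarrow>\<^sub>M count_space UNIV" by measurable
    show "(\<lambda>c. \<Sum>\<sigma>\<in>inj_tuples 4 (fst c). \<Gamma> (snd c (\<sigma> 0)) (snd c (\<sigma> 1)) (snd c (\<sigma> 2)) (snd c (\<sigma> 3))) \<in> borel_measurable P"
      by (rule measurable_compose_countable[OF _ fst_m]) (intro borel_measurable_sum \<Gamma>_measurable point_measurable)
  qed
  also have "(\<integral>\<^sup>+c. ?S c \<partial>P)
    = (\<integral>\<^sup>+x. ?f x \<partial>(\<Pi>\<^sub>M i\<in>{..<4}. intensity W t))"
    using poisson_factorial_moment[OF poisson t_pos W_borel W_finite f] by simp
  also have "\<dots> = (\<integral>\<^sup>+a. (\<integral>\<^sup>+b. (\<integral>\<^sup>+c. (\<integral>\<^sup>+d. \<Gamma> a b c d \<partial>intensity W t) \<partial>intensity W t) \<partial>intensity W t) \<partial>intensity W t)"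
    unfolding S by (rule N.nn_integral_PiM_4) (auto, measurable)
  finally show ?thesis .
qed

text \<open>Each edge is rewritten by its starting point and its edge vector, and the starting
  points are integrated first. Up to the null set of parallel pairs \<open>seg_meet\<close> may be
  replaced by \<open>meet\<close>.\<close>

lemma nn_integral_crossings:
  "(\<integral>\<^sup>+\<omega>. ennreal (crossings \<phi> L \<omega>) \<partial>\<Omega>) = ennreal (t ^ 4 / 8) *
    (\<integral>\<^sup>+z. (\<integral>\<^sup>+u. ennreal (g (norm u)) * ennreal (g (norm z)) * crossing_vol u z \<partial>lborel) \<partial>lborel)"
proof -
  let ?W = "\<lambda>x. indicator W x :: ennreal"
  let ?G = "(\<integral>\<^sup>+a. (\<integral>\<^sup>+b. (\<integral>\<^sup>+c. (\<integral>\<^sup>+d. \<Gamma> a b c d \<partial>intensity W t) \<partial>intensity W t) \<partial>intensity W t) \<partial>intensity W t)"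
  let ?k = "\<lambda>v u w z. ?W v * ?W (v + u) * (?W w * ?W (w + z)) * \<Gamma> v (v + u) w (w + z)"
  let ?F = "\<lambda>u z. (\<integral>\<^sup>+v. (\<integral>\<^sup>+w. ennreal t ^ 4 * ?k v u w z \<partial>lborel) \<partial>lborel)"
  let ?M = "\<lambda>v. (\<integral>\<^sup>+b. (\<integral>\<^sup>+w. (\<integral>\<^sup>+d. ennreal t ^ 4 * (?W v * ?W b * (?W w * ?W d) * \<Gamma> v b w d) \<partial>lborel) \<partial>lborel) \<partial>lborel)"
  let ?N = "\<lambda>v. (\<integral>\<^sup>+u. (\<integral>\<^sup>+w. (\<integral>\<^sup>+z. ennreal t ^ 4 * ?k v u w z \<partial>lborel) \<partial>lborel) \<partial>lborel)"
  have "?G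
    = ennreal t * (\<integral>\<^sup>+v. ?W v * (ennreal t * (\<integral>\<^sup>+b. ?W b * (ennreal t * (\<integral>\<^sup>+w. ?W w * (ennreal t * (\<integral>\<^sup>+d. ?W d * \<Gamma> v b w d \<partial>lborel)) \<partial>lborel)) \<partial>lborel)) \<partial>lborel)"
    by (simp add: nn_integral_intensity)
  also have "\<dots> = (\<integral>\<^sup>+v. ?M v \<partial>lborel)"
    by (simp add: nn_integral_cmult[symmetric] mult_ac power4_eq_xxxx)
  also have "\<dots> = (\<integral>\<^sup>+v. ?N v \<partial>lborel)"
  proof (rule nn_integral_cong)
    fix v :: 'a
    have "?M v
      = (\<integral>\<^sup>+u. (\<integral>\<^sup>+w. (\<integral>\<^sup>+d. ennreal t ^ 4 * (?W v * ?W (v + u) * (?W w * ?W d) * \<Gamma> v (v + u) w d) \<partial>lborel) \<partial>lborel) \<partial>lborel)"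
      by (rule nn_integral_lborel_translate[symmetric]) measurable
    also have "\<dots> = ?N v"
      by (intro nn_integral_cong nn_integral_lborel_translate[symmetric]) measurable
    finally show "?M v
      = ?N v" .
  qed
  also have "\<dots> = (\<integral>\<^sup>+u. (\<integral>\<^sup>+v. (\<integral>\<^sup>+w. (\<integral>\<^sup>+z. ennreal t ^ 4 * ?k v u w z \<partial>lborel) \<partial>lborel) \<partial>lborel) \<partial>lborel)"
    by (rule lborel_pair.Fubini') measurable
  also have "\<dots> = (\<integral>\<^sup>+u. (\<integral>\<^sup>+v. (\<integral>\<^sup>+z. (\<integral>\<^sup>+w. ennreal t ^ 4 * ?k v u w z \<partial>lborel) \<partial>lborel) \<partial>lborel) \<partial>lborel)"
    by (rule nn_integral_cong, rule nn_integral_cong, rule lborel_pair.Fubini') measurable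
  also have "\<dots> = (\<integral>\<^sup>+u. (\<integral>\<^sup>+z. ?F u z \<partial>lborel) \<partial>lborel)"
    by (rule nn_integral_cong, rule lborel_pair.Fubini') measurable
  also have "\<dots> = (\<integral>\<^sup>+z. (\<integral>\<^sup>+u. ?F u z \<partial>lborel) \<partial>lborel)"
    by (rule lborel_pair.Fubini') measurable
  also have "\<dots> = (\<integral>\<^sup>+z. (\<integral>\<^sup>+u. ennreal (t ^ 4) * (ennreal (g (norm u)) * ennreal (g (norm z)) * crossing_vol u z) \<partial>lborel) \<partial>lborel)"
  proof (rule nn_integral_cong_AE)
    show "AE z in lborel. (\<integral>\<^sup>+u. ?F u z \<partial>lborel)
      = (\<integral>\<^sup>+u. ennreal (t ^ 4) * (ennreal (g (norm u)) * ennreal (g (norm z)) * crossing_vol u z) \<partial>lborel)"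
      using AE_det2
    proof eventually_elim
      case (elim z)
      show ?case
      proof (rule nn_integral_cong_AE)
        show "AE u in lborel. ?F u z
          = ennreal (t ^ 4) * (ennreal (g (norm u)) * ennreal (g (norm z)) * crossing_vol u z)"
          using elim
        proof eventually_elim
          case (elim u)
          let ?c = "ennreal (t ^ 4) * (ennreal (g (norm u)) * ennreal (g (norm z)))"
          let ?m = "\<lambda>v w. ?W v * ?W (v + u) * (?W w * ?W (w + z)) * meet u z (w - v)"
          have "?F u z = (\<integral>\<^sup>+v. (\<integral>\<^sup>+w. ?c * ?m v w \<partial>lborel) \<partial>lborel)"
            using t_pos by (intro nn_integral_cong) (simp add: \<Gamma>_def seg_meet_meet[OF elim] ennreal_power mult_ac)
          also have "\<dots> = (\<integral>\<^sup>+v. ?c * (\<integral>\<^sup>+w. ?m v w \<partial>lborel) \<partial>lborel)"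
            by (intro nn_integral_cong nn_integral_cmult) measurable
          also have "\<dots> = ?c * crossing_vol u z"
            unfolding crossing_vol_def by (rule nn_integral_cmult) measurable
          finally show ?case by (simp add: mult.assoc)
        qed
      qed
    qed
  qed
  also have "\<dots> = (\<integral>\<^sup>+z. ennreal (t ^ 4) * (\<integral>\<^sup>+u. (ennreal (g (norm u)) * ennreal (g (norm z)) * crossing_vol u z) \<partial>lborel) \<partial>lborel)"
    unfolding crossing_vol_def by (intro nn_integral_cong nn_integral_cmult) measurable
  also have "\<dots> = ennreal (t ^ 4) * (\<integral>\<^sup>+z. (\<integral>\<^sup>+u. ennreal (g (norm u)) * ennreal (g (norm z)) * crossing_vol u z \<partial>lborel) \<partial>lborel)"
    unfolding crossing_vol_def by (rule nn_integral_cmult) measurable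
  finally have I: "?G
    = ennreal (t ^ 4) * (\<integral>\<^sup>+z. (\<integral>\<^sup>+u. ennreal (g (norm u)) * ennreal (g (norm z)) * crossing_vol u z \<partial>lborel) \<partial>lborel)" .
  have "ennreal (1 / 8) * ennreal (t ^ 4) = ennreal (t ^ 4 / 8)"
    using t_pos by (subst ennreal_mult[symmetric]) auto
  then show ?thesis unfolding nn_integral_crossings_points I by (simp add: mult.assoc[symmetric])
qed

end

section \<open>The main estimates\<close>

context marks
begin

definition J :: "nat \<Rightarrow> real \<Rightarrow> real \<Rightarrow> real" where
  "J d a b = (LBINT x:{a..b}. g x * x ^ d)"

text \<open>As g is at most 1 and the interval is bounded, the integral is finite, so the Bochner
  and the nonnegative integral carry the same information.\<close>

lemma J_eq:
  assumes "a \<ge> 0"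
  shows "ennreal (J d a b) = (\<integral>\<^sup>+r. ennreal (r ^ d) * (ennreal (g r) * indicator {a..b} r) \<partial>lborel)" (is "_ = ?N")
    and "J d a b \<ge> 0"
proof -
  have eq: "ennreal (r ^ d) * (ennreal (g r) * indicator {a..b} r) = ennreal (indicator {a..b} r *\<^sub>R (g r * r ^ d))" for r
    using assms g_bounds[of r] by (auto simp: indicator_def ennreal_mult[symmetric] mult.commute)
  have nn: "0 \<le> indicator {a..b} r *\<^sub>R (g r * r ^ d)" for r
    using assms g_bounds[of r] by (auto simp: indicator_def)
  have "?N \<le> (\<integral>\<^sup>+r. ennreal (\<bar>b\<bar> ^ d) * indicator {a..b} r \<partial>lborel)"
  proof (rule nn_integral_mono)
    fix r
    have "g r * r ^ d \<le> 1 * \<bar>b\<bar> ^ d" if "a \<le> r" "r \<le> b"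
      using that assms g_bounds[of r] by (intro mult_mono power_mono) auto
    then show "ennreal (r ^ d) * (ennreal (g r) * indicator {a..b} r) \<le> ennreal (\<bar>b\<bar> ^ d) * indicator {a..b} r"
      unfolding eq by (auto simp: indicator_def intro!: ennreal_leI)
  qed
  also have "\<dots> = ennreal (\<bar>b\<bar> ^ d) * emeasure lborel {a..b}" by (subst nn_integral_cmult) auto
  also have "\<dots> < \<top>" by (cases "a \<le> b") (auto simp: ennreal_mult_less_top)
  finally have fin: "?N < \<top>" .
  have "J d a b = enn2real ?N"
    unfolding J_def set_lebesgue_integral_def eq by (rule integral_eq_nn_integral) (use nn in auto)
  then show "ennreal (J d a b) = ?N" "J d a b \<ge> 0" using fin by auto
qed

lemma J_add:
  assumes "0 \<le> a" "a \<le> b" "b \<le> c"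
  shows "J d a c = J d a b + J d b c"
proof -
  have "ennreal (J d a c) = (\<integral>\<^sup>+r. ennreal (r ^ d) * (ennreal (g r) * indicator {a..c} r) \<partial>lborel)"
    by (rule J_eq) (use assms in auto)
  also have "\<dots> = (\<integral>\<^sup>+r. ennreal (r ^ d) * (ennreal (g r) * indicator {a..b} r) + ennreal (r ^ d) * (ennreal (g r) * indicator {b..c} r) \<partial>lborel)"
  proof (rule nn_integral_cong_AE)
    show "AE r in lborel. ennreal (r ^ d) * (ennreal (g r) * indicator {a..c} r)
      = ennreal (r ^ d) * (ennreal (g r) * indicator {a..b} r) + ennreal (r ^ d) * (ennreal (g r) * indicator {b..c} r)"
      using AE_lborel_singleton[of b] by eventually_elim (use assms in \<open>auto simp: indicator_def\<close>)
  qed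
  also have "\<dots> = ennreal (J d a b) + ennreal (J d b c)"
    using assms by (subst nn_integral_add) (auto simp: J_eq(1))
  also have "\<dots> = ennreal (J d a b + J d b c)"
    using assms by (intro ennreal_plus[symmetric] J_eq(2)) auto
  finally show ?thesis
    by (rule ennreal_inj[THEN iffD1, rotated 2]) (use assms in \<open>auto intro!: J_eq(2) add_nonneg_nonneg\<close>)
qed

end

section \<open>Splitting the mean by edge length\<close>

context crossing_model
begin

definition K_const :: real where "K_const = (real (DIM('a)) + 1)\<^sup>2 * c_const DIM('a)"

lemma K_const_pos: "K_const > 0"
proof -
  have "dim L \<le> DIM('a)" by (rule dim_subset_UNIV)
  then show ?thesis using c_const_pos[of "DIM('a)"] by (simp add: K_const_def dim_L)
qed

text \<open>What \<open>vol_part\<close> becomes, up to the factor \<open>I_W W L\<close>, for edges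
  of length at most \<open>R\<close> when the boundary of \<open>W\<close> is ignored; its integral
  is known exactly.\<close>

definition main_part :: "real \<Rightarrow> 'a \<Rightarrow> 'a \<Rightarrow> ennreal" where
  "main_part R u z = ennreal \<bar>det2 u z\<bar> * (ennreal (g (norm u)) * indicator {..R} (norm u)) * (ennreal (g (norm z)) * indicator {..R} (norm z))"

definition vol_part :: "'a \<Rightarrow> 'a \<Rightarrow> ennreal" where
  "vol_part u z = ennreal (g (norm u)) * ennreal (g (norm z)) * crossing_vol u z"

definition vol_part_le :: "real \<Rightarrow> 'a \<Rightarrow> 'a \<Rightarrow> ennreal" where
  "vol_part_le R u z = vol_part u z * (indicator {..R} (norm u) * indicator {..R} (norm z))"

abbreviation I2 :: "('a \<Rightarrow> 'a \<Rightarrow> ennreal) \<Rightarrow> ennreal" where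
  "I2 f \<equiv> (\<integral>\<^sup>+z. (\<integral>\<^sup>+u. f u z \<partial>lborel) \<partial>lborel)"

lemma parts_measurable [measurable]:
  "(\<lambda>(u, z). main_part R u z) \<in> borel_measurable (borel \<Otimes>\<^sub>M borel)"
  "(\<lambda>(u, z). vol_part u z) \<in> borel_measurable (borel \<Otimes>\<^sub>M borel)"
  "(\<lambda>(u, z). vol_part_le R u z) \<in> borel_measurable (borel \<Otimes>\<^sub>M borel)"
  unfolding main_part_def vol_part_le_def vol_part_def crossing_vol_def by measurable

lemma I2_mono_AE:
  assumes "\<And>u z. det2 u z \<noteq> 0 \<Longrightarrow> f u z \<le> h u z"
  shows "I2 f \<le> I2 h"
proof (rule nn_integral_mono_AE)
  show "AE z in lborel. (\<integral>\<^sup>+u. f u z \<partial>lborel) \<le> (\<integral>\<^sup>+u. h u z \<partial>lborel)"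
    using AE_det2
  proof eventually_elim
    case (elim z)
    show ?case by (rule nn_integral_mono_AE) (use elim in eventually_elim, rule assms)
  qed
qed

lemma I2_cmult:
  assumes [measurable]: "(\<lambda>(u, z). f u z) \<in> borel_measurable (borel \<Otimes>\<^sub>M borel)"
  shows "I2 (\<lambda>u z. c * f u z) = c * I2 f"
proof -
  have "I2 (\<lambda>u z. c * f u z) = (\<integral>\<^sup>+z. c * (\<integral>\<^sup>+u. f u z \<partial>lborel) \<partial>lborel)"
    by (intro nn_integral_cong nn_integral_cmult) measurable
  also have "\<dots> = c * I2 f" by (rule nn_integral_cmult) measurable
  finally show ?thesis .
qed

lemma I2_add:
  assumes [measurable]: "(\<lambda>(u, z). f u z) \<in> borel_measurable (borel \<Otimes>\<^sub>M borel)"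
    "(\<lambda>(u, z). h u z) \<in> borel_measurable (borel \<Otimes>\<^sub>M borel)"
  shows "I2 (\<lambda>u z. f u z + h u z) = I2 f + I2 h"
proof -
  have "I2 (\<lambda>u z. f u z + h u z) = (\<integral>\<^sup>+z. (\<integral>\<^sup>+u. f u z \<partial>lborel) + (\<integral>\<^sup>+u. h u z \<partial>lborel) \<partial>lborel)"
    by (intro nn_integral_cong nn_integral_add) measurable
  also have "\<dots> = I2 f + I2 h" by (rule nn_integral_add) measurable
  finally show ?thesis .
qed

lemma I2_main_part:
  "I2 (main_part R) = ennreal (K_const * (J DIM('a) 0 R)\<^sup>2)"
proof -
  let ?G = "\<lambda>r. ennreal (g r) * indicator {..R} r"
  have "I2 (main_part R) = ennreal K_const *
      (\<integral>\<^sup>+r. ennreal (r ^ DIM('a)) * indicator {0..} r * ?G r \<partial>lborel) *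
      (\<integral>\<^sup>+r. ennreal (r ^ DIM('a)) * indicator {0..} r * ?G r \<partial>lborel)"
    unfolding main_part_def K_const_def by (rule nn_integral_det2) measurable
  also have "(\<integral>\<^sup>+r. ennreal (r ^ DIM('a)) * indicator {0..} r * ?G r \<partial>lborel) = ennreal (J DIM('a) 0 R)"
    unfolding J_eq(1)[OF order_refl] by (intro nn_integral_cong) (auto simp: indicator_def)
  finally show ?thesis
    using K_const_pos J_eq(2)[OF order_refl, of "DIM('a)" R]
    by (simp add: ennreal_mult power2_eq_square mult.assoc)
qed

lemma vol_part_le_main_part:
  assumes "det2 u z \<noteq> 0" shows "vol_part u z \<le> ennreal (I_W W L) * main_part D u z"
proof (cases "norm u \<le> D \<and> norm z \<le> D")
  case True
  have "vol_part u z \<le> ennreal (g (norm u)) * ennreal (g (norm z)) * (ennreal \<bar>det2 u z\<bar> * ennreal (I_W W L))"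
    unfolding vol_part_def by (intro mult_left_mono crossing_vol_le assms) simp
  also have "\<dots> = ennreal (I_W W L) * main_part D u z"
    using True by (simp add: main_part_def mult_ac)
  finally show ?thesis .
next
  case False
  then have "crossing_vol u z = 0" by (intro crossing_vol_eq_0) auto
  then show ?thesis by (simp add: vol_part_def)
qed

lemma vol_part_le_le:
  assumes "det2 u z \<noteq> 0" shows "vol_part_le R u z \<le> ennreal (I_W W L) * main_part R u z"
proof -
  have "vol_part_le R u z \<le> ennreal (g (norm u)) * ennreal (g (norm z)) * (ennreal \<bar>det2 u z\<bar> * ennreal (I_W W L))
      * (indicator {..R} (norm u) * indicator {..R} (norm z))"
    unfolding vol_part_def vol_part_le_def by (intro mult_right_mono mult_left_mono crossing_vol_le assms) simp_all
  also have "\<dots> = ennreal (I_W W L) * main_part R u z"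
    by (simp add: main_part_def mult_ac)
  finally show ?thesis .
qed

lemma main_part_le_vol_part:
  assumes "det2 u z \<noteq> 0" "R \<ge> 0"
  shows "ennreal (I_W W L) * main_part R u z \<le> vol_part_le R u z + ennreal (2 * slope * R) * main_part R u z"
proof (cases "norm u \<le> R \<and> norm z \<le> R")
  case True
  let ?g = "ennreal (g (norm u)) * ennreal (g (norm z))"
  have "ennreal \<bar>det2 u z\<bar> * ennreal (I_W W L) \<le> crossing_vol u z + ennreal \<bar>det2 u z\<bar> * ennreal (slope * (norm u + norm z))"
    by (rule crossing_vol_ge[OF assms(1)])
  also have "\<dots> \<le> crossing_vol u z + ennreal \<bar>det2 u z\<bar> * ennreal (2 * slope * R)"
  proof (intro add_left_mono mult_left_mono ennreal_leI)
    have "slope * (norm u + norm z) \<le> slope * (2 * R)" using True slope_nonneg by (intro mult_left_mono) auto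
    then show "slope * (norm u + norm z) \<le> 2 * slope * R" by simp
  qed simp
  finally have "?g * (ennreal \<bar>det2 u z\<bar> * ennreal (I_W W L)) \<le> ?g * (crossing_vol u z + ennreal \<bar>det2 u z\<bar> * ennreal (2 * slope * R))"
    by (rule mult_left_mono) simp
  then show ?thesis
    using True unfolding main_part_def vol_part_le_def vol_part_def by (simp add: distrib_left mult_ac)
qed (auto simp: main_part_def)

text \<open>Pairs with an edge longer than \<open>R\<close> contribute at most
  \<open>I_W W L\<close> times the difference of the main parts at \<open>D\<close> and
  \<open>R\<close>. The form avoids subtraction; for two short edges both sides agree.\<close>

lemma vol_part_split:
  assumes "det2 u z \<noteq> 0" "R \<le> D"
  shows "vol_part u z + ennreal (I_W W L) * main_part R u z \<le> vol_part_le R u z + ennreal (I_W W L) * main_part D u z"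
proof (cases "norm u \<le> R \<and> norm z \<le> R")
  case True
  then have "vol_part u z = vol_part_le R u z" "main_part R u z = main_part D u z"
    using assms(2) by (auto simp: vol_part_le_def main_part_def)
  then show ?thesis by simp
next
  case False
  then have "main_part R u z = 0" "vol_part_le R u z = 0" by (auto simp: main_part_def vol_part_le_def)
  then show ?thesis using vol_part_le_main_part[OF assms(1)] by simp
qed

text \<open>\<open>z\<close> is the part of the crossing integral due to two edges of length at most
  \<open>R\<close>. It is a quantity of its own because the two error factors of the expansion
  compare \<open>z\<close> with the main term and the mean with \<open>z\<close>. The two-sided
  bound uses the same estimates at a fixed \<open>R\<close>.\<close>

lemma expected_crossings_estimates:
  assumes R: "R \<ge> 0"
  obtains z where "0 \<le> z" "z \<le> I_W W L * K_const * (J DIM('a) 0 R)\<^sup>2"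
    "(I_W W L - 2 * slope * R) * K_const * (J DIM('a) 0 R)\<^sup>2 \<le> z"
    "t ^ 4 / 8 * z \<le> expected_crossings P \<kappa>v \<kappa>e \<phi> L"
    "R \<le> D \<Longrightarrow> expected_crossings P \<kappa>v \<kappa>e \<phi> L \<le> t ^ 4 / 8 * (z + I_W W L * K_const * ((J DIM('a) 0 D)\<^sup>2 - (J DIM('a) 0 R)\<^sup>2))"
proof -
  let ?I = "I_W W L" and ?J = "\<lambda>R. J DIM('a) 0 R"
  have I0: "?I \<ge> 0" using I_W_pos by simp
  have KJ: "K_const * (?J r)\<^sup>2 \<ge> 0" for r using K_const_pos by simp
  have upper: "I2 vol_part \<le> ennreal (?I * (K_const * (?J D)\<^sup>2))"
  proof -
    have "I2 vol_part \<le> I2 (\<lambda>u z. ennreal ?I * main_part D u z)" by (rule I2_mono_AE) (rule vol_part_le_main_part)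
    then show ?thesis using I0 KJ by (simp add: I2_cmult I2_main_part ennreal_mult)
  qed
  have upperR: "I2 (vol_part_le R) \<le> ennreal (?I * (K_const * (?J R)\<^sup>2))"
  proof -
    have "I2 (vol_part_le R) \<le> I2 (\<lambda>u z. ennreal ?I * main_part R u z)" by (rule I2_mono_AE) (rule vol_part_le_le)
    then show ?thesis using I0 KJ by (simp add: I2_cmult I2_main_part ennreal_mult)
  qed
  define v where "v = enn2real (I2 vol_part)"
  define z where "z = enn2real (I2 (vol_part_le R))"
  have v: "I2 vol_part = ennreal v" "v \<ge> 0"
    using le_less_trans[OF upper ennreal_less_top] unfolding v_def by (simp_all only: ennreal_enn2real enn2real_nonneg)
  have z: "I2 (vol_part_le R) = ennreal z" "z \<ge> 0"
    using le_less_trans[OF upperR ennreal_less_top] unfolding z_def by (simp_all only: ennreal_enn2real enn2real_nonneg)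
  have EX: "expected_crossings P \<kappa>v \<kappa>e \<phi> L = t ^ 4 / 8 * v"
  proof -
    have "crossings \<phi> L \<omega> \<ge> 0" for \<omega>
      unfolding crossings_def h_cross_def by (auto intro!: sum_nonneg)
    moreover have m: "crossings \<phi> L \<in> borel_measurable \<Omega>"
    proof -
      have "(\<lambda>\<omega>. enn2real (ennreal (crossings \<phi> L \<omega>))) \<in> borel_measurable \<Omega>"
        using crossings_measurable by measurable
      then show ?thesis using calculation by simp
    qed
    ultimately have "expected_crossings P \<kappa>v \<kappa>e \<phi> L = enn2real (\<integral>\<^sup>+\<omega>. ennreal (crossings \<phi> L \<omega>) \<partial>\<Omega>)"
      unfolding expected_crossings_def by (intro integral_eq_nn_integral) auto
    also have "\<dots> = enn2real (ennreal (t ^ 4 / 8) * ennreal v)"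
      unfolding nn_integral_crossings v(1)[symmetric] vol_part_def ..
    also have "\<dots> = t ^ 4 / 8 * v" using v(2) t_pos by (subst ennreal_mult[symmetric]) auto
    finally show ?thesis .
  qed
  have zv: "z \<le> v"
  proof -
    have "I2 (vol_part_le R) \<le> I2 vol_part"
      by (rule I2_mono_AE) (auto simp: vol_part_le_def indicator_def)
    then show ?thesis using v z by simp
  qed
  have lower: "?I * (K_const * (?J R)\<^sup>2) \<le> z + 2 * slope * R * (K_const * (?J R)\<^sup>2)"
  proof -
    have "I2 (\<lambda>u z. ennreal ?I * main_part R u z) \<le> I2 (\<lambda>u z. vol_part_le R u z + ennreal (2 * slope * R) * main_part R u z)"
      by (rule I2_mono_AE) (rule main_part_le_vol_part[OF _ R])
    also have "\<dots> = I2 (vol_part_le R) + I2 (\<lambda>u z. ennreal (2 * slope * R) * main_part R u z)"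
      by (rule I2_add) measurable
    finally have "ennreal (?I * (K_const * (?J R)\<^sup>2)) \<le> ennreal z + ennreal (2 * slope * R) * ennreal (K_const * (?J R)\<^sup>2)"
      using I0 KJ by (simp add: I2_cmult I2_main_part ennreal_mult z(1))
    also have "\<dots> = ennreal (z + 2 * slope * R * (K_const * (?J R)\<^sup>2))"
      using z(2) KJ slope_nonneg R by (subst ennreal_plus) (auto simp: ennreal_mult)
    finally show ?thesis using z(2) KJ slope_nonneg R by (subst (asm) ennreal_le_iff) auto
  qed
  have split: "v + ?I * (K_const * (?J R)\<^sup>2) \<le> z + ?I * (K_const * (?J D)\<^sup>2)" if "R \<le> D"
  proof -
    have "I2 (\<lambda>u z. vol_part u z + ennreal ?I * main_part R u z) \<le> I2 (\<lambda>u z. vol_part_le R u z + ennreal ?I * main_part D u z)"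
      by (rule I2_mono_AE) (rule vol_part_split[OF _ that])
    also have "\<dots> = I2 (vol_part_le R) + I2 (\<lambda>u z. ennreal ?I * main_part D u z)"
      by (rule I2_add) measurable
    also have "I2 (\<lambda>u z. vol_part u z + ennreal ?I * main_part R u z) = I2 vol_part + I2 (\<lambda>u z. ennreal ?I * main_part R u z)"
      by (rule I2_add) measurable
    finally have "ennreal v + ennreal (?I * (K_const * (?J R)\<^sup>2)) \<le> ennreal z + ennreal (?I * (K_const * (?J D)\<^sup>2))"
      using I0 KJ by (simp add: I2_cmult I2_main_part ennreal_mult z(1) v(1))
    then have "ennreal (v + ?I * (K_const * (?J R)\<^sup>2)) \<le> ennreal (z + ?I * (K_const * (?J D)\<^sup>2))"
      using v(2) z(2) I0 KJ by (subst (1 2) ennreal_plus) auto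
    then show ?thesis using v(2) z(2) I0 KJ by (subst (asm) ennreal_le_iff) auto
  qed
  have t8: "t ^ 4 / 8 \<ge> 0" using t_pos by simp
  show ?thesis
  proof (rule that[of z])
    show "0 \<le> z" by fact
    show "z \<le> ?I * K_const * (?J R)\<^sup>2" using upperR z I0 KJ[of R] by (simp add: mult.assoc)
    show "(?I - 2 * slope * R) * K_const * (?J R)\<^sup>2 \<le> z"
      using lower by (simp add: algebra_simps)
    show "t ^ 4 / 8 * z \<le> expected_crossings P \<kappa>v \<kappa>e \<phi> L"
      unfolding EX by (rule mult_left_mono[OF zv t8])
    show "expected_crossings P \<kappa>v \<kappa>e \<phi> L \<le> t ^ 4 / 8 * (z + ?I * K_const * ((?J D)\<^sup>2 - (?J R)\<^sup>2))" if "R \<le> D"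
      unfolding EX using split[OF that] by (intro mult_left_mono[OF _ t8]) (simp add: algebra_simps)
  qed
qed

end

text \<open>Here \<open>J1\<close> and \<open>J2\<close> are the integrals up to and beyond \<open>R\<close>, and \<open>z\<close> is the
  contribution of the edges of length at most \<open>R\<close>.\<close>

lemma expansion_errors:
  fixes A s :: real and mX J1 J2 z R :: "real \<Rightarrow> real"
  assumes A: "A > 0" and s: "s \<ge> 0"
    and R: "\<And>t. t > 0 \<Longrightarrow> R t \<ge> 0" "(R \<longlongrightarrow> 0) at_top"
    and J: "\<And>t. t > 0 \<Longrightarrow> J1 t \<ge> 0" "\<And>t. t > 0 \<Longrightarrow> J2 t \<ge> 0" "J2 \<in> o[at_top](J1)"
    and z: "\<And>t. t > 0 \<Longrightarrow> 0 \<le> z t" "\<And>t. t > 0 \<Longrightarrow> z t \<le> A * (J1 t)\<^sup>2" "\<And>t. t > 0 \<Longrightarrow> (1 - s * R t) * (A * (J1 t)\<^sup>2) \<le> z t"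
    and mX: "\<And>t. t > 0 \<Longrightarrow> t ^ 4 / 8 * z t \<le> mX t"
      "\<forall>\<^sub>F t in at_top. mX t \<le> t ^ 4 / 8 * (z t + A * ((J1 t + J2 t)\<^sup>2 - (J1 t)\<^sup>2))"
  shows "\<exists>e1 e2. e1 \<in> O[at_top](R) \<and> e2 \<in> O[at_top](\<lambda>t. J2 t / J1 t) \<and>
    (\<forall>\<^sub>F t in at_top. mX t = t ^ 4 / 8 * (A * (J1 t)\<^sup>2) * (1 + e1 t) * (1 + e2 t))"
proof -
  \<comment> \<open>The two relative errors: \<open>z\<close> against the main term, then
    \<open>mX\<close> against \<open>z\<close>. The default 0 is for a vanishing
    \<open>J1 t\<close>; for large t \<open>mX t\<close> then vanishes too, and the product formula
    reads 0 = 0.\<close>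
  define e1 where "e1 t = (if J1 t = 0 then 0 else z t / (A * (J1 t)\<^sup>2) - 1)" for t
  define e2 where "e2 t = (if J1 t = 0 then 0 else mX t / (t ^ 4 / 8 * z t) - 1)" for t
  have pos: "\<forall>\<^sub>F t in at_top. (t::real) > 0" by (rule eventually_gt_at_top)
  \<comment> \<open>Where this holds, \<open>z\<close> is at least half the main term, so one may
    divide by it if the main term is positive.\<close>
  have small: "\<forall>\<^sub>F t in at_top. s * R t < 1 / 2"
  proof -
    have "((\<lambda>t. s * R t) \<longlongrightarrow> s * 0) at_top" by (intro tendsto_intros R)
    then show ?thesis by (rule order_tendstoD) simp
  qed
  have J12: "\<forall>\<^sub>F t in at_top. norm (J2 t) \<le> 1 * norm (J1 t)"
    by (rule landau_o.smallD[OF J(3)]) simp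
  have 1: "\<bar>e1 t\<bar> \<le> s * \<bar>R t\<bar>" if t: "t > 0" for t
  proof (cases "J1 t = 0")
    case False
    then have M: "A * (J1 t)\<^sup>2 > 0" using A by simp
    have "z t / (A * (J1 t)\<^sup>2) \<le> 1" using z(2)[OF t] M by (simp add: divide_le_eq)
    moreover have "1 - s * R t \<le> z t / (A * (J1 t)\<^sup>2)" using z(3)[OF t] M by (simp add: le_divide_eq)
    ultimately show ?thesis using False R(1)[OF t] by (simp add: e1_def)
  qed (use s in \<open>auto simp: e1_def\<close>)
  have "e1 \<in> O[at_top](R)"
    by (rule bigoI[of _ s]) (use pos in eventually_elim, use 1 in simp)
  moreover have "e2 \<in> O[at_top](\<lambda>t. J2 t / J1 t)"
  \<comment> \<open>With x = J2 / J1 <= 1 the increment of the squares is x (2 + x) <= 3 x times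
    J1^2, and A J1^2 <= 2 z supplies the other factor 2.\<close>
  proof (rule bigoI[of _ 6])
    show "\<forall>\<^sub>F t in at_top. norm (e2 t) \<le> 6 * norm (J2 t / J1 t)"
      using pos small J12 mX(2)
    proof eventually_elim
      case (elim t)
      show ?case
      proof (cases "J1 t = 0")
        case False
        then have J1: "J1 t > 0" using J(1)[OF elim(1)] by simp
        then have M: "A * (J1 t)\<^sup>2 > 0" using A by simp
        have "1 / 2 * (A * (J1 t)\<^sup>2) \<le> (1 - s * R t) * (A * (J1 t)\<^sup>2)"
          using M elim(2) by (intro mult_right_mono) auto
        then have z2: "A * (J1 t)\<^sup>2 \<le> 2 * z t" using z(3)[OF elim(1)] by simp
        then have z0: "z t > 0" using M by simp
        define x where "x = J2 t / J1 t"
        have x: "0 \<le> x" "x \<le> 1" using J1 J(2)[OF elim(1)] elim(3) by (auto simp: x_def)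
        have J2: "J2 t = x * J1 t" using J1 by (simp add: x_def)
        have "A * ((J1 t + J2 t)\<^sup>2 - (J1 t)\<^sup>2) = (A * (J1 t)\<^sup>2) * (x * (2 + x))"
          unfolding J2 by (simp add: power2_eq_square algebra_simps)
        also have "\<dots> \<le> (2 * z t) * (x * 3)"
        proof (rule mult_mono[OF z2])
          show "x * (2 + x) \<le> x * 3" using x by (intro mult_left_mono) auto
        qed (use x z0 in auto)
        finally have "z t + A * ((J1 t + J2 t)\<^sup>2 - (J1 t)\<^sup>2) \<le> z t + (2 * z t) * (x * 3)" by simp
        then have "t ^ 4 / 8 * (z t + A * ((J1 t + J2 t)\<^sup>2 - (J1 t)\<^sup>2)) \<le> t ^ 4 / 8 * (z t + (2 * z t) * (x * 3))"
          using elim(1) by (intro mult_left_mono) auto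
        with elim(4) have up: "mX t \<le> t ^ 4 / 8 * (z t + (2 * z t) * (x * 3))" by linarith
        have T: "t ^ 4 / 8 * z t > 0" using elim(1) z0 by simp
        have "mX t / (t ^ 4 / 8 * z t) \<le> 1 + 6 * x"
          using up T by (simp add: divide_le_eq algebra_simps)
        moreover have "1 \<le> mX t / (t ^ 4 / 8 * z t)"
          using mX(1)[OF elim(1)] T by (simp add: le_divide_eq)
        ultimately show ?thesis using False x(1) by (simp add: e2_def x_def[symmetric])
      qed (simp add: e2_def)
    qed
  qed
  moreover have "\<forall>\<^sub>F t in at_top. mX t = t ^ 4 / 8 * (A * (J1 t)\<^sup>2) * (1 + e1 t) * (1 + e2 t)"
    using pos small J12 mX(2)
  proof eventually_elim
    case (elim t)
    show ?case
    proof (cases "J1 t = 0")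
      case True
      then have "J2 t = 0" using elim(3) by simp
      moreover have "z t = 0" using z(1,2)[OF elim(1)] True by simp
      ultimately have "mX t = 0" using elim(4) mX(1)[OF elim(1)] True by simp
      then show ?thesis using True by simp
    next
      case False
      then have M: "A * (J1 t)\<^sup>2 > 0" using A by simp
      have "1 / 2 * (A * (J1 t)\<^sup>2) \<le> (1 - s * R t) * (A * (J1 t)\<^sup>2)"
        using M elim(2) by (intro mult_right_mono) auto
      then have z0: "z t > 0" using z(3)[OF elim(1)] M by simp
      have cancel: "x * (1 + (y / x - 1)) = y" if "x > 0" for x y :: real using that by simp
      have "A * (J1 t)\<^sup>2 * (1 + e1 t) = z t"
        unfolding e1_def using cancel[OF M] False by (simp only: if_False)
      moreover have "t ^ 4 / 8 * z t > 0" using elim(1) z0 by simp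
      then have "t ^ 4 / 8 * z t * (1 + e2 t) = mX t"
        unfolding e2_def using cancel False by (simp only: if_False)
      ultimately show ?thesis by (simp only: mult.assoc)
    qed
  qed
  ultimately show ?thesis by blast
qed

theorem theoremA:
  fixes W :: "'a::euclidean_space set"
  assumes "DIM('a) \<ge> 2"
    and "compact W" and "convex W" and "interior W \<noteq> {}"
    and "measure lborel W = 1"
  shows "\<exists>c1 c1' c2 c2' :: real. c1 > 0 \<and> c1' > 0 \<and> c2 > 0 \<and> c2' > 0 \<and>
    (\<forall>L (P :: real \<Rightarrow> 'a config measure) \<kappa>v \<kappa>e \<phi>.
      subspace L \<and> dim L = 2 \<and> (\<forall>t>0. marked_model W t (P t) (\<kappa>v t) (\<kappa>e t) (\<phi> t)) \<longrightarrow>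
      (let mX = (\<lambda>t. expected_crossings (P t) (\<kappa>v t) (\<kappa>e t) (\<phi> t) L);
           g = (\<lambda>t. connection_fun (\<kappa>v t) (\<kappa>e t) (\<phi> t));
           J = (\<lambda>t a b. LBINT x:{a..b}. g t x * x ^ DIM('a))
       in
        (\<forall>t>0. c1' * t ^ 4 * (J t 0 c1)\<^sup>2 \<le> mX t \<and> mX t \<le> c2' * t ^ 4 * (J t 0 c2)\<^sup>2) \<and>
        (\<forall>R :: real \<Rightarrow> real.
          (\<forall>t>0. R t \<ge> 0) \<and> (R \<longlongrightarrow> 0) at_top \<and>
          (\<lambda>t. J t (R t) c2) \<in> o[at_top](\<lambda>t. J t 0 (R t)) \<longrightarrow>
          (\<exists>e1 e2 :: real \<Rightarrow> real.
            e1 \<in> O[at_top](R) \<and>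
            e2 \<in> O[at_top](\<lambda>t. J t (R t) c2 / J t 0 (R t)) \<and>
            (\<forall>\<^sub>F t in at_top.
              mX t = t ^ 4 * (J t 0 (R t))\<^sup>2 * (1 / 8) * c_const (DIM('a)) * (real (DIM('a)) + 1)\<^sup>2
                * I_W W L * (1 + e1 t) * (1 + e2 t))))))"
proof -
  let ?d = "DIM('a)"
  obtain p0 \<rho> where \<rho>: "\<rho> > 0" "cball p0 \<rho> \<subseteq> W"
    using assms(4) by (metis ex_in_conv mem_interior_cball)
  obtain e where e: "\<And>x y. x \<in> W \<Longrightarrow> y \<in> W \<Longrightarrow> dist x y \<le> e"
    using compact_imp_bounded[OF assms(2)] bounded_two_points[of W] by auto
  \<comment> \<open>The maximum with 1 makes the diameter bound positive by construction.\<close>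
  define D0 where "D0 = max e 1"
  have D0: "D0 > 0" by (simp add: D0_def)
  have D: "norm (x - y) \<le> D0" if "x \<in> W" "y \<in> W" for x y
    using e[OF that] by (simp add: D0_def dist_norm)
  have Wb: "W \<in> sets borel" using assms(2) by (simp add: borel_closed compact_imp_closed)
  have Wv: "emeasure lborel W = 1"
    using emeasure_eq_ennreal_measure[of lborel W] emeasure_bounded_finite[OF compact_imp_bounded[OF assms(2)]] assms(5) by simp
  have body: "body L p q W D0 \<rho> p0" if "subspace L" "subspace_basis L = {p, q}" "p \<noteq> q" for L p q
    by unfold_locales (use that Wb Wv \<rho> D0 D assms(3) in auto)
  \<comment> \<open>\<open>hm\<close>, \<open>sl\<close> and \<open>K\<close> repeat constants of
    the locales at a place where no plane is fixed yet, and \<open>Im\<close> is the lower bound of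
    \<open>I_W_ge\<close>. The constants of the theorem are thus chosen before
    \<open>L\<close>.\<close>
  define hm where "hm = unit_ball_vol (?d - 2) * D0 ^ (?d - 2)"
  define sl where "sl = hm * (?d / \<rho>)"
  define K where "K = (real ?d + 1)\<^sup>2 * c_const ?d"
  define Im where "Im = 1 / (pi * D0\<^sup>2)"
  have hm: "hm > 0" using D0 by (simp add: hm_def)
  have sl: "sl > 0" using hm \<rho> by (simp add: sl_def)
  have Im: "Im > 0" using D0 by (simp add: Im_def)
  have K: "K > 0"
    using c_const_pos[OF assms(1)] by (simp add: K_def)
  \<comment> \<open>Chosen so that \<open>2 * sl * c1 = Im / 2\<close>: for edges up to this length
    at least half of the lower bound \<open>Im\<close> survives, and this half turns 1/8 into
    1/16.\<close>
  define c1 where "c1 = Im / (4 * sl)"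
  have c1: "c1 > 0" using Im sl by (simp add: c1_def)
  have main: "(let mX = (\<lambda>t. expected_crossings (P t) (\<kappa>v t) (\<kappa>e t) (\<phi> t) L);
           g = (\<lambda>t. connection_fun (\<kappa>v t) (\<kappa>e t) (\<phi> t));
           J = (\<lambda>t a b. LBINT x:{a..b}. g t x * x ^ DIM('a))
       in
        (\<forall>t>0. Im * K / 16 * t ^ 4 * (J t 0 c1)\<^sup>2 \<le> mX t \<and> mX t \<le> hm * K / 8 * t ^ 4 * (J t 0 D0)\<^sup>2) \<and>
        (\<forall>R :: real \<Rightarrow> real.
          (\<forall>t>0. R t \<ge> 0) \<and> (R \<longlongrightarrow> 0) at_top \<and>
          (\<lambda>t. J t (R t) D0) \<in> o[at_top](\<lambda>t. J t 0 (R t)) \<longrightarrow>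
          (\<exists>e1 e2 :: real \<Rightarrow> real.
            e1 \<in> O[at_top](R) \<and>
            e2 \<in> O[at_top](\<lambda>t. J t (R t) D0 / J t 0 (R t)) \<and>
            (\<forall>\<^sub>F t in at_top.
              mX t = t ^ 4 * (J t 0 (R t))\<^sup>2 * (1 / 8) * c_const (DIM('a)) * (real (DIM('a)) + 1)\<^sup>2
                * I_W W L * (1 + e1 t) * (1 + e2 t)))))"
    if L: "subspace L" "dim L = 2" and mm: "\<forall>t>0. marked_model W t (P t) (\<kappa>v t) (\<kappa>e t) (\<phi> t)"
    for L and P :: "real \<Rightarrow> 'a config measure" and \<kappa>v \<kappa>e \<phi>
  proof -
    have "card (subspace_basis L) = 2"
      using orthonormal_basis_card[OF orthonormal_basis_subspace_basis[OF L(1)]] L(2) by simp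
    then obtain p q where pq: "subspace_basis L = {p, q}" "p \<noteq> q" by (meson card_2_iff)
    interpret B: body L p q W D0 \<rho> p0 by (rule body[OF L(1) pq])
    define I where "I = I_W W L"
    have I: "Im \<le> I" "I \<le> hm" "I > 0"
      using B.I_W_ge B.I_W_le B.I_W_pos by (auto simp: I_def Im_def hm_def B.h_max_def)
    have slope: "B.slope = sl" by (simp add: B.slope_def sl_def hm_def B.h_max_def)
    define mX where "mX t = expected_crossings (P t) (\<kappa>v t) (\<kappa>e t) (\<phi> t) L" for t
    define J where "J t a b = (LBINT x:{a..b}. connection_fun (\<kappa>v t) (\<kappa>e t) (\<phi> t) x * x ^ ?d)" for t a b
    have marks: "marks (\<kappa>v t) (\<kappa>e t) (\<phi> t)" if "t > 0" for t
      using mm[rule_format, OF that] unfolding marked_model_def by (intro marks.intro) blast+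
    have J_marks: "J t a b = marks.J (\<kappa>v t) (\<kappa>e t) (\<phi> t) ?d a b" if "t > 0" for t a b
      unfolding J_def marks.J_def[OF marks[OF that]] ..
    have model: "crossing_model L p q W D0 \<rho> p0 (\<kappa>v t) (\<kappa>e t) (\<phi> t) t (P t)" if "t > 0" for t
    proof (intro crossing_model.intro crossing_model_axioms.intro B.body_axioms marks that)
      show "poisson_process W t (P t)" using mm[rule_format, OF that] unfolding marked_model_def by blast
    qed
    have J_nonneg: "J t a b \<ge> 0" if "t > 0" "a \<ge> 0" for t a b
      using marks.J_eq(2)[OF marks[OF that(1)] that(2)] J_marks[OF that(1)] by simp
    have J_add: "J t 0 D0 = J t 0 R + J t R D0" if "t > 0" "0 \<le> R" "R \<le> D0" for t R
      unfolding J_marks[OF that(1)] by (rule marks.J_add[OF marks[OF that(1)]]) (use that in auto)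
    have key: "\<exists>z. 0 \<le> z \<and> z \<le> I * K * (J t 0 R)\<^sup>2 \<and> (I - 2 * sl * R) * K * (J t 0 R)\<^sup>2 \<le> z \<and> t ^ 4 / 8 * z \<le> mX t \<and>
      (R \<le> D0 \<longrightarrow> mX t \<le> t ^ 4 / 8 * (z + I * K * ((J t 0 D0)\<^sup>2 - (J t 0 R)\<^sup>2)))" if t: "t > 0" and R: "R \<ge> 0" for t R
      using crossing_model.expected_crossings_estimates[OF model[OF t] R]
      unfolding slope crossing_model.K_const_def[OF model[OF t]] K_def[symmetric] I_def[symmetric] mX_def J_marks[OF t] by blast
    have bounds: "Im * K / 16 * t ^ 4 * (J t 0 c1)\<^sup>2 \<le> mX t \<and> mX t \<le> hm * K / 8 * t ^ 4 * (J t 0 D0)\<^sup>2" if t: "t > 0" for t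
    proof
      obtain z where z: "(I - 2 * sl * c1) * K * (J t 0 c1)\<^sup>2 \<le> z" "t ^ 4 / 8 * z \<le> mX t"
        using key[OF t, of c1] c1 by auto
      have "Im / 2 \<le> I - 2 * sl * c1" using I sl by (simp add: c1_def)
      then have "Im / 2 * (K * (J t 0 c1)\<^sup>2) \<le> (I - 2 * sl * c1) * (K * (J t 0 c1)\<^sup>2)"
        using K by (intro mult_right_mono) auto
      also have "\<dots> \<le> z" using z(1) by (simp add: mult.assoc)
      finally have "t ^ 4 / 8 * (Im / 2 * (K * (J t 0 c1)\<^sup>2)) \<le> t ^ 4 / 8 * z"
        using t by (intro mult_left_mono) auto
      then show "Im * K / 16 * t ^ 4 * (J t 0 c1)\<^sup>2 \<le> mX t" using z(2) by (simp add: mult_ac)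
      \<comment> \<open>At R = D0 the difference of squares is 0, so the main term bounds the whole
        mean.\<close>
      obtain z' where z': "z' \<le> I * K * (J t 0 D0)\<^sup>2" "mX t \<le> t ^ 4 / 8 * z'"
        using key[OF t, of D0] D0 by auto
      have "I * (K * (J t 0 D0)\<^sup>2) \<le> hm * (K * (J t 0 D0)\<^sup>2)" using I K by (intro mult_right_mono) auto
      then have "z' \<le> hm * (K * (J t 0 D0)\<^sup>2)" using z'(1) by (simp add: mult.assoc)
      then have "t ^ 4 / 8 * z' \<le> t ^ 4 / 8 * (hm * (K * (J t 0 D0)\<^sup>2))" using t by (intro mult_left_mono) auto
      then show "mX t \<le> hm * K / 8 * t ^ 4 * (J t 0 D0)\<^sup>2" using z'(2) by (simp add: mult_ac)
    qed
    have expansion: "\<exists>e1 e2 :: real \<Rightarrow> real. e1 \<in> O[at_top](R) \<and> e2 \<in> O[at_top](\<lambda>t. J t (R t) D0 / J t 0 (R t)) \<and>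
            (\<forall>\<^sub>F t in at_top. mX t = t ^ 4 * (J t 0 (R t))\<^sup>2 * (1 / 8) * c_const ?d * (real ?d + 1)\<^sup>2
                * I_W W L * (1 + e1 t) * (1 + e2 t))"
      if R: "\<forall>t>0. R t \<ge> 0" "(R \<longlongrightarrow> 0) at_top" and o: "(\<lambda>t. J t (R t) D0) \<in> o[at_top](\<lambda>t. J t 0 (R t))" for R
    proof -
      have "\<forall>t. \<exists>z. t > 0 \<longrightarrow> (0 \<le> z \<and> z \<le> I * K * (J t 0 (R t))\<^sup>2 \<and> (I - 2 * sl * R t) * K * (J t 0 (R t))\<^sup>2 \<le> z \<and> t ^ 4 / 8 * z \<le> mX t \<and>
        (R t \<le> D0 \<longrightarrow> mX t \<le> t ^ 4 / 8 * (z + I * K * ((J t 0 D0)\<^sup>2 - (J t 0 (R t))\<^sup>2))))"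
        using key R(1) by blast
      then obtain z where z: "\<And>t. t > 0 \<Longrightarrow> 0 \<le> z t" "\<And>t. t > 0 \<Longrightarrow> z t \<le> I * K * (J t 0 (R t))\<^sup>2"
        "\<And>t. t > 0 \<Longrightarrow> (I - 2 * sl * R t) * K * (J t 0 (R t))\<^sup>2 \<le> z t" "\<And>t. t > 0 \<Longrightarrow> t ^ 4 / 8 * z t \<le> mX t"
        "\<And>t. t > 0 \<Longrightarrow> R t \<le> D0 \<Longrightarrow> mX t \<le> t ^ 4 / 8 * (z t + I * K * ((J t 0 D0)\<^sup>2 - (J t 0 (R t))\<^sup>2))"
        by metis
      have "\<exists>e1 e2. e1 \<in> O[at_top](R) \<and> e2 \<in> O[at_top](\<lambda>t. J t (R t) D0 / J t 0 (R t)) \<and>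
        (\<forall>\<^sub>F t in at_top. mX t = t ^ 4 / 8 * (I * K * (J t 0 (R t))\<^sup>2) * (1 + e1 t) * (1 + e2 t))"
      \<comment> \<open>Dividing the absolute loss \<open>2 * sl * R t\<close> by \<open>I\<close>
        makes it relative.\<close>
      proof (rule expansion_errors[where s="2 * sl / I" and z=z])
        show "(1 - 2 * sl / I * R t) * (I * K * (J t 0 (R t))\<^sup>2) \<le> z t" if "t > 0" for t
        proof -
          have "(1 - 2 * sl / I * R t) * I = I - 2 * sl * R t" using I(3) by (simp add: left_diff_distrib)
          then show ?thesis using z(3)[OF that] by (simp only: mult.assoc[symmetric])
        qed
        \<comment> \<open>The upper estimate is available for \<open>R t <= D0\<close>, which holds
          eventually because \<open>R\<close> tends to 0.\<close>
        have "\<forall>\<^sub>F t in at_top. R t < D0" by (rule order_tendstoD(2)[OF R(2) D0])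
        then show "\<forall>\<^sub>F t in at_top. mX t \<le> t ^ 4 / 8 * (z t + I * K * ((J t 0 (R t) + J t (R t) D0)\<^sup>2 - (J t 0 (R t))\<^sup>2))"
          using eventually_gt_at_top[of 0]
          by eventually_elim (use z(5) J_add R(1) in auto)
      qed (use I K sl R o z J_nonneg in auto)
      moreover have "t ^ 4 / 8 * (I * K * (J t 0 (R t))\<^sup>2) = t ^ 4 * (J t 0 (R t))\<^sup>2 * (1 / 8) * c_const ?d * (real ?d + 1)\<^sup>2 * I_W W L" for t
        by (simp add: K_def I_def)
      ultimately show ?thesis by (simp only:)
    qed
    show ?thesis
      unfolding Let_def J_def[symmetric] mX_def[symmetric] using bounds expansion by blast
  qed
  show ?thesis
    by (rule exI[of _ c1], rule exI[of _ "Im * K / 16"], rule exI[of _ D0], rule exI[of _ "hm * K / 8"])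
       (use c1 Im K D0 hm main in auto)
qed

end
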